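(* Let $X$ be the mixed moving average process with generating quadruple $(a,b,\lambda,\pi)$ and kernel $f$ described in the context, and let $X^*(t)=\int_0^tX(u)\,du$. Suppose $a=0$, $b>0$ and $\lambda\equiv0$. If $0<\int_Vf_1(x)^2\,\pi(dx)<\infty$, then $$\limsup_{t\to\infty}\frac{|X^*(t)|}{\sqrt{2b\int_Vf_1^2\,d\pi\;t\log\log t}}=1\quad\text{a.s.}$$
   Context: Let $V$ be a Lusin space (a Hausdorff space that is the image of a Polish space under a continuous bijection) with its Borel $\sigma$-algebra and a $\sigma$-finite measure $\pi$; $\mathrm{Leb}$ is Lebesgue measure on $\mathbb R$. Let $a\in\mathbb R$, $b\ge 0$ and let $\lambda$ be a Lévy measure on $\mathbb R$. $\Lambda$ is a homogeneous infinitely divisible independently scattered random measure (Lévy basis) on $V\times\mathbb R$ with generating quadruple $(a,b,\lambda,\pi)$: for every Borel $A\subset V\times\mathbb R$ with $(\pi\times\mathrm{Leb})(A)<\infty$ and $\theta\in\mathbb R$, $$\log \mathbb E e^{i\theta\Lambda(A)}=(\pi\times\mathrm{Leb})(A)\Big(i\theta a-\tfrac{\theta^2}{2}b+\int_{\mathbb R}(e^{i\theta z}-1-i\theta z\mathbf 1(|z|\le1))\lambda(dz)\Big).$$ Integrals of deterministic functions with respect to $\Lambda$ are in the sense of Rajput–Rosiński (limits in probability of integrals of approximating simple functions). The kernel $f:V\times\mathbb R\to[0,\infty)$ is measurable, $\Lambda$-integrable, belongs to $L^1(\pi\times\mathrm{Leb})$, and $f(x,v)=0$ for $v<0$. The mixed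 moving average (MMA) process is $X(t)=\int_{V\times\mathbb R}f(x,t-s)\,\Lambda(dx,ds)$, and the integrated process is $X^*(t)=\int_0^tX(u)\,du$, $t\ge0$ (for a measurable modification of $X$ with locally integrable paths). Here $f_1(x)=\int_0^\infty f(x,v)\,dv$, $x\in V$. *)

theory Defs
  imports "HOL-Probability.Probability"
begin

(* A Polish space that maps bijectively onto T can be carried over to the points of T, so
   it is no restriction that P lives on the same type as T. *)
definition lusin_space :: "'a topology \<Rightarrow> bool" where
  "lusin_space T \<longleftrightarrow> Hausdorff_space T \<and>
     (\<exists>(P :: 'a topology) g. completely_metrizable_space P \<and> separable_space P \<and>
        continuous_map P T g \<and> bij_betw g (topspace P) (topspace T))"

definition levy_measure :: "real measure \<Rightarrow> bool" where
  "levy_measure \<nu> \<longleftrightarrow> sets \<nu> = sets borel \<and> emeasure \<nu> {0} = 0 \<and>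
     (\<integral>\<^sup>+ z. ennreal (min 1 (z\<^sup>2)) \<partial>\<nu>) < \<infinity>"

definition levy_exponent :: "real \<Rightarrow> real \<Rightarrow> real measure \<Rightarrow> real \<Rightarrow> complex" where
  "levy_exponent a b \<nu> \<theta> =
     \<i> * of_real (\<theta> * a) - of_real (\<theta>\<^sup>2 / 2 * b) +
     (CLINT z|\<nu>. iexp (\<theta> * z) - 1 - \<i> * of_real (\<theta> * z * indicator {z. \<bar>z\<bar> \<le> 1} z))"

definition finite_sets :: "'a measure \<Rightarrow> 'a set set" where
  "finite_sets N = {A \<in> sets N. emeasure N A < \<infinity>}"

(* Homogeneous infinitely divisible independently scattered random measure on V * R with
   generating quadruple (a, b, \<nu>, \<pi>), as a process indexed by the delta-ring of sets of
   finite measure under the product of \<pi> and Lebesgue measure; the values of \<Lambda> on other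
   sets carry no meaning. When V is Lusin, the product sigma-algebra of the Borel
   sigma-algebras is the Borel sigma-algebra of V * R. The logarithm of the characteristic
   function is the distinguished one, which is what the exponential form says. *)
locale levy_basis = prob_space M + base: sigma_finite_measure \<pi>
  for M :: "'w measure" and \<pi> :: "'v::topological_space measure"
    and a b :: real and \<nu> :: "real measure" and \<Lambda> :: "('v \<times> real) set \<Rightarrow> 'w \<Rightarrow> real" +
  assumes sets_base: "sets \<pi> = sets borel"
    and variance_nonneg: "0 \<le> b"
    and levy_measure: "levy_measure \<nu>"
    and random_variable:
      "A \<in> finite_sets (\<pi> \<Otimes>\<^sub>M lborel) \<Longrightarrow> random_variable borel (\<Lambda> A)"
    and independently_scattered:
      "\<lbrakk>range B \<subseteq> finite_sets (\<pi> \<Otimes>\<^sub>M lborel); disjoint_family B\<rbrakk>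
       \<Longrightarrow> indep_vars (\<lambda>_. borel) (\<lambda>n::nat. \<Lambda> (B n)) UNIV"
    and countably_additive:
      "\<lbrakk>range B \<subseteq> finite_sets (\<pi> \<Otimes>\<^sub>M lborel); disjoint_family B;
        (\<Union>n::nat. B n) \<in> finite_sets (\<pi> \<Otimes>\<^sub>M lborel)\<rbrakk>
       \<Longrightarrow> AE \<omega> in M. (\<lambda>n. \<Lambda> (B n) \<omega>) sums \<Lambda> (\<Union>n. B n) \<omega>"
    and char_basis:
      "A \<in> finite_sets (\<pi> \<Otimes>\<^sub>M lborel) \<Longrightarrow>
       (CLINT \<omega>|M. iexp (\<theta> * \<Lambda> A \<omega>)) =
         exp (of_real (measure (\<pi> \<Otimes>\<^sub>M lborel) A) * levy_exponent a b \<nu> \<theta>)"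

definition tendsto_in_prob :: "'w measure \<Rightarrow> (nat \<Rightarrow> 'w \<Rightarrow> real) \<Rightarrow> ('w \<Rightarrow> real) \<Rightarrow> bool" where
  "tendsto_in_prob M Y Z \<longleftrightarrow> Z \<in> borel_measurable M \<and>
     (\<forall>\<epsilon>>0. (\<lambda>n. measure M {\<omega> \<in> space M. \<epsilon> < \<bar>Y n \<omega> - Z \<omega>\<bar>}) \<longlonglongrightarrow> 0)"

(* The integral over A of a simple function g whose support has finite measure, computed
   from the representation of g by its nonzero values and their level sets. *)
definition simple_levy_integral ::
  "'a measure \<Rightarrow> ('a set \<Rightarrow> 'w \<Rightarrow> real) \<Rightarrow> 'a set \<Rightarrow> ('a \<Rightarrow> real) \<Rightarrow> 'w \<Rightarrow> real" where
  "simple_levy_integral N \<Lambda> A g \<omega> =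
     (\<Sum>y\<in>g ` space N - {0}. y * \<Lambda> (A \<inter> {z \<in> space N. g z = y}) \<omega>)"

(* Rajput-Rosinski integral: Y is a version of the integral of g over the whole space.
   Integrals over every measurable A must converge in probability along the approximating
   sequence. The control measure of a homogeneous basis is a constant multiple of the
   measure N (zero only if a, b and the Levy measure all vanish), so "almost everywhere" refers to N. *)
definition has_levy_integral ::
  "'w measure \<Rightarrow> 'a measure \<Rightarrow> ('a set \<Rightarrow> 'w \<Rightarrow> real) \<Rightarrow> ('a \<Rightarrow> real) \<Rightarrow> ('w \<Rightarrow> real) \<Rightarrow> bool" where
  "has_levy_integral M N \<Lambda> g Y \<longleftrightarrow> g \<in> borel_measurable N \<and>
     (\<exists>h :: nat \<Rightarrow> 'a \<Rightarrow> real.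
        (\<forall>n. simple_function N (h n) \<and> {z \<in> space N. h n z \<noteq> 0} \<in> finite_sets N) \<and>
        (AE z in N. (\<lambda>n. h n z) \<longlonglongrightarrow> g z) \<and>
        (\<forall>A\<in>sets N. \<exists>Z. tendsto_in_prob M (\<lambda>n. simple_levy_integral N \<Lambda> A (h n)) Z) \<and>
        tendsto_in_prob M (\<lambda>n. simple_levy_integral N \<Lambda> (space N) (h n)) Y)"

definition levy_integrable ::
  "'w measure \<Rightarrow> 'a measure \<Rightarrow> ('a set \<Rightarrow> 'w \<Rightarrow> real) \<Rightarrow> ('a \<Rightarrow> real) \<Rightarrow> bool" where
  "levy_integrable M N \<Lambda> g \<longleftrightarrow> (\<exists>Y. has_levy_integral M N \<Lambda> g Y)"

definition mma_kernel ::
  "'w measure \<Rightarrow> 'v measure \<Rightarrow> (('v \<times> real) set \<Rightarrow> 'w \<Rightarrow> real) \<Rightarrow> ('v \<times> real \<Rightarrow> real) \<Rightarrow> bool" where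
  "mma_kernel M \<pi> \<Lambda> f \<longleftrightarrow>
     f \<in> borel_measurable (\<pi> \<Otimes>\<^sub>M lborel) \<and> (\<forall>z. 0 \<le> f z) \<and>
     (\<forall>x v. v < 0 \<longrightarrow> f (x, v) = 0) \<and>
     integrable (\<pi> \<Otimes>\<^sub>M lborel) f \<and>
     levy_integrable M (\<pi> \<Otimes>\<^sub>M lborel) \<Lambda> f"

(* X is a jointly measurable version, with almost surely locally integrable paths, of the
   process whose value at t is the integral of (x, s) \<mapsto> f (x, t - s). *)
definition mma_process ::
  "'w measure \<Rightarrow> 'v measure \<Rightarrow> (('v \<times> real) set \<Rightarrow> 'w \<Rightarrow> real) \<Rightarrow> ('v \<times> real \<Rightarrow> real) \<Rightarrow>
   (real \<Rightarrow> 'w \<Rightarrow> real) \<Rightarrow> bool" where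
  "mma_process M \<pi> \<Lambda> f X \<longleftrightarrow>
     (\<forall>t\<ge>0. has_levy_integral M (\<pi> \<Otimes>\<^sub>M lborel) \<Lambda> (\<lambda>(x, s). f (x, t - s)) (X t)) \<and>
     (\<lambda>(t, \<omega>). X t \<omega>) \<in> borel_measurable (restrict_space borel {0..} \<Otimes>\<^sub>M M) \<and>
     (AE \<omega> in M. \<forall>t\<ge>0. set_integrable lborel {0..t} (\<lambda>u. X u \<omega>))"

definition integrated_process :: "(real \<Rightarrow> 'w \<Rightarrow> real) \<Rightarrow> real \<Rightarrow> 'w \<Rightarrow> real" where
  "integrated_process X t \<omega> = (LINT u:{0..t}|lborel. X u \<omega>)"

definition kernel_mass :: "('v \<times> real \<Rightarrow> real) \<Rightarrow> 'v \<Rightarrow> ennreal" where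
  "kernel_mass f x = (\<integral>\<^sup>+ v\<in>{0..}. ennreal (f (x, v)) \<partial>lborel)"

end

theory Submission
  imports Defs
begin

text \<open>
  In the purely Gaussian case every \<open>\<Lambda>\<close>-integral is a mean-square limit of centred Gaussian
  variables and \<open>g \<mapsto> \<integral>g d\<Lambda>\<close> is \<open>\<surd>b\<close> times an isometry. Stochastic Fubini gives
  \<open>X\<^sup>*(t) = \<integral>F\<^sub>t d\<Lambda>\<close> with \<open>F\<^sub>t(x, s) = \<integral>\<^sub>0\<^sup>t f(x, u - s) du\<close>, and Tonelli gives
  \<open>\<parallel>F\<^sub>t - F\<^sub>s\<parallel>\<^sup>2 \<le> m (t - s)\<close> for \<open>m = \<integral>f\<^sub>1\<^sup>2 d\<pi>\<close>, so the increments of \<open>X\<^sup>*\<close> have the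
  sub-Gaussian tails of a Brownian motion of variance \<open>b m\<close>.

  Upper bound: Borel-Cantelli along \<open>\<rho>\<^sup>k\<close> with \<open>\<rho>\<close> close to 1. Between consecutive times a crude
  dyadic chaining bound suffices, since \<open>\<rho> - 1\<close> absorbs its constant.

  Lower bound: for large \<open>\<rho>\<close> almost all the mass of \<open>F\<^sub>t\<close>, \<open>t = \<rho>\<^sup>k\<^sup>+\<^sup>1\<close>, lies on
  \<open>V \<times> (\<rho>\<^sup>k, \<rho>\<^sup>k\<^sup>+\<^sup>1]\<close>. The integrals over these disjoint strips are independent because \<open>\<Lambda>\<close> is
  independently scattered, the second Borel-Cantelli lemma applies to them, and what is left of
  \<open>X\<^sup>*(\<rho>\<^sup>k\<^sup>+\<^sup>1)\<close> is negligible.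
\<close>

section \<open>Convergence in mean square\<close>

text \<open>The integral is defined by limits in probability and only up to null sets, so
  \<open>wiener\<close> relates an integrand to a version instead of being a function, and
  convergence must first be upgraded to mean square. The law of a general integral is never
  identified. Upper tail bounds survive mean-square limits, and they are all that the upper half and
  the remainder in the lower half require. Lower tail bounds and independence are used for simple
  integrands only, where they follow from the values of \<open>\<Lambda>\<close> on disjoint sets;
  hence the restrictions of \<open>F t\<close> to the strips are replaced by simple functions. The
  parameters are tied to \<epsilon>: in the upper half \<rho> - 1 = \<epsilon>^2 / 2 makes the
  chaining exponent exactly 2 log log, and in the lower half \<rho> >= 16 / \<epsilon>^2 makes the
  remainder exponent at least 2 log log. Both are summable along geometric times.\<close>

definition square_integrable :: "'a measure \<Rightarrow> ('a \<Rightarrow> real) \<Rightarrow> bool" where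
  "square_integrable N g \<longleftrightarrow> g \<in> borel_measurable N \<and> integrable N (\<lambda>z. (g z)\<^sup>2)"

lemma square_integrableD:
  assumes "square_integrable N g"
  shows "g \<in> borel_measurable N" "integrable N (\<lambda>z. (g z)\<^sup>2)"
  using assms by (auto simp: square_integrable_def)

lemma square_integrable_bound:
  assumes "square_integrable N g" "f \<in> borel_measurable N" "AE z in N. \<bar>f z\<bar> \<le> c * \<bar>g z\<bar>"
  shows "square_integrable N f"
  unfolding square_integrable_def
proof
  show "integrable N (\<lambda>z. (f z)\<^sup>2)"
  proof (rule Bochner_Integration.integrable_bound)
    show "integrable N (\<lambda>z. c\<^sup>2 * (g z)\<^sup>2)"
      using square_integrableD[OF assms(1)] by auto
    show "AE z in N. norm ((f z)\<^sup>2) \<le> norm (c\<^sup>2 * (g z)\<^sup>2)"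
      using assms(3)
    proof eventually_elim
      case (elim z)
      then have "\<bar>f z\<bar>\<^sup>2 \<le> (c * \<bar>g z\<bar>)\<^sup>2" by (intro power_mono) auto
      then show ?case by (simp add: power_mult_distrib)
    qed
  qed (use assms(2) in measurable)
qed fact

lemma square_integrable_mult:
  assumes "square_integrable N f" "square_integrable N g"
  shows "integrable N (\<lambda>z. f z * g z)"
proof (rule Bochner_Integration.integrable_bound)
  show "integrable N (\<lambda>z. (f z)\<^sup>2 + (g z)\<^sup>2)"
    using assms by (auto simp: square_integrable_def)
  show "(\<lambda>z. f z * g z) \<in> borel_measurable N"
    using assms by (auto simp: square_integrable_def)
  have "\<bar>x * y\<bar> \<le> x\<^sup>2 + y\<^sup>2" for x y :: real
  proof -
    have "2 * (\<bar>x\<bar> * \<bar>y\<bar>) \<le> x\<^sup>2 + y\<^sup>2"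
      using sum_squares_bound[of "\<bar>x\<bar>" "\<bar>y\<bar>"] by simp
    moreover have "0 \<le> \<bar>x\<bar> * \<bar>y\<bar>" by simp
    ultimately show ?thesis unfolding abs_mult by linarith
  qed
  then show "AE z in N. norm (f z * g z) \<le> norm ((f z)\<^sup>2 + (g z)\<^sup>2)"
    by (intro AE_I2) (simp add: abs_of_nonneg)
qed

lemma square_integrable_lincomb:
  assumes "square_integrable N f" "square_integrable N g"
  shows "square_integrable N (\<lambda>z. c * f z + d * g z)"
proof -
  have "integrable N (\<lambda>z. c\<^sup>2 * (f z)\<^sup>2 + 2 * c * d * (f z * g z) + d\<^sup>2 * (g z)\<^sup>2)"
    by (intro Bochner_Integration.integrable_add integrable_mult_right square_integrable_mult
        square_integrableD assms)
  moreover have "(\<lambda>z. (c * f z + d * g z)\<^sup>2) =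
      (\<lambda>z. c\<^sup>2 * (f z)\<^sup>2 + 2 * c * d * (f z * g z) + d\<^sup>2 * (g z)\<^sup>2)"
    by (auto simp: power2_eq_square algebra_simps)
  ultimately show ?thesis
    using assms by (auto simp: square_integrable_def)
qed

lemma square_integrable_diff:
  assumes "square_integrable N f" "square_integrable N g"
  shows "square_integrable N (\<lambda>z. f z - g z)"
  using square_integrable_lincomb[OF assms, of 1 "-1"] by simp

lemma integral_square_lincomb:
  assumes "square_integrable N f" "square_integrable N g"
  shows "(\<integral>z. (c * f z + d * g z)\<^sup>2 \<partial>N) =
    c\<^sup>2 * (\<integral>z. (f z)\<^sup>2 \<partial>N) + 2 * c * d * (\<integral>z. f z * g z \<partial>N) + d\<^sup>2 * (\<integral>z. (g z)\<^sup>2 \<partial>N)"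
proof -
  have "(\<lambda>z. (c * f z + d * g z)\<^sup>2) =
      (\<lambda>z. c\<^sup>2 * (f z)\<^sup>2 + 2 * c * d * (f z * g z) + d\<^sup>2 * (g z)\<^sup>2)"
    by (auto simp: power2_eq_square algebra_simps)
  then show ?thesis
    using assms square_integrable_mult[OF assms] square_integrableD(2)[OF assms(1)]
      square_integrableD(2)[OF assms(2)]
    by (simp add: Bochner_Integration.integral_add)
qed

lemma integral_square_diff:
  assumes "square_integrable N f" "square_integrable N g"
  shows "(\<integral>z. (f z - g z)\<^sup>2 \<partial>N) =
    (\<integral>z. (f z)\<^sup>2 \<partial>N) - 2 * (\<integral>z. f z * g z \<partial>N) + (\<integral>z. (g z)\<^sup>2 \<partial>N)"
  using integral_square_lincomb[OF assms, of 1 "-1"] by simp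

text \<open>Parallelogram law for f - g and h - g, with the square of their sum discarded.\<close>

lemma integral_square_diff_le:
  assumes "square_integrable N f" "square_integrable N h" "square_integrable N g"
  shows "(\<integral>z. (f z - h z)\<^sup>2 \<partial>N) \<le> 2 * (\<integral>z. (f z - g z)\<^sup>2 \<partial>N) + 2 * (\<integral>z. (h z - g z)\<^sup>2 \<partial>N)"
proof -
  note D = square_integrable_diff[OF assms(1,3)] and D' = square_integrable_diff[OF assms(2,3)]
  have "(\<integral>z. (f z - h z)\<^sup>2 \<partial>N) = (\<integral>z. (1 * (f z - g z) + (-1) * (h z - g z))\<^sup>2 \<partial>N)"
    by simp
  also have "\<dots> \<le> (\<integral>z. (1 * (f z - g z) + (-1) * (h z - g z))\<^sup>2 \<partial>N) +
      (\<integral>z. (1 * (f z - g z) + 1 * (h z - g z))\<^sup>2 \<partial>N)"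
    by simp
  also have "\<dots> = 2 * (\<integral>z. (f z - g z)\<^sup>2 \<partial>N) + 2 * (\<integral>z. (h z - g z)\<^sup>2 \<partial>N)"
    unfolding integral_square_lincomb[OF D D'] by simp
  finally show ?thesis .
qed

lemma Cauchy_Schwarz_integral:
  assumes f: "square_integrable N f" and g: "square_integrable N g"
  shows "\<bar>\<integral>z. f z * g z \<partial>N\<bar> \<le> sqrt (\<integral>z. (f z)\<^sup>2 \<partial>N) * sqrt (\<integral>z. (g z)\<^sup>2 \<partial>N)"
proof -
  define A B C where "A = (\<integral>z. (f z)\<^sup>2 \<partial>N)" and "B = (\<integral>z. (g z)\<^sup>2 \<partial>N)"
    and "C = (\<integral>z. f z * g z \<partial>N)"
  have *: "0 \<le> A + 2 * d * C + d\<^sup>2 * B" for d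
    using integral_square_lincomb[OF f g, of 1 d]
      Bochner_Integration.integral_nonneg[of N "\<lambda>z. (1 * f z + d * g z)\<^sup>2"]
    by (simp add: A_def B_def C_def)
  have "0 \<le> A" "0 \<le> B" by (auto simp: A_def B_def)
  have "C\<^sup>2 \<le> A * B"
  proof (cases "B = 0")
    case True
    have "C = 0"
    proof (rule ccontr)
      assume "C \<noteq> 0"
      \<comment> \<open>With B = 0 the quadratic is affine in d, and this d gives it the value A -
        (A + 1) = -1.\<close>
      then show False using *[of "- (A + 1) / (2 * C)"] True by (simp add: field_simps)
    qed
    then show ?thesis using True by simp
  next
    case False
    with \<open>0 \<le> B\<close> have "0 < B" by simp
    \<comment> \<open>The choice d = -C / B minimises the quadratic.\<close>
    have "0 \<le> A + 2 * (- C / B) * C + (- C / B)\<^sup>2 * B" by (rule *)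
    also have "\<dots> = A - C\<^sup>2 / B"
      using \<open>0 < B\<close> by (simp add: power2_eq_square field_simps)
    finally show ?thesis using \<open>0 < B\<close> by (simp add: field_simps)
  qed
  then have "sqrt (C\<^sup>2) \<le> sqrt (A * B)" by (rule real_sqrt_le_mono)
  then show ?thesis by (simp add: real_sqrt_mult A_def B_def C_def)
qed

section \<open>Mean-square limits of sequences\<close>

definition l2_tendsto :: "'a measure \<Rightarrow> (nat \<Rightarrow> 'a \<Rightarrow> real) \<Rightarrow> ('a \<Rightarrow> real) \<Rightarrow> bool" where
  "l2_tendsto N h g \<longleftrightarrow> (\<forall>n. square_integrable N (h n)) \<and> square_integrable N g \<and>
     (\<lambda>n. \<integral>z. (h n z - g z)\<^sup>2 \<partial>N) \<longlonglongrightarrow> 0"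

lemma l2_tendstoD:
  assumes "l2_tendsto N h g"
  shows "square_integrable N (h n)" "square_integrable N g"
    "(\<lambda>n. \<integral>z. (h n z - g z)\<^sup>2 \<partial>N) \<longlonglongrightarrow> 0"
  using assms by (auto simp: l2_tendsto_def)

lemma l2_tendsto_const: "square_integrable N g \<Longrightarrow> l2_tendsto N (\<lambda>_. g) g"
  by (simp add: l2_tendsto_def)

lemma l2_tendsto_inner_const:
  assumes "l2_tendsto N h g" "square_integrable N k"
  shows "(\<lambda>n. \<integral>z. h n z * k z \<partial>N) \<longlonglongrightarrow> (\<integral>z. g z * k z \<partial>N)"
proof (rule LIM_zero_cancel, rule Lim_null_comparison)
  note h = l2_tendstoD[OF assms(1)]
  show "(\<lambda>n. sqrt (\<integral>z. (h n z - g z)\<^sup>2 \<partial>N) * sqrt (\<integral>z. (k z)\<^sup>2 \<partial>N)) \<longlonglongrightarrow> 0"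
    using tendsto_mult[OF tendsto_real_sqrt[OF h(3)] tendsto_const] by simp
  have "(\<integral>z. h n z * k z \<partial>N) - (\<integral>z. g z * k z \<partial>N) = (\<integral>z. (h n z - g z) * k z \<partial>N)" for n
    using square_integrable_mult[OF h(1) assms(2)] square_integrable_mult[OF h(2) assms(2)]
    by (simp add: left_diff_distrib)
  then show "\<forall>\<^sub>F n in sequentially. norm ((\<integral>z. h n z * k z \<partial>N) - (\<integral>z. g z * k z \<partial>N))
      \<le> sqrt (\<integral>z. (h n z - g z)\<^sup>2 \<partial>N) * sqrt (\<integral>z. (k z)\<^sup>2 \<partial>N)"
    using Cauchy_Schwarz_integral[OF square_integrable_diff[OF h(1) h(2)] assms(2)]
    by simp
qed

text \<open>Expanding the square expresses the norm of h n through its distance to g and its inner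
  product with the fixed g, and both of these converge.\<close>

lemma l2_tendsto_square:
  assumes "l2_tendsto N h g"
  shows "(\<lambda>n. \<integral>z. (h n z)\<^sup>2 \<partial>N) \<longlonglongrightarrow> (\<integral>z. (g z)\<^sup>2 \<partial>N)"
proof -
  note h = l2_tendstoD[OF assms]
  have "(\<lambda>n. (\<integral>z. (h n z - g z)\<^sup>2 \<partial>N) + 2 * (\<integral>z. h n z * g z \<partial>N) - (\<integral>z. (g z)\<^sup>2 \<partial>N))
     \<longlonglongrightarrow> 0 + 2 * (\<integral>z. g z * g z \<partial>N) - (\<integral>z. (g z)\<^sup>2 \<partial>N)"
    by (intro tendsto_intros h(3) l2_tendsto_inner_const assms h(2))
  then show ?thesis
    by (simp add: integral_square_diff[OF h(1) h(2)] power2_eq_square[of "g _"])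
qed

lemma l2_tendsto_lincomb:
  assumes "l2_tendsto N h g" "l2_tendsto N h' g'"
  shows "l2_tendsto N (\<lambda>n z. c * h n z + d * h' n z) (\<lambda>z. c * g z + d * g' z)"
  unfolding l2_tendsto_def
proof (intro conjI allI)
  note h = l2_tendstoD[OF assms(1)] and h' = l2_tendstoD[OF assms(2)]
  show "square_integrable N (\<lambda>z. c * h n z + d * h' n z)" for n
    by (intro square_integrable_lincomb h h')
  show "square_integrable N (\<lambda>z. c * g z + d * g' z)"
    by (intro square_integrable_lincomb h h')
  let ?D = "\<lambda>n z. h n z - g z" and ?D' = "\<lambda>n z. h' n z - g' z"
  show "(\<lambda>n. \<integral>z. (c * h n z + d * h' n z - (c * g z + d * g' z))\<^sup>2 \<partial>N) \<longlonglongrightarrow> 0"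
  proof (rule tendsto_sandwich[OF _ _ tendsto_const])
    show "(\<lambda>n. 2 * c\<^sup>2 * (\<integral>z. (?D n z)\<^sup>2 \<partial>N) + 2 * d\<^sup>2 * (\<integral>z. (?D' n z)\<^sup>2 \<partial>N)) \<longlonglongrightarrow> 0"
      using tendsto_add[OF tendsto_mult_left[OF h(3)] tendsto_mult_left[OF h'(3)]] by simp
    have "(\<integral>z. (c * h n z + d * h' n z - (c * g z + d * g' z))\<^sup>2 \<partial>N)
      \<le> 2 * c\<^sup>2 * (\<integral>z. (?D n z)\<^sup>2 \<partial>N) + 2 * d\<^sup>2 * (\<integral>z. (?D' n z)\<^sup>2 \<partial>N)" for n
    proof -
      note D = square_integrable_diff[OF h(1)[of n] h(2)]
      note D' = square_integrable_diff[OF h'(1)[of n] h'(2)]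
      have "(\<integral>z. (c * h n z + d * h' n z - (c * g z + d * g' z))\<^sup>2 \<partial>N) =
        (\<integral>z. (c * ?D n z + d * ?D' n z)\<^sup>2 \<partial>N)"
        by (simp add: algebra_simps)
      also have "\<dots> \<le> (\<integral>z. (c * ?D n z + d * ?D' n z)\<^sup>2 \<partial>N) + (\<integral>z. (c * ?D n z + (- d) * ?D' n z)\<^sup>2 \<partial>N)"
        by simp
      also have "\<dots> = 2 * c\<^sup>2 * (\<integral>z. (?D n z)\<^sup>2 \<partial>N) + 2 * d\<^sup>2 * (\<integral>z. (?D' n z)\<^sup>2 \<partial>N)"
        unfolding integral_square_lincomb[OF D D'] by simp
      finally show ?thesis .
    qed
    then show "\<forall>\<^sub>F n in sequentially. (\<integral>z. (c * h n z + d * h' n z - (c * g z + d * g' z))\<^sup>2 \<partial>N)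
      \<le> 2 * c\<^sup>2 * (\<integral>z. (?D n z)\<^sup>2 \<partial>N) + 2 * d\<^sup>2 * (\<integral>z. (?D' n z)\<^sup>2 \<partial>N)" by simp
  qed (simp add: always_eventually)
qed

text \<open>The limit is already identified almost everywhere along a subsequence, so Fatou's lemma
  turns the Cauchy bound directly into convergence to it. It is applied on the index space with the
  full sequence, and on the probability space with a subsequence extracted from convergence in
  probability.\<close>

lemma l2_tendsto_of_Cauchy_AE:
  assumes sq: "\<And>n. square_integrable N (h n)"
    and Cauchy: "\<And>e. 0 < e \<Longrightarrow> \<exists>K. \<forall>n\<ge>K. \<forall>m\<ge>K. (\<integral>z. (h n z - h m z)\<^sup>2 \<partial>N) \<le> e"
    and r: "strict_mono (r :: nat \<Rightarrow> nat)"
    and lim: "AE z in N. (\<lambda>k. h (r k) z) \<longlonglongrightarrow> g z"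
    and g[measurable]: "g \<in> borel_measurable N"
  shows "l2_tendsto N h g"
proof -
  note [measurable] = square_integrableD(1)[OF sq]
  have bound: "(\<integral>\<^sup>+z. ennreal ((h n z - g z)\<^sup>2) \<partial>N) \<le> ennreal e"
    if K: "\<And>n m. n \<ge> K \<Longrightarrow> m \<ge> K \<Longrightarrow> (\<integral>z. (h n z - h m z)\<^sup>2 \<partial>N) \<le> e" and n: "n \<ge> K" and "0 < e"
    for e K n
  proof -
    have "(\<integral>\<^sup>+z. ennreal ((h n z - g z)\<^sup>2) \<partial>N) = (\<integral>\<^sup>+z. liminf (\<lambda>k. ennreal ((h n z - h (r k) z)\<^sup>2)) \<partial>N)"
    proof (rule nn_integral_cong_AE)
      show "AE z in N. ennreal ((h n z - g z)\<^sup>2) = liminf (\<lambda>k. ennreal ((h n z - h (r k) z)\<^sup>2))"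
        using lim
      proof eventually_elim
        case (elim z)
        have "(\<lambda>k. ennreal ((h n z - h (r k) z)\<^sup>2)) \<longlonglongrightarrow> ennreal ((h n z - g z)\<^sup>2)"
          by (intro tendsto_intros elim tendsto_ennrealI)
        then show ?case by (intro lim_imp_Liminf[symmetric]) auto
      qed
    qed
    also have "\<dots> \<le> liminf (\<lambda>k. \<integral>\<^sup>+z. ennreal ((h n z - h (r k) z)\<^sup>2) \<partial>N)"
      by (rule nn_integral_liminf) simp
    also have "\<dots> \<le> ennreal e"
    proof (rule Liminf_le)
      have "(\<integral>\<^sup>+z. ennreal ((h n z - h (r k) z)\<^sup>2) \<partial>N) \<le> ennreal e" if "k \<ge> K" for k
      proof -
        have "(\<integral>\<^sup>+z. ennreal ((h n z - h (r k) z)\<^sup>2) \<partial>N) = ennreal (\<integral>z. (h n z - h (r k) z)\<^sup>2 \<partial>N)"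
          by (intro nn_integral_eq_integral square_integrableD(2) square_integrable_diff sq) auto
        also have "\<dots> \<le> ennreal e"
          using seq_suble[OF r, of k] that by (intro ennreal_leI K n) auto
        finally show ?thesis .
      qed
      then show "\<forall>\<^sub>F k in sequentially. (\<integral>\<^sup>+z. ennreal ((h n z - h (r k) z)\<^sup>2) \<partial>N) \<le> ennreal e"
        by (auto simp: eventually_sequentially)
    qed simp
    finally show ?thesis .
  qed
  have diff: "square_integrable N (\<lambda>z. h n z - g z)"
    if K: "\<And>n m. n \<ge> K \<Longrightarrow> m \<ge> K \<Longrightarrow> (\<integral>z. (h n z - h m z)\<^sup>2 \<partial>N) \<le> 1" and n: "n \<ge> K" for K n
    unfolding square_integrable_def
  proof
    have "(\<integral>\<^sup>+z. ennreal ((h n z - g z)\<^sup>2) \<partial>N) < \<infinity>"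
      using bound[OF K n] by (auto simp: order_le_less_trans)
    then show "integrable N (\<lambda>z. (h n z - g z)\<^sup>2)"
      by (auto intro: integrableI_bounded)
  qed simp
  obtain K where K: "\<And>n m. n \<ge> K \<Longrightarrow> m \<ge> K \<Longrightarrow> (\<integral>z. (h n z - h m z)\<^sup>2 \<partial>N) \<le> 1"
    using Cauchy[of 1] by auto
  \<comment> \<open>One square-integrable difference h K - g already puts g itself into the
    space.\<close>
  have "square_integrable N (\<lambda>z. h K z - (h K z - g z))"
    by (rule square_integrable_diff[OF sq diff[OF K]]) auto
  then have sqg: "square_integrable N g" by simp
  have "(\<lambda>n. \<integral>z. (h n z - g z)\<^sup>2 \<partial>N) \<longlonglongrightarrow> 0"
  proof (rule LIMSEQ_I)
    fix e :: real assume "0 < e"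
    then obtain K where K: "\<And>n m. n \<ge> K \<Longrightarrow> m \<ge> K \<Longrightarrow> (\<integral>z. (h n z - h m z)\<^sup>2 \<partial>N) \<le> e / 2"
      using Cauchy[of "e / 2"] by auto
    have "norm ((\<integral>z. (h n z - g z)\<^sup>2 \<partial>N) - 0) < e" if "n \<ge> K" for n
    proof -
      have "ennreal (\<integral>z. (h n z - g z)\<^sup>2 \<partial>N) \<le> ennreal (e / 2)"
        using bound[OF K that] \<open>0 < e\<close>
        by (subst nn_integral_eq_integral[symmetric])
           (auto intro!: square_integrableD(2) square_integrable_diff sq sqg)
      then have "(\<integral>z. (h n z - g z)\<^sup>2 \<partial>N) \<le> e / 2"
        using \<open>0 < e\<close> by (simp add: ennreal_le_iff)
      moreover have "0 \<le> (\<integral>z. (h n z - g z)\<^sup>2 \<partial>N)" by simp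
      ultimately show ?thesis using \<open>0 < e\<close> by simp
    qed
    then show "\<exists>K. \<forall>n\<ge>K. norm ((\<integral>z. (h n z - g z)\<^sup>2 \<partial>N) - 0) < e" by blast
  qed
  then show ?thesis using sq sqg by (simp add: l2_tendsto_def)
qed

section \<open>Centred Gaussian variables\<close>

text \<open>The image of the standard normal law under scaling, so that \<open>\<sigma> = 0\<close> is included.\<close>

definition centered_gaussian :: "'w measure \<Rightarrow> real \<Rightarrow> ('w \<Rightarrow> real) \<Rightarrow> bool" where
  "centered_gaussian M \<sigma> Y \<longleftrightarrow> Y \<in> borel_measurable M \<and>
     distr M borel Y = distr std_normal_distribution borel (\<lambda>x. \<sigma> * x)"

lemma centered_gaussianD:
  "centered_gaussian M \<sigma> Y \<Longrightarrow> Y \<in> borel_measurable M"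
  by (simp add: centered_gaussian_def)

lemma (in prob_space) centered_gaussian_of_char:
  assumes [measurable]: "random_variable borel Y"
    and char: "\<And>\<theta>. (CLINT \<omega>|M. iexp (\<theta> * Y \<omega>)) = exp (of_real (- (\<sigma> * \<theta>)\<^sup>2 / 2))"
  shows "centered_gaussian M \<sigma> Y"
  unfolding centered_gaussian_def
proof
  interpret std: real_distribution std_normal_distribution by (rule real_dist_normal_dist)
  have m: "(\<lambda>x. \<sigma> * x) \<in> borel_measurable std_normal_distribution" by simp
  show "distr M borel Y = distr std_normal_distribution borel (\<lambda>x. \<sigma> * x)"
  proof (rule Levy_uniqueness)
    show "real_distribution (distr M borel Y)" by (rule real_distribution_distr) fact
    show "real_distribution (distr std_normal_distribution borel (\<lambda>x. \<sigma> * x))"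
      by (rule std.real_distribution_distr[OF m])
    show "char (distr M borel Y) = char (distr std_normal_distribution borel (\<lambda>x. \<sigma> * x))"
    proof
      fix \<theta>
      have "char (distr std_normal_distribution borel (\<lambda>x. \<sigma> * x)) \<theta> = char std_normal_distribution (\<sigma> * \<theta>)"
        unfolding char_def by (subst integral_distr[OF m]) (auto simp: ac_simps)
      also have "\<dots> = exp (of_real (- (\<sigma> * \<theta>)\<^sup>2 / 2))"
        by (simp only: char_std_normal_distribution exp_of_real)
      also have "\<dots> = char (distr M borel Y) \<theta>"
        unfolding char_def char[symmetric] by (subst integral_distr) auto
      finally show "char (distr M borel Y) \<theta> = char (distr std_normal_distribution borel (\<lambda>x. \<sigma> * x)) \<theta>" ..
    qed
  qed
qed fact

lemma centered_gaussian_prob: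
  assumes "centered_gaussian M \<sigma> Y" and B: "B \<in> sets borel"
  shows "measure M {\<omega> \<in> space M. Y \<omega> \<in> B} = measure std_normal_distribution {x. \<sigma> * x \<in> B}"
proof -
  have m: "(\<lambda>x. \<sigma> * x) \<in> borel_measurable std_normal_distribution" by simp
  have "measure M {\<omega> \<in> space M. Y \<omega> \<in> B} = measure (distr M borel Y) B"
    using assms by (subst measure_distr) (auto simp: centered_gaussian_def intro!: arg_cong[where f="measure M"])
  also have "\<dots> = measure std_normal_distribution {x. \<sigma> * x \<in> B}"
    using assms by (simp add: centered_gaussian_def measure_distr[OF m B] vimage_def)
  finally show ?thesis .
qed

lemma centered_gaussian_square_integrable:
  assumes "centered_gaussian M \<sigma> Y"
  shows "square_integrable M Y" "(\<integral>\<omega>. (Y \<omega>)\<^sup>2 \<partial>M) = \<sigma>\<^sup>2"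
proof -
  note m [measurable] = centered_gaussianD[OF assms]
  have [measurable]: "(\<lambda>x. \<sigma> * x) \<in> borel_measurable std_normal_distribution" by simp
  have d: "distr M borel Y = distr std_normal_distribution borel (\<lambda>x. \<sigma> * x)"
    using assms by (simp add: centered_gaussian_def)
  have "integrable (distr M borel Y) (\<lambda>x. x\<^sup>2)"
    unfolding d using integrable_std_normal_distribution_moment[of 2]
    by (subst integrable_distr_eq) (auto simp: power_mult_distrib)
  then show "square_integrable M Y"
    by (subst (asm) integrable_distr_eq) (auto simp: square_integrable_def)
  have "(\<integral>\<omega>. (Y \<omega>)\<^sup>2 \<partial>M) = (\<integral>x. x\<^sup>2 \<partial>distr M borel Y)"
    by (subst integral_distr) auto
  also have "\<dots> = (\<integral>x. (\<sigma> * x)\<^sup>2 \<partial>std_normal_distribution)"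
    unfolding d by (subst integral_distr) auto
  also have "\<dots> = \<sigma>\<^sup>2"
    using std_normal_distribution_even_moments(1)[of 1]
    by (simp add: power_mult_distrib fact_numeral)
  finally show "(\<integral>\<omega>. (Y \<omega>)\<^sup>2 \<partial>M) = \<sigma>\<^sup>2" .
qed

text \<open>On each tail the standard normal density is at most exp (-x^2 / 2) times the normal
  density centred at the edge of the tail, and the latter has total mass 1. The sign
  \<open>s\<close> treats both tails at once.\<close>

lemma std_normal_tail_upper:
  assumes "0 \<le> x"
  shows "measure std_normal_distribution {x<..} \<le> exp (- x\<^sup>2 / 2)"
    and "measure std_normal_distribution {..<-x} \<le> exp (- x\<^sup>2 / 2)"
proof -
  have *: "measure std_normal_distribution A \<le> exp (- x\<^sup>2 / 2)"
    if [measurable]: "A \<in> sets borel" and s: "\<bar>s\<bar> = 1" and A: "\<And>z. z \<in> A \<Longrightarrow> x \<le> s * z" for A s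
  proof -
    have s2: "s\<^sup>2 = 1" using s by (metis power2_abs one_power2)
    have "emeasure std_normal_distribution A = (\<integral>\<^sup>+z. ennreal (std_normal_density z) * indicator A z \<partial>lborel)"
      by (simp add: emeasure_density)
    also have "\<dots> \<le> (\<integral>\<^sup>+z. ennreal (exp (- x\<^sup>2 / 2)) * ennreal (normal_density (s * x) 1 z) \<partial>lborel)"
    proof (rule nn_integral_mono)
      fix z :: real
      have "std_normal_density z \<le> exp (- x\<^sup>2 / 2) * normal_density (s * x) 1 z" if "z \<in> A"
      proof -
        \<comment> \<open>As \<open>s\<^sup>2 = 1\<close>, expanding the next inequality gives
          exactly twice this one.\<close>
        have "0 \<le> x * (s * z - x)" using A[OF that] assms by simp
        then have "x\<^sup>2 + (z - s * x)\<^sup>2 \<le> z\<^sup>2"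
          using s2 by (simp add: power2_diff power_mult_distrib) (simp add: power2_eq_square algebra_simps)
        then have "exp (- z\<^sup>2 / 2) \<le> exp (- x\<^sup>2 / 2) * exp (- (z - s * x)\<^sup>2 / 2)"
          unfolding mult_exp_exp by (simp add: field_simps)
        then show ?thesis
          by (simp add: normal_density_def divide_right_mono)
      qed
      then show "ennreal (std_normal_density z) * indicator A z
          \<le> ennreal (exp (- x\<^sup>2 / 2)) * ennreal (normal_density (s * x) 1 z)"
        by (auto simp: indicator_def ennreal_mult[symmetric] intro!: ennreal_leI)
    qed
    also have "\<dots> = ennreal (exp (- x\<^sup>2 / 2))"
      by (subst nn_integral_cmult) (auto simp: nn_integral_eq_integral)
    finally show ?thesis
      by (simp add: measure_def enn2real_leI)
  qed
  show "measure std_normal_distribution {x<..} \<le> exp (- x\<^sup>2 / 2)"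
    by (rule *[of _ 1]) auto
  show "measure std_normal_distribution {..<-x} \<le> exp (- x\<^sup>2 / 2)"
    by (rule *[of _ "-1"]) auto
qed

text \<open>On (x, x + 1] the density is at least its value at the right end. The shift by 1 is of
  lower order for large x and replaces the factor 1/x of the sharp bound.\<close>

lemma std_normal_tail_lower:
  assumes "0 \<le> x"
  shows "exp (- (x + 1)\<^sup>2 / 2) / sqrt (2 * pi) \<le> measure std_normal_distribution {x<..}"
proof -
  interpret std: real_distribution std_normal_distribution by (rule real_dist_normal_dist)
  have "ennreal (exp (- (x + 1)\<^sup>2 / 2) / sqrt (2 * pi)) =
      (\<integral>\<^sup>+z. ennreal (std_normal_density (x + 1)) * indicator {x<..x+1} z \<partial>lborel)"
    by (simp add: nn_integral_cmult_indicator std_normal_density_def)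
  also have "\<dots> \<le> (\<integral>\<^sup>+z. ennreal (std_normal_density z) * indicator {x<..} z \<partial>lborel)"
    using assms by (intro nn_integral_mono)
      (auto simp: indicator_def std_normal_density_def intro!: ennreal_leI divide_right_mono power_mono)
  also have "\<dots> = emeasure std_normal_distribution {x<..}"
    by (simp add: emeasure_density)
  also have "\<dots> = ennreal (measure std_normal_distribution {x<..})"
    by (simp add: std.emeasure_eq_measure)
  finally show ?thesis by (simp add: ennreal_le_iff)
qed

text \<open>Working with a positive bound v for the variance covers degenerate laws and lets the
  variance vary along a sequence.\<close>

lemma centered_gaussian_tail_upper:
  assumes Y: "centered_gaussian M \<sigma> Y" and "\<sigma>\<^sup>2 \<le> v" "0 < v" "0 \<le> x"
  shows "measure M {\<omega> \<in> space M. x < \<bar>Y \<omega>\<bar>} \<le> 2 * exp (- x\<^sup>2 / (2 * v))"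
proof -
  interpret std: real_distribution std_normal_distribution by (rule real_dist_normal_dist)
  have eq: "measure M {\<omega> \<in> space M. x < \<bar>Y \<omega>\<bar>} = measure std_normal_distribution {z. x < \<bar>\<sigma>\<bar> * \<bar>z\<bar>}"
    using centered_gaussian_prob[OF Y, of "{y. x < \<bar>y\<bar>}"] by (simp add: abs_mult)
  show ?thesis
  proof (cases "\<sigma> = 0")
    case True
    then show ?thesis using assms eq by simp
  next
    case False
    define y where "y = x / \<bar>\<sigma>\<bar>"
    have "0 \<le> y" using assms by (simp add: y_def)
    have "{z. x < \<bar>\<sigma>\<bar> * \<bar>z\<bar>} = {y<..} \<union> {..<-y}"
    proof -
      have "x < \<bar>\<sigma>\<bar> * \<bar>z\<bar> \<longleftrightarrow> y < \<bar>z\<bar>" for z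
        using False pos_divide_less_eq[of "\<bar>\<sigma>\<bar>" x "\<bar>z\<bar>"] unfolding y_def by (simp add: mult.commute)
      then have "{z. x < \<bar>\<sigma>\<bar> * \<bar>z\<bar>} = {z. y < \<bar>z\<bar>}" by presburger
      also have "{z. y < \<bar>z\<bar>} = {y<..} \<union> {..<-y}" using \<open>0 \<le> y\<close>
        by (intro set_eqI) (simp add: abs_real_def; linarith)
      finally show ?thesis .
    qed
    then have "measure M {\<omega> \<in> space M. x < \<bar>Y \<omega>\<bar>} \<le>
        measure std_normal_distribution {y<..} + measure std_normal_distribution {..<-y}"
      unfolding eq by (simp add: measure_Un_le)
    also have "\<dots> \<le> 2 * exp (- y\<^sup>2 / 2)"
      using std_normal_tail_upper[OF \<open>0 \<le> y\<close>] by simp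
    finally have le: "measure M {\<omega> \<in> space M. x < \<bar>Y \<omega>\<bar>} \<le> 2 * exp (- y\<^sup>2 / 2)" .
    have "y\<^sup>2 / 2 = x\<^sup>2 / (2 * \<sigma>\<^sup>2)"
      by (simp add: y_def power_divide)
    then have "- y\<^sup>2 / 2 \<le> - x\<^sup>2 / (2 * v)"
      using assms False by (simp add: frac_le)
    then have "2 * exp (- y\<^sup>2 / 2) \<le> 2 * exp (- x\<^sup>2 / (2 * v))" by simp
    with le show ?thesis by (rule order_trans)
  qed
qed

lemma centered_gaussian_tail_lower:
  assumes Y: "centered_gaussian M \<sigma> Y" and "0 < \<sigma>" "0 \<le> x"
  shows "exp (- (x / \<sigma> + 1)\<^sup>2 / 2) / sqrt (2 * pi) \<le> measure M {\<omega> \<in> space M. x < Y \<omega>}"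
proof -
  have "measure M {\<omega> \<in> space M. x < Y \<omega>} = measure std_normal_distribution {z. x < \<sigma> * z}"
    using centered_gaussian_prob[OF Y, of "{x<..}"] by simp
  also have "{z. x < \<sigma> * z} = {x / \<sigma><..}"
    using assms by (auto simp: field_simps)
  finally show ?thesis using std_normal_tail_lower[of "x / \<sigma>"] assms by simp
qed

section \<open>The integral of simple functions\<close>

text \<open>The condition that \<open>has_levy_integral\<close> puts on its approximants. Finite
  support keeps every nonzero level set among the sets on which \<Lambda> has a meaning.\<close>

definition simple_finite :: "'a measure \<Rightarrow> ('a \<Rightarrow> real) \<Rightarrow> bool" where
  "simple_finite N h \<longleftrightarrow> simple_function N h \<and> {z \<in> space N. h z \<noteq> 0} \<in> finite_sets N"

lemma finite_sets_subset:
  assumes "A \<in> finite_sets N" "B \<in> sets N" "B \<subseteq> A"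
  shows "B \<in> finite_sets N"
  using assms emeasure_mono[of B A N] by (auto simp: finite_sets_def order_le_less_trans)

lemma empty_finite_sets [simp]: "{} \<in> finite_sets N"
  by (simp add: finite_sets_def)

lemma Un_finite_sets [simp]:
  assumes "A \<in> finite_sets N" "B \<in> finite_sets N"
  shows "A \<union> B \<in> finite_sets N"
  using assms emeasure_subadditive[of A N B]
  by (auto simp: finite_sets_def order_le_less_trans)

lemma UN_finite_sets:
  assumes "finite J" "\<And>j. j \<in> J \<Longrightarrow> B j \<in> finite_sets N"
  shows "(\<Union>j\<in>J. B j) \<in> finite_sets N"
  using assms by (induction J rule: finite_induct) auto

lemma simple_finite_level_set:
  assumes "simple_finite N h" "y \<noteq> 0"
  shows "{z \<in> space N. h z = y} \<in> finite_sets N"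
proof (rule finite_sets_subset)
  show "{z \<in> space N. h z \<noteq> 0} \<in> finite_sets N" using assms by (simp add: simple_finite_def)
  have "h -` {y} \<inter> space N \<in> sets N"
    using assms by (intro simple_functionD(2)) (simp add: simple_finite_def)
  also have "h -` {y} \<inter> space N = {z \<in> space N. h z = y}" by auto
  finally show "{z \<in> space N. h z = y} \<in> sets N" .
qed (use assms in auto)

lemma simple_finite_measurable: "simple_finite N h \<Longrightarrow> h \<in> borel_measurable N"
  by (simp add: simple_finite_def borel_measurable_simple_function)

lemma simple_finite_finite: "simple_finite N h \<Longrightarrow> finite (h ` space N)"
  by (auto simp: simple_finite_def dest: simple_functionD(1))

lemma simple_finite_lincomb:
  assumes "simple_finite N h" "simple_finite N g"
  shows "simple_finite N (\<lambda>z. c * h z + d * g z)"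
  unfolding simple_finite_def
proof
  show s: "simple_function N (\<lambda>z. c * h z + d * g z)"
    using assms by (auto simp: simple_finite_def)
  show "{z \<in> space N. c * h z + d * g z \<noteq> 0} \<in> finite_sets N"
  proof (rule finite_sets_subset)
    show "{z \<in> space N. h z \<noteq> 0} \<union> {z \<in> space N. g z \<noteq> 0} \<in> finite_sets N"
      using assms by (simp add: simple_finite_def)
    show "{z \<in> space N. c * h z + d * g z \<noteq> 0} \<in> sets N"
      using borel_measurable_simple_function[OF s] by measurable
  qed auto
qed

lemma simple_finite_integral_square:
  assumes h: "simple_finite N h"
  shows "square_integrable N h"
    "(\<integral>z. (h z)\<^sup>2 \<partial>N) = (\<Sum>y\<in>h ` space N - {0}. y\<^sup>2 * measure N {z \<in> space N. h z = y})"
proof -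
  let ?Y = "h ` space N - {0}" and ?B = "\<lambda>y. {z \<in> space N. h z = y}"
  have fin: "finite ?Y" using simple_finite_finite[OF h] by simp
  have B: "?B y \<in> sets N" "emeasure N (?B y) < \<infinity>" if "y \<in> ?Y" for y
    using simple_finite_level_set[OF h, of y] that by (auto simp: finite_sets_def)
  have eq: "(h z)\<^sup>2 = (\<Sum>y\<in>?Y. y\<^sup>2 * indicator (?B y) z)" if z: "z \<in> space N" for z
  proof (cases "h z = 0")
    case True
    then have "(\<Sum>y\<in>?Y. y\<^sup>2 * indicator (?B y) z) = (0::real)"
      by (intro sum.neutral) (auto simp: indicator_def)
    then show ?thesis using True by simp
  next
    case False
    have "(\<Sum>y\<in>?Y. y\<^sup>2 * indicator (?B y) z) = (\<Sum>y\<in>{h z}. y\<^sup>2 * indicator (?B y) z)"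
      using z False fin by (intro sum.mono_neutral_right) (auto simp: indicator_def)
    then show ?thesis using z by (simp add: indicator_def)
  qed
  have int: "integrable N (\<lambda>z. \<Sum>y\<in>?Y. y\<^sup>2 * indicator (?B y) z)"
    using B by (intro Bochner_Integration.integrable_sum integrable_mult_right) auto
  show "square_integrable N h"
    unfolding square_integrable_def
    using simple_finite_measurable[OF h] int by (simp add: eq cong: Bochner_Integration.integrable_cong)
  have "(\<integral>z. (h z)\<^sup>2 \<partial>N) = (\<integral>z. (\<Sum>y\<in>?Y. y\<^sup>2 * indicator (?B y) z) \<partial>N)"
    by (intro Bochner_Integration.integral_cong refl eq)
  also have "\<dots> = (\<Sum>y\<in>?Y. \<integral>z. y\<^sup>2 * indicator (?B y) z \<partial>N)"
    using B by (intro Bochner_Integration.integral_sum integrable_mult_right) auto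
  also have "\<dots> = (\<Sum>y\<in>?Y. y\<^sup>2 * measure N (?B y))"
    using B by (intro sum.cong) (auto simp: Int_absorb2 sets.sets_into_space)
  finally show "(\<integral>z. (h z)\<^sup>2 \<partial>N) = (\<Sum>y\<in>?Y. y\<^sup>2 * measure N (?B y))" .
qed

section \<open>The Gaussian random measure\<close>

locale gaussian_basis = levy_basis M \<pi> 0 b "null_measure borel" \<Lambda>
  for M :: "'w measure" and \<pi> :: "'v::topological_space measure" and b :: real
    and \<Lambda> :: "('v \<times> real) set \<Rightarrow> 'w \<Rightarrow> real"
begin

definition N :: "('v \<times> real) measure" where "N = \<pi> \<Otimes>\<^sub>M lborel"

lemmas random_variable_\<Lambda> = random_variable[folded N_def]
  and countably_additive_\<Lambda> = countably_additive[folded N_def]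
  and independently_scattered_\<Lambda> = independently_scattered[folded N_def]

abbreviation I :: "('v \<times> real \<Rightarrow> real) \<Rightarrow> 'w \<Rightarrow> real" where
  "I \<equiv> simple_levy_integral N \<Lambda> (space N)"

lemma I_eq: "I h \<omega> = (\<Sum>y\<in>h ` space N - {0}. y * \<Lambda> {z \<in> space N. h z = y} \<omega>)"
proof -
  have "space N \<inter> {z \<in> space N. h z = y} = {z \<in> space N. h z = y}" for y by auto
  then show ?thesis by (simp add: simple_levy_integral_def)
qed

lemma random_variable_I:
  assumes "simple_finite N h"
  shows "random_variable borel (I h)"
proof -
  have "random_variable borel (\<lambda>\<omega>. \<Sum>y\<in>h ` space N - {0}. y * \<Lambda> {z \<in> space N. h z = y} \<omega>)"
    by (intro borel_measurable_sum borel_measurable_times borel_measurable_const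
        random_variable_\<Lambda> simple_finite_level_set assms) auto
  then show ?thesis by (simp add: I_eq[abs_def])
qed

text \<open>Countable additivity over empty sets gives a convergent series with constant terms, so
  the term is 0. Finite additivity, obtained by padding with empty sets, rests on this.\<close>

lemma \<Lambda>_empty: "AE \<omega> in M. \<Lambda> {} \<omega> = 0"
proof -
  have "AE \<omega> in M. (\<lambda>n::nat. \<Lambda> {} \<omega>) sums \<Lambda> {} \<omega>"
    using countably_additive_\<Lambda>[of "\<lambda>_. {}"] by (simp add: disjoint_family_on_def)
  then show ?thesis
  proof eventually_elim
    case (elim \<omega>)
    then have "(\<lambda>n::nat. \<Lambda> {} \<omega>) \<longlonglongrightarrow> 0" by (intro summable_LIMSEQ_zero) (simp add: sums_iff)
    then show ?case by (simp add: LIMSEQ_const_iff)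
  qed
qed

lemma \<Lambda>_Un:
  assumes "A \<in> finite_sets N" "B \<in> finite_sets N" "A \<inter> B = {}"
  shows "AE \<omega> in M. \<Lambda> (A \<union> B) \<omega> = \<Lambda> A \<omega> + \<Lambda> B \<omega>"
proof -
  have "AE \<omega> in M. (\<lambda>n. \<Lambda> (binaryset A B n) \<omega>) sums \<Lambda> (\<Union>n. binaryset A B n) \<omega>"
  proof (rule countably_additive_\<Lambda>)
    show "range (binaryset A B) \<subseteq> finite_sets N" using assms by (simp add: range_binaryset_eq)
    show "disjoint_family (binaryset A B)"
      using assms by (auto simp: disjoint_family_on_def binaryset_def)
    show "(\<Union>n. binaryset A B n) \<in> finite_sets N" using assms by (simp add: UN_binaryset_eq)
  qed
  with \<Lambda>_empty show ?thesis
  proof eventually_elim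
    case (elim \<omega>)
    then show ?case
      using binaryset_sums[of "\<lambda>X. \<Lambda> X \<omega>" A B] by (auto simp: UN_binaryset_eq intro: sums_unique2)
  qed
qed

lemma \<Lambda>_UN:
  assumes "finite J" "\<And>j. j \<in> J \<Longrightarrow> B j \<in> finite_sets N" "disjoint_family_on B J"
  shows "AE \<omega> in M. \<Lambda> (\<Union>j\<in>J. B j) \<omega> = (\<Sum>j\<in>J. \<Lambda> (B j) \<omega>)"
  using assms
proof (induction J rule: finite_induct)
  case empty
  then show ?case using \<Lambda>_empty by simp
next
  case (insert i J)
  have "AE \<omega> in M. \<Lambda> (B i \<union> (\<Union>j\<in>J. B j)) \<omega> = \<Lambda> (B i) \<omega> + \<Lambda> (\<Union>j\<in>J. B j) \<omega>"
    using insert by (intro \<Lambda>_Un UN_finite_sets) (auto simp: disjoint_family_on_def)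
  moreover have "AE \<omega> in M. \<Lambda> (\<Union>j\<in>J. B j) \<omega> = (\<Sum>j\<in>J. \<Lambda> (B j) \<omega>)"
    using insert by (intro insert.IH) (auto simp: disjoint_family_on_def)
  ultimately show ?case
    by eventually_elim (use insert in simp)
qed

text \<open>The integral is defined through level sets; up to a null set, any disjoint
  representation gives the same value. Pieces with equal coefficient are merged into one level set
  by finite additivity.\<close>

lemma I_representation:
  assumes J: "finite J" and B: "\<And>j. j \<in> J \<Longrightarrow> B j \<in> finite_sets N" and dis: "disjoint_family_on B J"
    and h: "\<And>z. z \<in> space N \<Longrightarrow> h z = (\<Sum>j\<in>J. c j * indicator (B j) z)"
  shows "AE \<omega> in M. I h \<omega> = (\<Sum>j\<in>J. c j * \<Lambda> (B j) \<omega>)"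
proof -
  have sp: "B j \<subseteq> space N" if "j \<in> J" for j
    using B[OF that] sets.sets_into_space[of "B j" N] by (simp add: finite_sets_def)
  have hB: "h z = c j" if "j \<in> J" "z \<in> B j" for j z
  proof -
    have "(\<Sum>i\<in>J. c i * indicator (B i) z) = (\<Sum>i\<in>{j}. c i * indicator (B i) z)"
      using J that dis by (intro sum.mono_neutral_right) (auto simp: disjoint_family_on_def indicator_def)
    then show ?thesis using that sp h[of z] by auto
  qed
  have h0: "\<exists>j\<in>J. z \<in> B j" if "z \<in> space N" "h z \<noteq> 0" for z
  proof (rule ccontr)
    assume "\<not> ?thesis"
    then have "(\<Sum>j\<in>J. c j * indicator (B j) z) = 0" by (intro sum.neutral) auto
    then show False using h[of z] that by simp
  qed
  define Y where "Y = h ` space N - {0}"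
  have "Y \<subseteq> c ` J" using h0 hB by (fastforce simp: Y_def)
  then have finY: "finite Y" using J finite_subset by blast
  let ?J = "\<lambda>y. {j \<in> J. c j = y}"
  have lev: "{z \<in> space N. h z = y} = (\<Union>j\<in>?J y. B j)" if "y \<in> Y" for y
  proof -
    have "y \<noteq> 0" using that by (simp add: Y_def)
    show ?thesis
    proof (intro set_eqI iffI)
      fix z assume "z \<in> {z \<in> space N. h z = y}"
      then have z: "z \<in> space N" "h z = y" by auto
      then obtain j where "j \<in> J" "z \<in> B j" using h0 \<open>y \<noteq> 0\<close> by blast
      then show "z \<in> (\<Union>j\<in>?J y. B j)" using hB[of j z] z by auto
    next
      fix z assume "z \<in> (\<Union>j\<in>?J y. B j)"
      then obtain j where "j \<in> J" "c j = y" "z \<in> B j" by auto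
      then show "z \<in> {z \<in> space N. h z = y}" using hB[of j z] sp[of j] by auto
    qed
  qed
  have "AE \<omega> in M. \<forall>y\<in>Y. \<Lambda> {z \<in> space N. h z = y} \<omega> = (\<Sum>j\<in>?J y. \<Lambda> (B j) \<omega>)"
  proof (rule AE_finite_allI[OF finY])
    fix y assume "y \<in> Y"
    show "AE \<omega> in M. \<Lambda> {z \<in> space N. h z = y} \<omega> = (\<Sum>j\<in>?J y. \<Lambda> (B j) \<omega>)"
      unfolding lev[OF \<open>y \<in> Y\<close>] using J B dis
      by (intro \<Lambda>_UN) (auto simp: disjoint_family_on_def)
  qed
  with \<Lambda>_empty show ?thesis
  proof eventually_elim
    case (elim \<omega>)
    have "I h \<omega> = (\<Sum>y\<in>Y. \<Sum>j\<in>?J y. c j * \<Lambda> (B j) \<omega>)"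
      unfolding I_eq Y_def[symmetric] using elim by (intro sum.cong) (auto simp: sum_distrib_left)
    \<comment> \<open>Restricting to indices with coefficient in \<open>Y\<close> allows regrouping
      over j. The indices left out have coefficient 0 or an empty piece.\<close>
    also have "\<dots> = (\<Sum>y\<in>Y. \<Sum>j\<in>{x \<in> {j \<in> J. c j \<in> Y}. c x = y}. c j * \<Lambda> (B j) \<omega>)"
      by (intro sum.cong) auto
    also have "\<dots> = (\<Sum>j\<in>{j \<in> J. c j \<in> Y}. c j * \<Lambda> (B j) \<omega>)"
      using J finY by (intro sum.group) auto
    also have "\<dots> = (\<Sum>j\<in>J. c j * \<Lambda> (B j) \<omega>)"
    proof (intro sum.mono_neutral_left ballI)
      fix j assume j: "j \<in> J - {j \<in> J. c j \<in> Y}"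
      have "B j = {}" if "c j \<noteq> 0"
      proof (rule ccontr)
        assume "B j \<noteq> {}"
        then obtain z where "z \<in> B j" by auto
        then have "c j = h z" "z \<in> space N" using hB[of j z] sp[of j] j by auto
        then show False using j that by (simp add: Y_def)
      qed
      then show "c j * \<Lambda> (B j) \<omega> = 0" using elim by (cases "c j = 0") auto
    qed (use J in auto)
    finally show ?case .
  qed
qed

text \<open>Both functions are constant on the joint level sets, so the three integrals become sums
  over one common partition.\<close>

lemma I_lincomb:
  assumes h: "simple_finite N h" and g: "simple_finite N g"
  shows "AE \<omega> in M. I (\<lambda>z. c * h z + d * g z) \<omega> = c * I h \<omega> + d * I g \<omega>"
proof -
  define J where "J = (h ` space N \<times> g ` space N) - {(0, 0)}"
  define B where "B = (\<lambda>(y, y'). {z \<in> space N. h z = y \<and> g z = y'})"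
  have fin: "finite J" using simple_finite_finite[OF h] simple_finite_finite[OF g] by (simp add: J_def)
  have B: "B j \<in> finite_sets N" if "j \<in> J" for j
  proof (rule finite_sets_subset)
    show "{z \<in> space N. h z \<noteq> 0} \<union> {z \<in> space N. g z \<noteq> 0} \<in> finite_sets N"
      using h g by (simp add: simple_finite_def)
    show "B j \<in> sets N"
    proof -
      note [measurable] = simple_finite_measurable[OF h] simple_finite_measurable[OF g]
      obtain y y' where "j = (y, y')" by (cases j)
      then show ?thesis unfolding B_def by simp
    qed
    show "B j \<subseteq> {z \<in> space N. h z \<noteq> 0} \<union> {z \<in> space N. g z \<noteq> 0}"
      using that by (auto simp: J_def B_def)
  qed
  have dis: "disjoint_family_on B J" by (auto simp: disjoint_family_on_def B_def)
  \<comment> \<open>A general \<open>u\<close> covers h, g and their combination. The condition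
    \<open>u 0 0 = 0\<close> compensates for omitting the pair (0, 0), whose joint level set may
    have infinite measure.\<close>
  have eq: "u (h z) (g z) = (\<Sum>j\<in>J. u (fst j) (snd j) * indicator (B j) z)"
    if "z \<in> space N" "u 0 0 = 0" for z and u :: "real \<Rightarrow> real \<Rightarrow> real"
  proof (cases "(h z, g z) \<in> J")
    case True
    have "(\<Sum>j\<in>J. u (fst j) (snd j) * indicator (B j) z) = (\<Sum>j\<in>{(h z, g z)}. u (fst j) (snd j) * indicator (B j) z)"
      using fin True that by (intro sum.mono_neutral_right) (auto simp: B_def indicator_def split: if_splits)
    then show ?thesis using that by (simp add: B_def)
  next
    case False
    then have *: "h z = 0" "g z = 0" using that by (auto simp: J_def)
    have "(\<Sum>j\<in>J. u (fst j) (snd j) * indicator (B j) z) = 0"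
      using * by (intro sum.neutral) (auto simp: B_def J_def indicator_def)
    then show ?thesis using * that by simp
  qed
  have rep: "AE \<omega> in M. I (\<lambda>z. u (h z) (g z)) \<omega> = (\<Sum>j\<in>J. u (fst j) (snd j) * \<Lambda> (B j) \<omega>)"
    if "u 0 0 = 0" for u :: "real \<Rightarrow> real \<Rightarrow> real"
    using eq that by (intro I_representation[OF fin B dis]) blast
  have "AE \<omega> in M. I (\<lambda>z. c * h z + d * g z) \<omega> = (\<Sum>j\<in>J. (c * fst j + d * snd j) * \<Lambda> (B j) \<omega>)"
    using rep[of "\<lambda>y y'. c * y + d * y'"] by simp
  moreover have "AE \<omega> in M. I h \<omega> = (\<Sum>j\<in>J. fst j * \<Lambda> (B j) \<omega>)"
    using rep[of "\<lambda>y y'. y"] by simp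
  moreover have "AE \<omega> in M. I g \<omega> = (\<Sum>j\<in>J. snd j * \<Lambda> (B j) \<omega>)"
    using rep[of "\<lambda>y y'. y'"] by simp
  ultimately show ?thesis
    by eventually_elim (simp add: sum_distrib_left sum.distrib[symmetric] algebra_simps)
qed

lemma char_\<Lambda>:
  assumes "A \<in> finite_sets N"
  shows "(CLINT \<omega>|M. iexp (\<theta> * \<Lambda> A \<omega>)) = exp (of_real (- (\<theta>\<^sup>2 / 2) * b * measure N A))"
proof -
  have "levy_exponent 0 b (null_measure borel) \<theta> = of_real (- (\<theta>\<^sup>2 / 2 * b))"
    by (simp add: levy_exponent_def)
  then show ?thesis
    unfolding char_basis[OF assms[unfolded N_def]] N_def by (simp only: of_real_mult[symmetric]) (simp add: ac_simps)
qed

text \<open>As the supports are disjoint, the nonzero level sets of all h k form a single disjoint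
  family. Independence of \<Lambda> over one enumeration of it yields independence of the integrals
  by grouping into blocks, and the characteristic function of each integral as a product within its
  block.\<close>

lemma indep_vars_I:
  assumes h: "\<And>k::nat. simple_finite N (h k)"
    and dis: "\<And>k l z. k \<noteq> l \<Longrightarrow> h k z = 0 \<or> h l z = 0"
  shows "indep_vars (\<lambda>_. borel) (\<lambda>k. I (h k)) UNIV"
    and "(CLINT \<omega>|M. iexp (\<theta> * I (h k) \<omega>)) =
      exp (of_real (- (\<theta>\<^sup>2 / 2) * b * (\<integral>z. (h k z)\<^sup>2 \<partial>N)))"
proof -
  define Y where "Y k = h k ` space N - {0}" for k
  have finY: "finite (Y k)" for k using simple_finite_finite[OF h] by (simp add: Y_def)
  have "\<forall>k. \<exists>e. bij_betw e {0..<card (Y k)} (Y k)"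
    using ex_bij_betw_nat_finite[OF finY] by blast
  then obtain e where e: "\<And>k. bij_betw (e k) {0..<card (Y k)} (Y k)" by metis
  have eY: "e k i \<in> Y k" if "i < card (Y k)" for k i
    using e[of k] that by (auto simp: bij_betw_def)
  \<comment> \<open>The pairing function lays out all level sets along one sequence; positions
    beyond the last level of h k receive the empty set.\<close>
  define C where "C p = (case prod_decode p of (k, i) \<Rightarrow>
    if i < card (Y k) then {z \<in> space N. h k z = e k i} else {})" for p
  define K where "K k = (\<lambda>i. prod_encode (k, i)) ` {0..<card (Y k)}" for k
  have C_enc: "C (prod_encode (k, i)) = {z \<in> space N. h k z = e k i}" if "i < card (Y k)" for k i
    using that by (simp add: C_def)
  have Cfin: "C p \<in> finite_sets N" for p
  proof -
    obtain k i where p: "prod_decode p = (k, i)" by (cases "prod_decode p")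
    have "e k i \<noteq> 0" if "i < card (Y k)" using eY[OF that] by (simp add: Y_def)
    then show ?thesis using simple_finite_level_set[OF h, of "e k i" k] by (auto simp: C_def p)
  qed
  have Cdis: "disjoint_family C"
    unfolding disjoint_family_on_def
  proof (intro ballI impI)
    fix p q :: nat assume "p \<noteq> q"
    obtain k i where p: "prod_decode p = (k, i)" by (cases "prod_decode p")
    obtain l j where q: "prod_decode q = (l, j)" by (cases "prod_decode q")
    have ne: "(k, i) \<noteq> (l, j)" using \<open>p \<noteq> q\<close> p q by (metis prod_decode_inverse)
    show "C p \<inter> C q = {}"
    proof (rule ccontr)
      assume "C p \<inter> C q \<noteq> {}"
      then obtain z where z: "i < card (Y k)" "j < card (Y l)" "h k z = e k i" "h l z = e l j"
        by (auto simp: C_def p q split: if_splits)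
      then have "h k z \<noteq> 0" "h l z \<noteq> 0" using eY[of i k] eY[of j l] by (auto simp: Y_def)
      then have "k = l" using dis by blast
      moreover have "e k i = e k j" using \<open>k = l\<close> z by simp
      ultimately have "i = j"
        using bij_betw_imp_inj_on[OF e[of k]] z by (auto dest: inj_onD)
      with \<open>k = l\<close> ne show False by simp
    qed
  qed
  have ind: "indep_vars (\<lambda>_. borel) (\<lambda>p. \<Lambda> (C p)) UNIV"
    using Cfin Cdis by (intro independently_scattered_\<Lambda>) auto
  \<comment> \<open>The blocks \<open>K k\<close> are disjoint, so the vectors of values over them
    are independent, and each integral is a measurable function of its own vector.\<close>
  have "indep_vars (\<lambda>k. PiM (K k) (\<lambda>_. borel)) (\<lambda>k \<omega>. restrict (\<lambda>p. \<Lambda> (C p) \<omega>) (K k)) UNIV"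
    by (rule indep_vars_restrict[OF ind]) (auto simp: disjoint_family_on_def K_def)
  then have "indep_vars (\<lambda>_. borel) (\<lambda>k \<omega>. (\<lambda>x. \<Sum>i\<in>{0..<card (Y k)}. e k i * x (prod_encode (k, i)))
      (restrict (\<lambda>p. \<Lambda> (C p) \<omega>) (K k))) UNIV"
    by (rule indep_vars_compose2)
      (auto intro!: borel_measurable_sum borel_measurable_times measurable_component_singleton simp: K_def)
  moreover have I_sum: "I (h k) \<omega> = (\<Sum>i\<in>{0..<card (Y k)}. e k i * \<Lambda> (C (prod_encode (k, i))) \<omega>)" for k \<omega>
    unfolding I_eq Y_def[symmetric] using sum.reindex_bij_betw[OF e[of k], symmetric]
    by (simp add: C_enc)
  ultimately show "indep_vars (\<lambda>_. borel) (\<lambda>k. I (h k)) UNIV"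
    by (simp add: K_def I_sum[abs_def])
  have "indep_vars (\<lambda>_. borel) (\<lambda>p \<omega>. (\<lambda>x. e k (snd (prod_decode p)) * x) (\<Lambda> (C p) \<omega>)) (K k)"
    by (rule indep_vars_compose2[OF indep_vars_subset[OF ind]]) auto
  then have "char (distr M borel (\<lambda>\<omega>. \<Sum>p\<in>K k. e k (snd (prod_decode p)) * \<Lambda> (C p) \<omega>)) \<theta> =
      (\<Prod>p\<in>K k. char (distr M borel (\<lambda>\<omega>. e k (snd (prod_decode p)) * \<Lambda> (C p) \<omega>)) \<theta>)"
    by (intro char_distr_sum) simp
  also have "(\<lambda>\<omega>. \<Sum>p\<in>K k. e k (snd (prod_decode p)) * \<Lambda> (C p) \<omega>) = I (h k)"
    unfolding I_sum[abs_def] K_def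
    by (subst sum.reindex) (auto simp: inj_on_def)
  also have "(\<Prod>p\<in>K k. char (distr M borel (\<lambda>\<omega>. e k (snd (prod_decode p)) * \<Lambda> (C p) \<omega>)) \<theta>) =
      (\<Prod>i\<in>{0..<card (Y k)}. char (distr M borel (\<lambda>\<omega>. e k i * \<Lambda> (C (prod_encode (k, i))) \<omega>)) \<theta>)"
    unfolding K_def by (subst prod.reindex) (auto simp: inj_on_def)
  also have "\<dots> = (\<Prod>i\<in>{0..<card (Y k)}. exp (of_real (- ((\<theta> * e k i)\<^sup>2 / 2) * b * measure N {z \<in> space N. h k z = e k i})))"
  proof (intro prod.cong refl)
    fix i assume i: "i \<in> {0..<card (Y k)}"
    have [measurable]: "random_variable borel (\<Lambda> (C (prod_encode (k, i))))"
      by (rule random_variable_\<Lambda>[OF Cfin])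
    have "char (distr M borel (\<lambda>\<omega>. e k i * \<Lambda> (C (prod_encode (k, i))) \<omega>)) \<theta> =
        (CLINT \<omega>|M. iexp (\<theta> * e k i * \<Lambda> (C (prod_encode (k, i))) \<omega>))"
      unfolding char_def by (subst integral_distr) (auto simp: mult.assoc)
    also have "\<dots> = exp (of_real (- ((\<theta> * e k i)\<^sup>2 / 2) * b * measure N (C (prod_encode (k, i)))))"
      by (rule char_\<Lambda>[OF Cfin])
    finally show "char (distr M borel (\<lambda>\<omega>. e k i * \<Lambda> (C (prod_encode (k, i))) \<omega>)) \<theta> =
        exp (of_real (- ((\<theta> * e k i)\<^sup>2 / 2) * b * measure N {z \<in> space N. h k z = e k i}))"
      using i C_enc by simp
  qed
  also have "\<dots> = (\<Prod>y\<in>Y k. exp (of_real (- ((\<theta> * y)\<^sup>2 / 2) * b * measure N {z \<in> space N. h k z = y})))"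
    by (rule prod.reindex_bij_betw[OF e])
  also have "\<dots> = exp (of_real (\<Sum>y\<in>Y k. - ((\<theta> * y)\<^sup>2 / 2) * b * measure N {z \<in> space N. h k z = y}))"
    using finY by (simp add: exp_sum)
  also have "(\<Sum>y\<in>Y k. - ((\<theta> * y)\<^sup>2 / 2) * b * measure N {z \<in> space N. h k z = y}) =
      - (\<theta>\<^sup>2 / 2) * b * (\<integral>z. (h k z)\<^sup>2 \<partial>N)"
    unfolding simple_finite_integral_square(2)[OF h] Y_def sum_distrib_left
    by (intro sum.cong) (auto simp: power_mult_distrib)
  finally show "(CLINT \<omega>|M. iexp (\<theta> * I (h k) \<omega>)) =
      exp (of_real (- (\<theta>\<^sup>2 / 2) * b * (\<integral>z. (h k z)\<^sup>2 \<partial>N)))"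
    unfolding char_def by (subst (asm) integral_distr) (auto intro!: random_variable_I h)
qed

lemma centered_gaussian_I:
  assumes h: "simple_finite N h"
  shows "centered_gaussian M (sqrt (b * (\<integral>z. (h z)\<^sup>2 \<partial>N))) (I h)"
proof (rule centered_gaussian_of_char)
  show "random_variable borel (I h)" by (rule random_variable_I[OF h])
  fix \<theta> :: real
  \<comment> \<open>A single integrand becomes a family with disjoint supports once it is padded
    with zero functions.\<close>
  define h' where "h' k = (if k = 0 then h else (\<lambda>_. 0))" for k :: nat
  have "simple_finite N (h' k)" for k using h by (simp add: h'_def simple_finite_def)
  moreover have "k \<noteq> l \<Longrightarrow> h' k z = 0 \<or> h' l z = 0" for k l z by (auto simp: h'_def)
  ultimately have "(CLINT \<omega>|M. iexp (\<theta> * I (h' 0) \<omega>)) =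
      exp (of_real (- (\<theta>\<^sup>2 / 2) * b * (\<integral>z. (h' 0 z)\<^sup>2 \<partial>N)))"
    by (rule indep_vars_I(2))
  moreover have "- (sqrt (b * (\<integral>z. (h z)\<^sup>2 \<partial>N)) * \<theta>)\<^sup>2 / 2 = - (\<theta>\<^sup>2 / 2) * b * (\<integral>z. (h z)\<^sup>2 \<partial>N)"
    using variance_nonneg by (simp add: power_mult_distrib)
  ultimately show "(CLINT \<omega>|M. iexp (\<theta> * I h \<omega>)) =
      exp (of_real (- (sqrt (b * (\<integral>z. (h z)\<^sup>2 \<partial>N)) * \<theta>)\<^sup>2 / 2))"
    by (simp only: h'_def simp_thms if_True)
qed

end

section \<open>The Wiener integral\<close>

lemma l2_tendsto_AE_cong:
  assumes "l2_tendsto M h g" "\<And>n. AE z in M. h n z = h' n z" "\<And>n. h' n \<in> borel_measurable M"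
  shows "l2_tendsto M h' g"
proof -
  note h = l2_tendstoD[OF assms(1)]
  note [measurable] = assms(3) square_integrableD(1)[OF h(1)] square_integrableD(1)[OF h(2)]
  have "square_integrable M (h' n)" for n
  proof (rule square_integrable_bound[OF h(1) assms(3)])
    show "AE z in M. \<bar>h' n z\<bar> \<le> 1 * \<bar>h n z\<bar>" using assms(2)[of n] by eventually_elim simp
  qed
  moreover have "(\<integral>z. (h' n z - g z)\<^sup>2 \<partial>M) = (\<integral>z. (h n z - g z)\<^sup>2 \<partial>M)" for n
  proof (rule integral_cong_AE)
    show "AE z in M. (h' n z - g z)\<^sup>2 = (h n z - g z)\<^sup>2" using assms(2)[of n] by eventually_elim simp
  qed measurable
  ultimately show ?thesis using h by (simp add: l2_tendsto_def)
qed

text \<open>Indices are chosen so that the exceptional probabilities are at most 2^-k; the first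
  Borel-Cantelli lemma does the rest.\<close>

lemma (in prob_space) tendsto_in_prob_AE_subseq:
  assumes Y: "tendsto_in_prob M Y Z" and m: "\<And>n. random_variable borel (Y n)"
  shows "\<exists>r. strict_mono (r :: nat \<Rightarrow> nat) \<and> (AE \<omega> in M. (\<lambda>k. Y (r k) \<omega>) \<longlonglongrightarrow> Z \<omega>)"
proof -
  have [measurable]: "random_variable borel Z" "random_variable borel (Y n)" for n
    using Y m by (auto simp: tendsto_in_prob_def)
  have "\<exists>K. \<forall>n\<ge>K. prob {\<omega> \<in> space M. (1 / 2) ^ k < \<bar>Y n \<omega> - Z \<omega>\<bar>} \<le> (1 / 2) ^ k" for k
  proof -
    have "(\<lambda>n. prob {\<omega> \<in> space M. (1 / 2) ^ k < \<bar>Y n \<omega> - Z \<omega>\<bar>}) \<longlonglongrightarrow> 0"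
      using Y by (simp add: tendsto_in_prob_def)
    from order_tendstoD(2)[OF this, of "(1/2)^k"] show ?thesis
      by (auto simp: eventually_sequentially intro: less_imp_le)
  qed
  then obtain K where K: "\<And>k n. n \<ge> K k \<Longrightarrow> prob {\<omega> \<in> space M. (1 / 2) ^ k < \<bar>Y n \<omega> - Z \<omega>\<bar>} \<le> (1 / 2) ^ k"
    by metis
  \<comment> \<open>Partial sums make \<open>r\<close> strictly increasing and keep it above
    \<open>K\<close>.\<close>
  define r where "r k = (\<Sum>i\<le>k. Suc (K i))" for k
  have r: "strict_mono r" by (rule strict_monoI_Suc) (simp add: r_def)
  have "K k \<le> r k" for k
    unfolding r_def by (rule order_trans[of _ "Suc (K k)"]) (auto intro: member_le_sum)
  then have le: "prob {\<omega> \<in> space M. (1 / 2) ^ k < \<bar>Y (r k) \<omega> - Z \<omega>\<bar>} \<le> (1 / 2) ^ k" for k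
    by (rule K)
  have "AE \<omega> in M. eventually (\<lambda>k. \<omega> \<in> space M - {\<omega> \<in> space M. (1 / 2) ^ k < \<bar>Y (r k) \<omega> - Z \<omega>\<bar>}) sequentially"
  proof (rule borel_cantelli_AE1)
    show "summable (\<lambda>k. prob {\<omega> \<in> space M. (1 / 2) ^ k < \<bar>Y (r k) \<omega> - Z \<omega>\<bar>})"
      by (rule summable_comparison_test'[where g="\<lambda>k. (1/2) ^ k" and N=0]) (use le in auto)
  qed (auto simp: emeasure_eq_measure)
  then have "AE \<omega> in M. (\<lambda>k. Y (r k) \<omega>) \<longlonglongrightarrow> Z \<omega>"
  proof eventually_elim
    case (elim \<omega>)
    have "(\<lambda>k. Y (r k) \<omega> - Z \<omega>) \<longlonglongrightarrow> 0"
    proof (rule Lim_null_comparison)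
      show "(\<lambda>k. (1 / 2 :: real) ^ k) \<longlonglongrightarrow> 0" by (rule LIMSEQ_power_zero) simp
      show "\<forall>\<^sub>F k in sequentially. norm (Y (r k) \<omega> - Z \<omega>) \<le> (1 / 2) ^ k"
        using elim by eventually_elim auto
    qed
    then show ?case by (rule LIM_zero_cancel)
  qed
  with r show ?thesis by blast
qed

context gaussian_basis
begin

text \<open>\<open>Y\<close> is a version of the integral of \<open>g\<close>.\<close>

definition wiener :: "('v \<times> real \<Rightarrow> real) \<Rightarrow> ('w \<Rightarrow> real) \<Rightarrow> bool" where
  "wiener g Y \<longleftrightarrow> (\<exists>h. (\<forall>n. simple_finite N (h n)) \<and> l2_tendsto N h g \<and> l2_tendsto M (\<lambda>n. I (h n)) Y)"

lemma I_square_integrable: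
  assumes "simple_finite N h"
  shows "square_integrable M (I h)" "(\<integral>\<omega>. (I h \<omega>)\<^sup>2 \<partial>M) = b * (\<integral>z. (h z)\<^sup>2 \<partial>N)"
  using centered_gaussian_square_integrable[OF centered_gaussian_I[OF assms]] variance_nonneg
  by simp_all

lemma integral_square_I_diff:
  assumes "simple_finite N h" "simple_finite N g"
  shows "(\<integral>\<omega>. (I h \<omega> - I g \<omega>)\<^sup>2 \<partial>M) = b * (\<integral>z. (h z - g z)\<^sup>2 \<partial>N)"
proof -
  have s: "simple_finite N (\<lambda>z. 1 * h z + (-1) * g z)" by (intro simple_finite_lincomb assms)
  note [measurable] = random_variable_I[OF assms(1)] random_variable_I[OF assms(2)] random_variable_I[OF s]
  have "(\<integral>\<omega>. (I h \<omega> - I g \<omega>)\<^sup>2 \<partial>M) = (\<integral>\<omega>. (I (\<lambda>z. 1 * h z + (-1) * g z) \<omega>)\<^sup>2 \<partial>M)"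
  proof (rule integral_cong_AE)
    show "AE \<omega> in M. (I h \<omega> - I g \<omega>)\<^sup>2 = (I (\<lambda>z. 1 * h z + (-1) * g z) \<omega>)\<^sup>2"
      using I_lincomb[OF assms, of 1 "-1"] by eventually_elim simp
  qed measurable
  then show ?thesis using I_square_integrable(2)[OF s] by simp
qed

lemma wienerD:
  assumes "wiener g Y"
  shows "square_integrable N g" "square_integrable M Y" "(\<integral>\<omega>. (Y \<omega>)\<^sup>2 \<partial>M) = b * (\<integral>z. (g z)\<^sup>2 \<partial>N)"
proof -
  obtain h where h: "\<And>n. simple_finite N (h n)" "l2_tendsto N h g" "l2_tendsto M (\<lambda>n. I (h n)) Y"
    using assms by (auto simp: wiener_def)
  show "square_integrable N g" "square_integrable M Y"
    using l2_tendstoD(2)[OF h(2)] l2_tendstoD(2)[OF h(3)] .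
  have "(\<lambda>n. b * (\<integral>z. (h n z)\<^sup>2 \<partial>N)) \<longlonglongrightarrow> (\<integral>\<omega>. (Y \<omega>)\<^sup>2 \<partial>M)"
    using l2_tendsto_square[OF h(3)] by (simp add: I_square_integrable(2)[OF h(1)])
  moreover have "(\<lambda>n. b * (\<integral>z. (h n z)\<^sup>2 \<partial>N)) \<longlonglongrightarrow> b * (\<integral>z. (g z)\<^sup>2 \<partial>N)"
    by (intro tendsto_mult_left l2_tendsto_square h)
  ultimately show "(\<integral>\<omega>. (Y \<omega>)\<^sup>2 \<partial>M) = b * (\<integral>z. (g z)\<^sup>2 \<partial>N)" by (rule LIMSEQ_unique)
qed

lemma wiener_I: "simple_finite N h \<Longrightarrow> wiener h (I h)"
  unfolding wiener_def
  by (rule exI[of _ "\<lambda>_. h"])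
    (auto intro!: l2_tendsto_const simple_finite_integral_square I_square_integrable)

lemma wiener_lincomb:
  assumes "wiener g Y" "wiener g' Y'"
  shows "wiener (\<lambda>z. c * g z + d * g' z) (\<lambda>\<omega>. c * Y \<omega> + d * Y' \<omega>)"
proof -
  obtain h where h: "\<And>n. simple_finite N (h n)" "l2_tendsto N h g" "l2_tendsto M (\<lambda>n. I (h n)) Y"
    using assms by (auto simp: wiener_def)
  obtain h' where h': "\<And>n. simple_finite N (h' n)" "l2_tendsto N h' g'" "l2_tendsto M (\<lambda>n. I (h' n)) Y'"
    using assms by (auto simp: wiener_def)
  have s: "simple_finite N (\<lambda>z. c * h n z + d * h' n z)" for n
    by (intro simple_finite_lincomb h h')
  have "l2_tendsto M (\<lambda>n. I (\<lambda>z. c * h n z + d * h' n z)) (\<lambda>\<omega>. c * Y \<omega> + d * Y' \<omega>)"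
  proof (rule l2_tendsto_AE_cong[OF l2_tendsto_lincomb[OF h(3) h'(3), of c d]])
    show "AE \<omega> in M. c * I (h n) \<omega> + d * I (h' n) \<omega> = I (\<lambda>z. c * h n z + d * h' n z) \<omega>" for n
      using I_lincomb[OF h(1)[of n] h'(1)[of n], of c d] by eventually_elim simp
  qed (rule random_variable_I[OF s])
  then show ?thesis
    unfolding wiener_def
    using s l2_tendsto_lincomb[OF h(2) h'(2), of c d]
    by (intro exI[of _ "\<lambda>n z. c * h n z + d * h' n z"]) auto
qed

lemma wiener_diff: "wiener g Y \<Longrightarrow> wiener g' Y' \<Longrightarrow> wiener (\<lambda>z. g z - g' z) (\<lambda>\<omega>. Y \<omega> - Y' \<omega>)"
  using wiener_lincomb[of g Y g' Y' 1 "-1"] by simp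

text \<open>Polarisation: the norm identity holds for both versions and for their
  difference.\<close>

lemma wiener_inner:
  assumes "wiener g Y" "wiener g' Y'"
  shows "(\<integral>\<omega>. Y \<omega> * Y' \<omega> \<partial>M) = b * (\<integral>z. g z * g' z \<partial>N)"
proof -
  note D = wienerD[OF assms(1)] and D' = wienerD[OF assms(2)]
  have "(\<integral>\<omega>. (Y \<omega> - Y' \<omega>)\<^sup>2 \<partial>M) = b * (\<integral>z. (g z - g' z)\<^sup>2 \<partial>N)"
    by (rule wienerD(3)[OF wiener_diff[OF assms]])
  then show ?thesis
    unfolding integral_square_diff[OF D(2) D'(2)] integral_square_diff[OF D(1) D'(1)] D(3) D'(3)
    by (simp add: algebra_simps)
qed

text \<open>Chebyshev's inequality compares \<open>Y\<close> with its Gaussian approximants at a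
  lower level y < x. The error vanishes as n grows, and then y increases to x.\<close>

lemma wiener_tail:
  assumes W: "wiener g Y" and v: "b * (\<integral>z. (g z)\<^sup>2 \<partial>N) \<le> v" "0 < v" and x: "0 \<le> x"
  shows "prob {\<omega> \<in> space M. x < \<bar>Y \<omega>\<bar>} \<le> 2 * exp (- x\<^sup>2 / (2 * v))"
proof (cases "x = 0")
  case True
  \<comment> \<open>At x = 0 no level y with 0 <= y < x exists, but there the claimed bound equals
    2.\<close>
  have "prob {\<omega> \<in> space M. x < \<bar>Y \<omega>\<bar>} \<le> 1" by (rule prob_le_1)
  also have "1 \<le> 2 * exp (- x\<^sup>2 / (2 * v))" using True by simp
  finally show ?thesis .
next
  case False
  with x have "0 < x" by simp
  obtain h where h: "\<And>n. simple_finite N (h n)" "l2_tendsto N h g" "l2_tendsto M (\<lambda>n. I (h n)) Y"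
    using W by (auto simp: wiener_def)
  note [measurable] = random_variable_I[OF h(1)] square_integrableD(1)[OF wienerD(2)[OF W]]
  have *: "prob {\<omega> \<in> space M. x < \<bar>Y \<omega>\<bar>} \<le> 2 * exp (- y\<^sup>2 / (2 * v))" if y: "0 \<le> y" "y < x" for y
  proof (rule LIMSEQ_le_const)
    \<comment> \<open>The maximum stays positive and above the variance of the approximant, and it
      still tends to v.\<close>
    define V where "V n = max v (b * (\<integral>z. (h n z)\<^sup>2 \<partial>N))" for n
    have "V \<longlonglongrightarrow> max v (b * (\<integral>z. (g z)\<^sup>2 \<partial>N))"
      unfolding V_def by (intro tendsto_max tendsto_const tendsto_mult_left l2_tendsto_square h)
    then have V: "V \<longlonglongrightarrow> v" using v by (simp add: max_def)
    show "(\<lambda>n. 2 * exp (- y\<^sup>2 / (2 * V n)) + (\<integral>\<omega>. (I (h n) \<omega> - Y \<omega>)\<^sup>2 \<partial>M) / (x - y)\<^sup>2)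
        \<longlonglongrightarrow> 2 * exp (- y\<^sup>2 / (2 * v))"
      using v y by (auto intro!: tendsto_eq_intros V l2_tendstoD(3)[OF h(3)])
    have "prob {\<omega> \<in> space M. x < \<bar>Y \<omega>\<bar>} \<le>
        2 * exp (- y\<^sup>2 / (2 * V n)) + (\<integral>\<omega>. (I (h n) \<omega> - Y \<omega>)\<^sup>2 \<partial>M) / (x - y)\<^sup>2" for n
    proof -
      have "prob {\<omega> \<in> space M. x < \<bar>Y \<omega>\<bar>} \<le>
        prob ({\<omega> \<in> space M. y < \<bar>I (h n) \<omega>\<bar>} \<union> {\<omega> \<in> space M. (x - y)\<^sup>2 \<le> (I (h n) \<omega> - Y \<omega>)\<^sup>2})"
      proof (rule finite_measure_mono)
        have "y < \<bar>i\<bar> \<or> (x - y)\<^sup>2 \<le> (i - w)\<^sup>2" if "x < \<bar>w\<bar>" for i w :: real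
          using that y by (subst abs_le_square_iff[symmetric]) auto
        then show "{\<omega> \<in> space M. x < \<bar>Y \<omega>\<bar>} \<subseteq>
          {\<omega> \<in> space M. y < \<bar>I (h n) \<omega>\<bar>} \<union> {\<omega> \<in> space M. (x - y)\<^sup>2 \<le> (I (h n) \<omega> - Y \<omega>)\<^sup>2}"
          by blast
      qed measurable
      also have "\<dots> \<le> prob {\<omega> \<in> space M. y < \<bar>I (h n) \<omega>\<bar>} + prob {\<omega> \<in> space M. (x - y)\<^sup>2 \<le> (I (h n) \<omega> - Y \<omega>)\<^sup>2}"
        by (rule measure_Un_le) measurable
      also have "\<dots> \<le> 2 * exp (- y\<^sup>2 / (2 * V n)) + (\<integral>\<omega>. (I (h n) \<omega> - Y \<omega>)\<^sup>2 \<partial>M) / (x - y)\<^sup>2"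
      proof (rule add_mono)
        show "prob {\<omega> \<in> space M. y < \<bar>I (h n) \<omega>\<bar>} \<le> 2 * exp (- y\<^sup>2 / (2 * V n))"
          using y v variance_nonneg
          by (intro centered_gaussian_tail_upper[OF centered_gaussian_I[OF h(1)]]) (auto simp: V_def)
        show "prob {\<omega> \<in> space M. (x - y)\<^sup>2 \<le> (I (h n) \<omega> - Y \<omega>)\<^sup>2} \<le> (\<integral>\<omega>. (I (h n) \<omega> - Y \<omega>)\<^sup>2 \<partial>M) / (x - y)\<^sup>2"
          using y by (intro integral_Markov_inequality_measure[where A="{}"] square_integrableD(2)
            square_integrable_diff l2_tendstoD[OF h(3)]) auto
      qed
      finally show ?thesis .
    qed
    then show "\<exists>K. \<forall>n\<ge>K. prob {\<omega> \<in> space M. x < \<bar>Y \<omega>\<bar>} \<le>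
        2 * exp (- y\<^sup>2 / (2 * V n)) + (\<integral>\<omega>. (I (h n) \<omega> - Y \<omega>)\<^sup>2 \<partial>M) / (x - y)\<^sup>2" by blast
  qed
  have "((\<lambda>y. 2 * exp (- y\<^sup>2 / (2 * v))) \<longlongrightarrow> 2 * exp (- x\<^sup>2 / (2 * v))) (at_left x)"
    using v by (intro tendsto_intros) auto
  moreover have "\<forall>\<^sub>F y in at_left x. prob {\<omega> \<in> space M. x < \<bar>Y \<omega>\<bar>} \<le> 2 * exp (- y\<^sup>2 / (2 * v))"
    using eventually_at_left_real[OF \<open>0 < x\<close>] by eventually_elim (rule *, auto)
  ultimately show ?thesis
    by (intro tendsto_lowerbound) auto
qed

text \<open>Convergence in probability already forces the simple functions to be Cauchy in mean square:
  a centred Gaussian variable exceeds its standard deviation with a fixed positive probability.\<close>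

lemma wiener_of_levy_integral:
  assumes b: "0 < b" and L: "has_levy_integral M N \<Lambda> g Y"
  shows "wiener g Y"
proof -
  obtain h where h: "\<And>n. simple_finite N (h n)" and lim: "AE z in N. (\<lambda>n. h n z) \<longlonglongrightarrow> g z"
    and P: "tendsto_in_prob M (\<lambda>n. I (h n)) Y" and g[measurable]: "g \<in> borel_measurable N"
    using L by (auto simp: has_levy_integral_def simple_finite_def)
  have Y[measurable]: "random_variable borel Y" using P by (simp add: tendsto_in_prob_def)
  note [measurable] = random_variable_I[OF h]
  note sq = simple_finite_integral_square(1)[OF h]
  have Cauchy: "\<exists>K. \<forall>n\<ge>K. \<forall>m\<ge>K. (\<integral>z. (h n z - h m z)\<^sup>2 \<partial>N) \<le> e" if "0 < e" for e
  proof -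
    \<comment> \<open>The lower tail bound at one standard deviation, exp (-(1 + 1)^2 / 2) / sqrt (2
      pi).\<close>
    define p where "p = exp (- 2) / sqrt (2 * pi)"
    have "0 < p" by (simp add: p_def)
    define s where "s = sqrt (b * e)"
    have s: "0 < s" using b \<open>0 < e\<close> by (simp add: s_def)
    have "(\<lambda>n. prob {\<omega> \<in> space M. s / 2 < \<bar>I (h n) \<omega> - Y \<omega>\<bar>}) \<longlonglongrightarrow> 0"
      using P half_gt_zero[OF s] unfolding tendsto_in_prob_def by blast
    from order_tendstoD(2)[OF this, of "p / 2"] \<open>0 < p\<close>
    obtain K where K: "\<And>n. n \<ge> K \<Longrightarrow> prob {\<omega> \<in> space M. s / 2 < \<bar>I (h n) \<omega> - Y \<omega>\<bar>} < p / 2"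
      by (auto simp: eventually_sequentially)
    have "(\<integral>z. (h n z - h m z)\<^sup>2 \<partial>N) \<le> e" if "n \<ge> K" "m \<ge> K" for n m
    proof (rule ccontr)
      \<comment> \<open>Otherwise the difference of the two integrals would exceed s with
        probability at least p, although each of them is within s/2 of \<open>Y\<close> outside a
        set of probability below p/2.\<close>
      assume "\<not> ?thesis"
      then have big: "e < (\<integral>z. (h n z - h m z)\<^sup>2 \<partial>N)" by simp
      define d where "d = (\<lambda>z. 1 * h n z + (-1) * h m z)"
      have d: "simple_finite N d" unfolding d_def by (intro simple_finite_lincomb h)
      note [measurable] = random_variable_I[OF d]
      define \<sigma> where "\<sigma> = sqrt (b * (\<integral>z. (d z)\<^sup>2 \<partial>N))"
      have "s < \<sigma>" unfolding s_def \<sigma>_def using big b by (simp add: d_def)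
      have "p \<le> exp (- (s / \<sigma> + 1)\<^sup>2 / 2) / sqrt (2 * pi)"
      proof -
        have "s / \<sigma> \<le> 1" "0 \<le> s / \<sigma>" using \<open>s < \<sigma>\<close> s by auto
        then have "(s / \<sigma> + 1)\<^sup>2 \<le> 2\<^sup>2" by (intro power_mono) auto
        then show ?thesis unfolding p_def by (intro divide_right_mono) auto
      qed
      also have "\<dots> \<le> prob {\<omega> \<in> space M. s < I d \<omega>}"
        using s \<open>s < \<sigma>\<close>
        by (intro centered_gaussian_tail_lower[OF centered_gaussian_I[OF d], folded \<sigma>_def]) auto
      also have "\<dots> \<le> prob ({\<omega> \<in> space M. s / 2 < \<bar>I (h n) \<omega> - Y \<omega>\<bar>} \<union> {\<omega> \<in> space M. s / 2 < \<bar>I (h m) \<omega> - Y \<omega>\<bar>})"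
      proof (rule finite_measure_mono_AE)
        have "AE \<omega> in M. I d \<omega> = I (h n) \<omega> - I (h m) \<omega>"
          using I_lincomb[OF h[of n] h[of m], of 1 "-1"] by (simp add: d_def)
        then show "AE \<omega> in M. \<omega> \<in> {\<omega> \<in> space M. s < I d \<omega>} \<longrightarrow>
          \<omega> \<in> {\<omega> \<in> space M. s / 2 < \<bar>I (h n) \<omega> - Y \<omega>\<bar>} \<union> {\<omega> \<in> space M. s / 2 < \<bar>I (h m) \<omega> - Y \<omega>\<bar>}"
        proof eventually_elim
          case (elim \<omega>)
          have "s / 2 < \<bar>I (h n) \<omega> - Y \<omega>\<bar> \<or> s / 2 < \<bar>I (h m) \<omega> - Y \<omega>\<bar>" if "s < I (h n) \<omega> - I (h m) \<omega>"
            using that by linarith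
          with elim show ?case by auto
        qed
      qed measurable
      also have "\<dots> \<le> prob {\<omega> \<in> space M. s / 2 < \<bar>I (h n) \<omega> - Y \<omega>\<bar>} + prob {\<omega> \<in> space M. s / 2 < \<bar>I (h m) \<omega> - Y \<omega>\<bar>}"
        by (rule measure_Un_le) measurable
      also have "\<dots> < p" using K[OF that(1)] K[OF that(2)] by simp
      finally show False by simp
    qed
    then show ?thesis by blast
  qed
  have 1: "l2_tendsto N h g"
    by (rule l2_tendsto_of_Cauchy_AE[OF sq Cauchy strict_mono_id]) (use lim in auto)
  obtain r where r: "strict_mono (r :: nat \<Rightarrow> nat)" "AE \<omega> in M. (\<lambda>k. I (h (r k)) \<omega>) \<longlonglongrightarrow> Y \<omega>"
    using tendsto_in_prob_AE_subseq[OF P] random_variable_I[OF h] by blast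
  have "l2_tendsto M (\<lambda>n. I (h n)) Y"
  proof (rule l2_tendsto_of_Cauchy_AE[OF I_square_integrable(1)[OF h] _ r Y])
    fix e :: real assume "0 < e"
    \<comment> \<open>Dividing e by b undoes the factor b of the isometry.\<close>
    then obtain K where "\<And>n m. n \<ge> K \<Longrightarrow> m \<ge> K \<Longrightarrow> (\<integral>z. (h n z - h m z)\<^sup>2 \<partial>N) \<le> e / b"
      using Cauchy[of "e / b"] b by auto
    then show "\<exists>K. \<forall>n\<ge>K. \<forall>m\<ge>K. (\<integral>\<omega>. (I (h n) \<omega> - I (h m) \<omega>)\<^sup>2 \<partial>M) \<le> e"
      unfolding integral_square_I_diff[OF h h] using b by (auto simp: field_simps)
  qed
  with 1 h show ?thesis unfolding wiener_def by blast
qed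

end

section \<open>Integrals of square-integrable fields\<close>

text \<open>Instantiated both with the translated kernels on the index space and with the values of
  X on the probability space, so that the two sides of the stochastic Fubini argument share the same
  exchange of integrals.\<close>

locale square_integrable_field = sigma_finite_measure N
  for N :: "'a measure" +
  fixes \<phi> :: "real \<Rightarrow> 'a \<Rightarrow> real" and t C :: real
  assumes t_nonneg: "0 \<le> t"
    and \<phi>_measurable [measurable]: "(\<lambda>(u, z). \<phi> u z) \<in> borel_measurable (lborel \<Otimes>\<^sub>M N)"
    and \<phi>_outside: "\<And>u z. u \<notin> {0..t} \<Longrightarrow> \<phi> u z = 0"
    and \<phi>_square: "\<And>u. square_integrable N (\<phi> u)" "\<And>u. (\<integral>z. (\<phi> u z)\<^sup>2 \<partial>N) \<le> C"
begin

sublocale pair: pair_sigma_finite lborel N ..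

lemma integrable_indicator_t: "integrable lborel (indicator {0..t} :: real \<Rightarrow> real)"
  by (rule integrable_real_indicator) (simp_all add: emeasure_lborel_Icc_eq)

lemma integrable_square_prod: "integrable (lborel \<Otimes>\<^sub>M N) (\<lambda>(u, z). (\<phi> u z)\<^sup>2)"
proof (rule pair.Fubini_integrable)
  have C: "0 \<le> C" by (rule order_trans[OF Bochner_Integration.integral_nonneg \<phi>_square(2)[of 0]]) simp
  show "integrable lborel (\<lambda>u. \<integral>z. norm (case (u, z) of (u, z) \<Rightarrow> (\<phi> u z)\<^sup>2) \<partial>N)"
  proof (rule Bochner_Integration.integrable_bound)
    show "integrable lborel (\<lambda>u. C * indicator {0..t} u)"
      by (intro integrable_mult_right integrable_indicator_t)
    show "AE u in lborel. norm (\<integral>z. norm (case (u, z) of (u, z) \<Rightarrow> (\<phi> u z)\<^sup>2) \<partial>N) \<le> norm (C * indicator {0..t} u)"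
      using \<phi>_square(2) C by (intro AE_I2) (auto simp: indicator_def \<phi>_outside)
  qed measurable
  show "AE u in lborel. integrable N (\<lambda>z. case (u, z) of (u, z) \<Rightarrow> (\<phi> u z)\<^sup>2)"
    using square_integrableD(2)[OF \<phi>_square(1)] by simp
qed measurable

lemma integral_field_square_integrable: "square_integrable N (\<lambda>z. \<integral>u. \<phi> u z \<partial>lborel)"
  unfolding square_integrable_def
proof
  show m[measurable]: "(\<lambda>z. \<integral>u. \<phi> u z \<partial>lborel) \<in> borel_measurable N" by measurable
  show "integrable N (\<lambda>z. (\<integral>u. \<phi> u z \<partial>lborel)\<^sup>2)"
  proof (rule Bochner_Integration.integrable_bound)
    \<comment> \<open>Cauchy-Schwarz against the indicator of [0, t] bounds the squared integral by
      t times the integral of the square.\<close>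
    show "integrable N (\<lambda>z. t * (\<integral>u. (\<phi> u z)\<^sup>2 \<partial>lborel))"
      by (intro integrable_mult_right pair.integrable_snd integrable_square_prod)
    show "AE z in N. norm ((\<integral>u. \<phi> u z \<partial>lborel)\<^sup>2) \<le> norm (t * (\<integral>u. (\<phi> u z)\<^sup>2 \<partial>lborel))"
      using pair.AE_integrable_snd[OF integrable_square_prod] AE_space
    proof eventually_elim
      case (elim z)
      have "square_integrable lborel (\<lambda>u. \<phi> u z)"
        using elim by (auto simp: square_integrable_def)
      moreover have "square_integrable lborel (indicator {0..t} :: real \<Rightarrow> real)"
        using integrable_indicator_t by (simp add: square_integrable_def power2_eq_square indicator_inter_arith[symmetric])
      moreover have "(\<integral>u. (indicator {0..t} u :: real)\<^sup>2 \<partial>lborel) = t"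
        using t_nonneg by (simp add: power2_eq_square indicator_inter_arith[symmetric])
      ultimately have "\<bar>\<integral>u. \<phi> u z * indicator {0..t} u \<partial>lborel\<bar> \<le> sqrt (\<integral>u. (\<phi> u z)\<^sup>2 \<partial>lborel) * sqrt t"
        using Cauchy_Schwarz_integral[of lborel "\<lambda>u. \<phi> u z" "indicator {0..t}"] by simp
      moreover have "\<phi> u z * indicator {0..t} u = \<phi> u z" for u
        by (cases "u \<in> {0..t}") (auto simp: \<phi>_outside)
      ultimately have "\<bar>\<integral>u. \<phi> u z \<partial>lborel\<bar>\<^sup>2 \<le> (sqrt (\<integral>u. (\<phi> u z)\<^sup>2 \<partial>lborel) * sqrt t)\<^sup>2"
        by (intro power_mono) auto
      then show ?case using t_nonneg by (simp add: power_mult_distrib mult.commute)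
    qed
  qed measurable
qed

text \<open>Fubini applies because the integrand on the product space is a product of two
  square-integrable functions: \<phi>, and g cut off to u in [0, t], a cut that changes nothing
  after multiplication by \<phi>.\<close>

lemma integral_field_inner:
  assumes g: "square_integrable N g"
  shows "(\<integral>z. (\<integral>u. \<phi> u z \<partial>lborel) * g z \<partial>N) = (\<integral>u. (\<integral>z. \<phi> u z * g z \<partial>N) \<partial>lborel)"
proof -
  note [measurable] = square_integrableD(1)[OF g]
  have ind: "integrable (lborel \<Otimes>\<^sub>M N) (\<lambda>(u, z). (indicator {0..t} u * g z)\<^sup>2)"
  proof (rule pair.Fubini_integrable)
    have eq: "(indicator {0..t} u * g z)\<^sup>2 = indicator {0..t} u * (g z)\<^sup>2" for u z
      by (simp add: indicator_def)
    show "integrable lborel (\<lambda>u. \<integral>z. norm (case (u, z) of (u, z) \<Rightarrow> (indicator {0..t} u * g z)\<^sup>2) \<partial>N)"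
      using integrable_indicator_t by (simp add: eq)
    show "AE u in lborel. integrable N (\<lambda>z. case (u, z) of (u, z) \<Rightarrow> (indicator {0..t} u * g z)\<^sup>2)"
      using square_integrableD(2)[OF g] by (simp add: eq)
  qed measurable
  have "integrable (lborel \<Otimes>\<^sub>M N) (\<lambda>p. (case p of (u, z) \<Rightarrow> \<phi> u z) * (case p of (u, z) \<Rightarrow> indicator {0..t} u * g z))"
    using integrable_square_prod ind
    by (intro square_integrable_mult) (auto simp: square_integrable_def case_prod_beta')
  moreover have "\<phi> u z * (indicator {0..t} u * g z) = \<phi> u z * g z" for u z
    by (cases "u \<in> {0..t}") (auto simp: \<phi>_outside)
  ultimately have "integrable (lborel \<Otimes>\<^sub>M N) (\<lambda>(u, z). \<phi> u z * g z)" by (simp add: case_prod_beta')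
  from pair.Fubini_integral[OF this] show ?thesis by simp
qed

end

text \<open>Pointwise approximants with |h n| <= 2 |g| supply the dominating function 9 g^2, finite
  support, and zeros wherever g is zero. The last property preserves disjointness of
  supports.\<close>

lemma square_integrable_simple_approx:
  assumes g: "square_integrable N g"
  shows "\<exists>h. (\<forall>n. simple_finite N (h n)) \<and> l2_tendsto N h g \<and> (\<forall>n. \<forall>z\<in>space N. g z = 0 \<longrightarrow> h n z = 0)"
proof -
  note [measurable] = square_integrableD(1)[OF g]
  obtain h where h: "\<And>n. simple_function N (h n)" "\<And>z. z \<in> space N \<Longrightarrow> (\<lambda>n. h n z) \<longlonglongrightarrow> g z"
    and bd: "\<And>n z. z \<in> space N \<Longrightarrow> dist (h n z) 0 \<le> 2 * dist (g z) 0"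
    using borel_measurable_implies_sequence_metric[OF square_integrableD(1)[OF g], of 0] by metis
  have [measurable]: "h n \<in> borel_measurable N" for n by (rule borel_measurable_simple_function[OF h(1)])
  have sq: "square_integrable N (h n)" for n
    by (rule square_integrable_bound[OF g, where c=2]) (use bd in auto)
  have "simple_finite N (h n)" for n
    unfolding simple_finite_def finite_sets_def
  proof (intro conjI CollectI h(1))
    have s: "simple_function N (\<lambda>z. ennreal ((h n z)\<^sup>2))"
      using h(1)[of n] by (rule simple_function_compose1)
    have "(\<integral>\<^sup>+z. ennreal ((h n z)\<^sup>2) \<partial>N) < \<infinity>"
      using square_integrableD(2)[OF sq[of n]] by (simp add: nn_integral_eq_integral)
    from simple_function_finite_support[OF s this]
    show "emeasure N {z \<in> space N. h n z \<noteq> 0} < \<infinity>"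
      by (simp add: less_top[symmetric] ennreal_eq_0_iff)
    show "{z \<in> space N. h n z \<noteq> 0} \<in> sets N" by measurable
  qed
  moreover have "(\<lambda>n. \<integral>z. (h n z - g z)\<^sup>2 \<partial>N) \<longlonglongrightarrow> (\<integral>z. 0 \<partial>N)"
  proof (rule integral_dominated_convergence)
    show "integrable N (\<lambda>z. 9 * (g z)\<^sup>2)" using square_integrableD(2)[OF g] by simp
    show "AE z in N. (\<lambda>n. (h n z - g z)\<^sup>2) \<longlonglongrightarrow> 0"
    proof (rule AE_I2)
      fix z assume "z \<in> space N"
      then have "(\<lambda>n. (h n z - g z)\<^sup>2) \<longlonglongrightarrow> (g z - g z)\<^sup>2" by (intro tendsto_intros h)
      then show "(\<lambda>n. (h n z - g z)\<^sup>2) \<longlonglongrightarrow> 0" by simp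
    qed
    show "AE z in N. norm ((h n z - g z)\<^sup>2) \<le> 9 * (g z)\<^sup>2" for n
    proof (rule AE_I2)
      fix z assume "z \<in> space N"
      then have "\<bar>h n z - g z\<bar> \<le> 3 * \<bar>g z\<bar>" using bd[of z n] by simp
      then have "\<bar>h n z - g z\<bar>\<^sup>2 \<le> (3 * \<bar>g z\<bar>)\<^sup>2" by (intro power_mono) auto
      then show "norm ((h n z - g z)\<^sup>2) \<le> 9 * (g z)\<^sup>2" by (simp add: power_mult_distrib)
    qed
  qed measurable
  moreover have "h n z = 0" if "z \<in> space N" "g z = 0" for n z
    using bd[OF that(1), of n] that(2) by simp
  ultimately show ?thesis
    using sq g by (intro exI[of _ h]) (auto simp: l2_tendsto_def)
qed

section \<open>Two halves of a law of the iterated logarithm\<close>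

text \<open>A dyadic point of level n is reached from \<open>a\<close> with at most one increment
  per level: an even numerator lowers the level, an odd one first steps back by one. Continuity
  extends the bound to every t.\<close>

lemma dyadic_chaining:
  fixes w :: "real \<Rightarrow> real"
  assumes cont: "continuous_on {a..a+T} w" and T: "0 < T" and x: "0 \<le> x"
    and incr: "\<And>j i. i < 2 ^ j \<Longrightarrow> \<bar>w (a + real (Suc i) * T / 2 ^ j) - w (a + real i * T / 2 ^ j)\<bar> \<le> x * (3 / 4) ^ j"
    and t: "t \<in> {a..a+T}"
  shows "\<bar>w t - w a\<bar> \<le> 4 * x"
proof -
  \<comment> \<open>The full geometric series has sum 4, the constant of the conclusion.\<close>
  have S: "(\<Sum>j\<le>n. (3 / 4 :: real) ^ j) \<le> 4" for n
  proof -
    have "(\<Sum>j\<le>n. (3 / 4 :: real) ^ j) = 4 - 3 * (3 / 4) ^ n" by (induction n) auto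
    then show ?thesis by simp
  qed
  have D: "\<bar>w (a + real k * T / 2 ^ n) - w a\<bar> \<le> x * (\<Sum>j\<le>n. (3 / 4) ^ j)" if "k \<le> 2 ^ n" for n k
    using that
  proof (induction n arbitrary: k)
    case 0
    then have "k = 0 \<or> k = 1" by auto
    then show ?case using incr[of 0 0] x by auto
  next
    case (Suc n)
    have half: "a + real (2 * i) * T / 2 ^ Suc n = a + real i * T / 2 ^ n" for i by simp
    have le: "x * (\<Sum>j\<le>n. (3 / 4) ^ j) \<le> x * (\<Sum>j\<le>Suc n. (3 / 4) ^ j)"
      using x by (intro mult_left_mono) auto
    show ?case
    proof (cases "even k")
      case True
      then obtain i where i: "k = 2 * i" by (elim evenE)
      with Suc.prems have "i \<le> 2 ^ n" by simp
      from Suc.IH[OF this] show ?thesis unfolding i half using le by linarith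
    next
      case False
      then obtain i where i: "k = Suc (2 * i)" by (metis oddE Suc_eq_plus1)
      with Suc.prems have "i \<le> 2 ^ n" and i2: "2 * i < 2 ^ Suc n" by auto
      from Suc.IH[OF this(1)] have "\<bar>w (a + real (2 * i) * T / 2 ^ Suc n) - w a\<bar> \<le> x * (\<Sum>j\<le>n. (3 / 4) ^ j)"
        unfolding half .
      moreover have "\<bar>w (a + real k * T / 2 ^ Suc n) - w (a + real (2 * i) * T / 2 ^ Suc n)\<bar> \<le> x * (3 / 4) ^ Suc n"
        unfolding i by (rule incr[OF i2])
      moreover have "x * (\<Sum>j\<le>Suc n. (3 / 4) ^ j) = x * (\<Sum>j\<le>n. (3 / 4) ^ j) + x * (3 / 4) ^ Suc n"
        by (simp add: distrib_left)
      ultimately show ?thesis by linarith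
    qed
  qed
  \<comment> \<open>Dyadic approximation of t from below, so that all points remain in the
    interval.\<close>
  define k where "k n = nat \<lfloor>(t - a) / T * 2 ^ n\<rfloor>" for n
  define d where "d n = a + real (k n) * T / 2 ^ n" for n
  have nn: "0 \<le> (t - a) / T" "(t - a) / T \<le> 1" using t T by auto
  have k: "real (k n) \<le> (t - a) / T * 2 ^ n" "(t - a) / T * 2 ^ n < real (k n) + 1" for n
  proof -
    have "0 \<le> (t - a) / T * 2 ^ n" using nn by (intro mult_nonneg_nonneg) auto
    then have "real (k n) = of_int \<lfloor>(t - a) / T * 2 ^ n\<rfloor>"
      unfolding k_def by (intro of_nat_nat) (simp only: zero_le_floor)
    then show "real (k n) \<le> (t - a) / T * 2 ^ n" "(t - a) / T * 2 ^ n < real (k n) + 1"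
      by linarith+
  qed
  have kle: "k n \<le> 2 ^ n" for n
  proof -
    have "(t - a) / T * 2 ^ n \<le> 1 * 2 ^ n" using nn by (intro mult_right_mono) auto
    with k(1)[of n] have "real (k n) \<le> real (2 ^ n)" by (simp only: of_nat_power of_nat_numeral mult_1)
    then show ?thesis by (simp only: of_nat_le_iff)
  qed
  have d1: "d n \<le> t" "t - T / 2 ^ n \<le> d n" for n
  proof -
    have "real (k n) / 2 ^ n * T \<le> (t - a) / T * T"
      using k(1)[of n] T by (intro mult_right_mono) (auto simp: field_simps)
    then show "d n \<le> t" using T by (simp add: d_def)
    have "(t - a) / T * T \<le> (real (k n) / 2 ^ n + 1 / 2 ^ n) * T"
      using k(2)[of n] T by (intro mult_right_mono) (auto simp: field_simps)
    moreover have "(t - a) / T * T = t - a" using T by simp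
    ultimately show "t - T / 2 ^ n \<le> d n" by (simp add: d_def algebra_simps)
  qed
  have "(\<lambda>n. t - T / 2 ^ n) \<longlonglongrightarrow> t - 0"
    by (intro tendsto_diff tendsto_const LIMSEQ_divide_realpow_zero) simp
  then have lim: "(\<lambda>n. t - T / 2 ^ n) \<longlonglongrightarrow> t" by (simp only: diff_zero)
  have "d \<longlonglongrightarrow> t"
    by (rule tendsto_sandwich[OF always_eventually[OF allI[OF d1(2)]] always_eventually[OF allI[OF d1(1)]] lim tendsto_const])
  moreover have "d n \<in> {a..a+T}" for n
    using d1(1)[of n] t T by (auto simp: d_def)
  ultimately have "(\<lambda>n. w (d n)) \<longlonglongrightarrow> w t"
    using cont t by (auto simp: continuous_on_sequentially o_def)
  then have "(\<lambda>n. \<bar>w (d n) - w a\<bar>) \<longlonglongrightarrow> \<bar>w t - w a\<bar>"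
    by (intro tendsto_intros)
  moreover have "\<bar>w (d n) - w a\<bar> \<le> 4 * x" for n
  proof -
    have "\<bar>w (d n) - w a\<bar> \<le> x * (\<Sum>j\<le>n. (3 / 4) ^ j)" unfolding d_def by (rule D[OF kle])
    also have "\<dots> \<le> x * 4" by (rule mult_left_mono[OF S x])
    finally show ?thesis by simp
  qed
  ultimately show ?thesis by (intro LIMSEQ_le_const2) auto
qed

text \<open>The weights \<open>(3/4)\<^sup>j\<close> are summable, while \<open>(3/4)\<^sup>2 > 1/2\<close> lets the Gaussian tails beat the number
  \<open>2\<^sup>j\<close> of increments at level \<open>j\<close>.\<close>

lemma (in prob_space) chaining_tail:
  fixes W :: "real \<Rightarrow> 'a \<Rightarrow> real"
  assumes v: "0 < v" and meas: "\<And>t. 0 \<le> t \<Longrightarrow> random_variable borel (W t)"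
    and tail: "\<And>s t x. 0 \<le> s \<Longrightarrow> s < t \<Longrightarrow> 0 \<le> x \<Longrightarrow>
      prob {\<omega> \<in> space M. x < \<bar>W t \<omega> - W s \<omega>\<bar>} \<le> 2 * exp (- x\<^sup>2 / (2 * (v * (t - s))))"
    and a: "0 \<le> a" and T: "0 < T" and x: "0 \<le> x" and large: "16 \<le> x\<^sup>2 / (2 * v * T)"
  defines "B \<equiv> \<lambda>j i. {\<omega> \<in> space M. x * (3 / 4) ^ j <
      \<bar>W (a + real (Suc i) * T / 2 ^ j) \<omega> - W (a + real i * T / 2 ^ j) \<omega>\<bar>}"
  shows "prob (\<Union>j. \<Union>i<2 ^ j. B j i) \<le> 4 * exp (- (x\<^sup>2 / (2 * v * T)))"
proof -
  define L where "L = x\<^sup>2 / (2 * v * T)"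
  have "16 \<le> L" using large by (simp only: L_def)
  have [measurable]: "random_variable borel (W (a + real i * T / 2 ^ j))" for i j
    using a T by (intro meas) auto
  have B[measurable]: "B j i \<in> events" for i j unfolding B_def by measurable
  \<comment> \<open>The threshold 16 is chosen for this: the factor 1/4 per level beats the 2^j
    increments at level j and leaves (1/2)^j.\<close>
  have e4: "exp (- L / 8) \<le> 1 / 4"
  proof -
    have "4 \<le> exp (2 :: real)" using exp_lower_Taylor_quadratic[of 2] by simp
    then have "exp (- 2) \<le> (1 / 4 :: real)" by (simp add: exp_minus field_simps)
    moreover have "exp (- L / 8) \<le> exp (- 2)" using \<open>16 \<le> L\<close> by simp
    ultimately show ?thesis by linarith
  qed
  have Bji: "prob (B j i) \<le> 2 * exp (- L) * (1 / 4) ^ j" if "i < 2 ^ j" for i j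
  proof -
    have "prob (B j i) \<le> 2 * exp (- (x * (3 / 4) ^ j)\<^sup>2 / (2 * (v * (a + real (Suc i) * T / 2 ^ j - (a + real i * T / 2 ^ j)))))"
      unfolding B_def using a T x by (intro tail) (auto simp: divide_strict_right_mono)
    also have "a + real (Suc i) * T / 2 ^ j - (a + real i * T / 2 ^ j) = T / 2 ^ j"
      by (simp add: field_simps)
    also have "- (x * (3 / 4) ^ j)\<^sup>2 / (2 * (v * (T / 2 ^ j))) = - (L * (9 / 8) ^ j)"
    proof -
      \<comment> \<open>An increment of level j has variance of order 2^-j, so the exponent grows
        like (9/16 * 2)^j.\<close>
      have "((3 / 4 :: real) ^ j)\<^sup>2 * 2 ^ j = (9 / 8) ^ j"
        unfolding power2_eq_square by (simp add: power_mult_distrib[symmetric])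
      then show ?thesis using v T by (simp add: L_def power_mult_distrib field_simps)
    qed
    also have "exp (- (L * (9 / 8) ^ j)) \<le> exp (- L) * (1 / 4) ^ j"
    proof -
      \<comment> \<open>Bernoulli's inequality replaces geometric growth of the exponent by linear
        growth, that is, by a factor exp (-L / 8) per level.\<close>
      have "1 + real j * (1 / 8) \<le> (1 + 1 / 8 :: real) ^ j" by (rule Bernoulli_inequality) simp
      then have "L * (1 + real j * (1 / 8)) \<le> L * (9 / 8) ^ j"
        using \<open>16 \<le> L\<close> by (intro mult_left_mono) auto
      then have "exp (- (L * (9 / 8) ^ j)) \<le> exp (- L + real j * (- L / 8))"
        by (simp add: algebra_simps)
      also have "\<dots> = exp (- L) * exp (- L / 8) ^ j"
        by (simp only: exp_add exp_of_nat_mult)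
      also have "\<dots> \<le> exp (- L) * (1 / 4) ^ j"
        using e4 by (intro mult_left_mono power_mono) auto
      finally show ?thesis .
    qed
    finally show ?thesis by simp
  qed
  have Bj: "prob (\<Union>i<2 ^ j. B j i) \<le> 2 * exp (- L) * (1 / 2) ^ j" for j
  proof -
    have "prob (\<Union>i<2 ^ j. B j i) \<le> (\<Sum>i<2 ^ j. prob (B j i))"
      by (rule finite_measure_subadditive_finite) auto
    also have "\<dots> \<le> (\<Sum>i<(2::nat) ^ j. 2 * exp (- L) * (1 / 4) ^ j)"
      by (intro sum_mono Bji) auto
    also have "\<dots> = 2 * exp (- L) * (2 ^ j * (1 / 4) ^ j)" by simp
    also have "2 ^ j * (1 / 4 :: real) ^ j = (1 / 2) ^ j"
      by (simp add: power_mult_distrib[symmetric])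
    finally show ?thesis .
  qed
  have sum: "summable (\<lambda>j. 2 * exp (- L) * (1 / 2) ^ j)"
    by (intro summable_mult summable_geometric) simp
  have sumB: "summable (\<lambda>j. prob (\<Union>i<2 ^ j. B j i))"
    by (rule summable_comparison_test'[OF sum, of 0]) (use Bj in auto)
  have "prob (\<Union>j. \<Union>i<2 ^ j. B j i) \<le> (\<Sum>j. prob (\<Union>i<2 ^ j. B j i))"
    by (rule finite_measure_subadditive_countably[OF _ sumB]) auto
  also have "\<dots> \<le> (\<Sum>j. 2 * exp (- L) * (1 / 2) ^ j)"
    by (rule suminf_le[OF Bj sumB sum])
  also have "\<dots> = 4 * exp (- L)"
    by (subst suminf_mult) (auto simp: suminf_geometric)
  finally show "prob (\<Union>j. \<Union>i<2 ^ j. B j i) \<le> 4 * exp (- (x\<^sup>2 / (2 * v * T)))"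
    by (simp add: L_def)
qed

text \<open>The terms are (Suc k * ln \<rho>)^-\<alpha>, a convergent p-series. Exponents start at 1
  because ln (\<rho>^0) = 0.\<close>

lemma summable_iterated_log_powr:
  fixes \<rho> \<alpha> :: real
  assumes "1 < \<rho>" "1 < \<alpha>"
  shows "summable (\<lambda>k. exp (- (\<alpha> * ln (ln (\<rho> ^ Suc k)))))"
proof -
  have "summable (\<lambda>k. (ln \<rho>) powr (- \<alpha>) * real (Suc k) powr (- \<alpha>))"
    using assms by (intro summable_mult summable_Suc_iff[THEN iffD2]) (simp add: summable_real_powr_iff)
  moreover have "exp (- (\<alpha> * ln (ln (\<rho> ^ Suc k)))) = (ln \<rho>) powr (- \<alpha>) * real (Suc k) powr (- \<alpha>)" for k
  proof -
    have "0 < ln \<rho>" using assms by simp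
    moreover have "ln (\<rho> ^ Suc k) = ln \<rho> * real (Suc k)"
      using assms by (subst ln_realpow) auto
    ultimately show ?thesis
      using assms by (simp only: powr_mult[symmetric]) (simp add: powr_def)
  qed
  ultimately show ?thesis by simp
qed

lemma filterlim_power_Suc_at_top:
  fixes \<rho> :: real
  assumes "1 < \<rho>"
  shows "filterlim (\<lambda>k. \<rho> ^ Suc k) at_top sequentially"
  unfolding filterlim_at_top eventually_sequentially
proof
  fix Z
  obtain n where n: "Z < \<rho> ^ n" using real_arch_pow[OF assms] by blast
  have "Z \<le> \<rho> ^ Suc k" if "n \<le> k" for k
    using n that power_increasing[of n "Suc k" \<rho>] assms by linarith
  then show "\<exists>n. \<forall>k\<ge>n. Z \<le> \<rho> ^ Suc k" by blast
qed

lemma exists_power_interval: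
  fixes \<rho> t :: real
  assumes "1 < \<rho>" "\<rho> ^ K \<le> t"
  shows "\<exists>k\<ge>K. \<rho> ^ k \<le> t \<and> t \<le> \<rho> * \<rho> ^ k"
proof -
  obtain n where n: "t < \<rho> ^ n" using real_arch_pow[OF assms(1)] by blast
  define k where "k = (GREATEST k. \<rho> ^ k \<le> t)"
  have bd: "k \<le> n" if "\<rho> ^ k \<le> t" for k
    using that n assms(1) by (meson less_le_not_le nat_le_linear order_trans power_increasing less_imp_le)
  have k: "\<rho> ^ k \<le> t" "K \<le> k"
    unfolding k_def using GreatestI_nat[of "\<lambda>k. \<rho> ^ k \<le> t" K n] Greatest_le_nat[of "\<lambda>k. \<rho> ^ k \<le> t" K n] assms bd by auto
  have "\<not> \<rho> ^ Suc k \<le> t"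
  proof
    assume "\<rho> ^ Suc k \<le> t"
    then have "Suc k \<le> k"
      unfolding k_def using Greatest_le_nat[of "\<lambda>k. \<rho> ^ k \<le> t" _ n] bd by blast
    then show False by simp
  qed
  with k show ?thesis by (intro exI[of _ k]) auto
qed

text \<open>The process enters through its increment tails and path continuity alone. On a block
  [a k, \<rho> * a k] the left end contributes 1 + \<epsilon> and the chaining bound 4
  \<epsilon>.\<close>

lemma (in prob_space) lil_upper:
  fixes W :: "real \<Rightarrow> 'a \<Rightarrow> real"
  assumes v: "0 < v" and meas: "\<And>t. 0 \<le> t \<Longrightarrow> random_variable borel (W t)"
    and zero: "\<And>\<omega>. W 0 \<omega> = 0"
    and tail: "\<And>s t x. 0 \<le> s \<Longrightarrow> s < t \<Longrightarrow> 0 \<le> x \<Longrightarrow>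
      prob {\<omega> \<in> space M. x < \<bar>W t \<omega> - W s \<omega>\<bar>} \<le> 2 * exp (- x\<^sup>2 / (2 * (v * (t - s))))"
    and cont: "AE \<omega> in M. continuous_on {0..} (\<lambda>t. W t \<omega>)"
    and \<epsilon>: "0 < \<epsilon>"
  shows "AE \<omega> in M. \<forall>\<^sub>F t in at_top. \<bar>W t \<omega>\<bar> \<le> (1 + 5 * \<epsilon>) * sqrt (2 * v * t * ln (ln t))"
proof -
  \<comment> \<open>With T k = (\<rho> - 1) * a k, this value makes (\<epsilon> \<psi>)^2 / (2 v T)
    equal to exactly 2 ln (ln (a k)).\<close>
  define \<rho> where "\<rho> = 1 + \<epsilon>\<^sup>2 / 2"
  have \<rho>: "1 < \<rho>" using \<epsilon> by (simp add: \<rho>_def)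
  define \<psi> where "\<psi> t = sqrt (2 * v * t * ln (ln t))" for t
  define a where "a k = \<rho> ^ Suc k" for k
  have a: "1 < a k" for k unfolding a_def using \<rho> by (intro one_less_power) auto
  define T where "T k = (\<rho> - 1) * a k" for k
  have T: "0 < T k" for k using a[of k] \<rho> by (simp add: T_def)
  define B where "B k j i = {\<omega> \<in> space M. (\<epsilon> * \<psi> (a k)) * (3 / 4) ^ j <
      \<bar>W (a k + real (Suc i) * T k / 2 ^ j) \<omega> - W (a k + real i * T k / 2 ^ j) \<omega>\<bar>}" for k j i
  define A where "A k = {\<omega> \<in> space M. (1 + \<epsilon>) * \<psi> (a k) < \<bar>W (a k) \<omega>\<bar>} \<union> (\<Union>j. \<Union>i<2 ^ j. B k j i)" for k
  have "filterlim a at_top sequentially"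
    unfolding a_def by (rule filterlim_power_Suc_at_top[OF \<rho>])
  then have "filterlim (\<lambda>k. ln (ln (a k))) at_top sequentially"
    by (intro filterlim_compose[OF ln_at_top])
  \<comment> \<open>From 8 on, the chaining exponent 2 ln (ln (a k)) reaches the threshold 16 of
    \<open>chaining_tail\<close>.\<close>
  then obtain K where K: "\<And>k. k \<ge> K \<Longrightarrow> 8 \<le> ln (ln (a k))"
    by (auto simp: filterlim_at_top eventually_sequentially)
  have \<psi>: "0 \<le> \<psi> (a k)" "(\<psi> (a k))\<^sup>2 = 2 * v * a k * ln (ln (a k))" if "k \<ge> K" for k
  proof -
    have "0 \<le> ln (ln (a k))" using K[OF that] by linarith
    then have "0 \<le> 2 * v * a k * ln (ln (a k))"
      using a[of k] v by (intro mult_nonneg_nonneg) linarith+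
    then show "0 \<le> \<psi> (a k)" "(\<psi> (a k))\<^sup>2 = 2 * v * a k * ln (ln (a k))"
      by (simp_all only: \<psi>_def real_sqrt_ge_zero real_sqrt_pow2)
  qed
  have [measurable]: "random_variable borel (W (a k + real i * T k / 2 ^ j))" "random_variable borel (W (a k))" for k i j
    using a[of k] T[of k] by (auto intro!: meas)
  have Bm[measurable]: "B k j i \<in> events" for k j i unfolding B_def by measurable
  have Am[measurable]: "A k \<in> events" for k unfolding A_def by measurable
  have A: "prob (A k) \<le> 2 * exp (- ((1 + \<epsilon>)\<^sup>2 * ln (ln (a k)))) + 4 * exp (- (2 * ln (ln (a k))))" if k: "k \<ge> K" for k
  proof -
    have "prob (A k) \<le> prob {\<omega> \<in> space M. (1 + \<epsilon>) * \<psi> (a k) < \<bar>W (a k) \<omega>\<bar>} + prob (\<Union>j. \<Union>i<2 ^ j. B k j i)"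
      unfolding A_def by (rule measure_Un_le) measurable
    also have "\<dots> \<le> 2 * exp (- ((1 + \<epsilon>)\<^sup>2 * ln (ln (a k)))) + 4 * exp (- (2 * ln (ln (a k))))"
    proof (rule add_mono)
      have "prob {\<omega> \<in> space M. (1 + \<epsilon>) * \<psi> (a k) < \<bar>W (a k) \<omega> - W 0 \<omega>\<bar>} \<le>
          2 * exp (- ((1 + \<epsilon>) * \<psi> (a k))\<^sup>2 / (2 * (v * (a k - 0))))"
        using \<psi>[OF k] a[of k] \<epsilon> by (intro tail) auto
      also have "- ((1 + \<epsilon>) * \<psi> (a k))\<^sup>2 / (2 * (v * (a k - 0))) = - ((1 + \<epsilon>)\<^sup>2 * ln (ln (a k)))"
        unfolding power_mult_distrib \<psi>(2)[OF k] using v a[of k] by (simp add: field_simps)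
      finally show "prob {\<omega> \<in> space M. (1 + \<epsilon>) * \<psi> (a k) < \<bar>W (a k) \<omega>\<bar>} \<le> 2 * exp (- ((1 + \<epsilon>)\<^sup>2 * ln (ln (a k))))"
        by (simp add: zero)
      have eq: "(\<epsilon> * \<psi> (a k))\<^sup>2 / (2 * v * T k) = 2 * ln (ln (a k))"
        unfolding power_mult_distrib \<psi>(2)[OF k] T_def \<rho>_def using v a[of k] \<epsilon> by (simp add: field_simps)
      have "prob (\<Union>j. \<Union>i<2 ^ j. B k j i) \<le> 4 * exp (- ((\<epsilon> * \<psi> (a k))\<^sup>2 / (2 * v * T k)))"
        unfolding B_def using a[of k] T[of k] \<psi>[OF k] \<epsilon> K[OF k]
        by (intro chaining_tail[OF v meas tail]) (auto simp: eq)
      then show "prob (\<Union>j. \<Union>i<2 ^ j. B k j i) \<le> 4 * exp (- (2 * ln (ln (a k))))" by (simp add: eq)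
    qed
    finally show ?thesis .
  qed
  have "AE \<omega> in M. eventually (\<lambda>k. \<omega> \<in> space M - A k) sequentially"
  proof (rule borel_cantelli_AE1)
    have "1 < (1 + \<epsilon>)\<^sup>2" using \<epsilon> by (simp add: power2_eq_square algebra_simps add_pos_pos)
    then have "summable (\<lambda>k. 2 * exp (- ((1 + \<epsilon>)\<^sup>2 * ln (ln (a k)))) + 4 * exp (- (2 * ln (ln (a k)))))"
      unfolding a_def by (intro summable_add summable_mult summable_iterated_log_powr \<rho>) auto
    then show "summable (\<lambda>k. prob (A k))"
      by (rule summable_comparison_test'[of _ K]) (use A in auto)
  qed (auto simp: emeasure_eq_measure)
  with cont show ?thesis
  proof eventually_elim
    case (elim \<omega>)
    then obtain K' where K': "\<And>k. k \<ge> K' \<Longrightarrow> \<omega> \<in> space M - A k" by (auto simp: eventually_sequentially)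
    have "\<bar>W t \<omega>\<bar> \<le> (1 + 5 * \<epsilon>) * \<psi> t" if t: "t \<ge> \<rho> ^ Suc (max K K')" for t
    proof -
      \<comment> \<open>The grid is \<open>a k = \<rho> ^ Suc k\<close>, hence the successor in the
        bound and the predecessor in the definition of k.\<close>
      obtain k' where k': "k' \<ge> Suc (max K K')" "\<rho> ^ k' \<le> t" "t \<le> \<rho> * \<rho> ^ k'"
        using exists_power_interval[OF \<rho> t] by blast
      define k where "k = k' - 1"
      have k'k: "k' = Suc k" using k'(1) by (simp add: k_def)
      have k: "k \<ge> K" "k \<ge> K'" "a k \<le> t" "t \<le> a k + T k"
        using k' by (auto simp: k'k a_def T_def algebra_simps)
      have \<omega>: "\<omega> \<in> space M" "\<omega> \<notin> A k" using K'[OF k(2)] by auto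
      have 1: "\<bar>W (a k) \<omega>\<bar> \<le> (1 + \<epsilon>) * \<psi> (a k)" using \<omega> by (auto simp: A_def not_less)
      have 2: "\<bar>W t \<omega> - W (a k) \<omega>\<bar> \<le> 4 * (\<epsilon> * \<psi> (a k))"
      proof (rule dyadic_chaining[where T="T k" and w="\<lambda>t. W t \<omega>" and a="a k" and x="\<epsilon> * \<psi> (a k)"])
        show "continuous_on {a k..a k + T k} (\<lambda>t. W t \<omega>)"
          using a[of k] by (intro continuous_on_subset[OF elim(1)]) auto
        show "\<bar>W (a k + real (Suc i) * T k / 2 ^ j) \<omega> - W (a k + real i * T k / 2 ^ j) \<omega>\<bar> \<le> \<epsilon> * \<psi> (a k) * (3 / 4) ^ j"
          if "i < 2 ^ j" for j i
        proof -
          have "\<omega> \<notin> B k j i" using \<omega>(2) that unfolding A_def by blast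
          then show ?thesis using \<omega>(1) unfolding B_def by (simp only: mem_Collect_eq not_less simp_thms)
        qed
      qed (use k T[of k] \<psi>[OF k(1)] \<epsilon> in auto)
      have "\<psi> (a k) \<le> \<psi> t"
      proof -
        have "0 < ln (a k)" using a[of k] by simp
        moreover have "ln (a k) \<le> ln t" using k a[of k] by simp
        ultimately have "ln (ln (a k)) \<le> ln (ln t)" by simp
        moreover have "0 \<le> ln (ln (a k))" using K[OF k(1)] by linarith
        moreover have "2 * v * a k \<le> 2 * v * t" "0 \<le> 2 * v * t" using k v a[of k] by auto
        ultimately show ?thesis
          unfolding \<psi>_def by - (rule real_sqrt_le_mono, rule mult_mono)
      qed
      have "\<bar>W t \<omega>\<bar> \<le> (1 + 5 * \<epsilon>) * \<psi> (a k)" using 1 2 by (simp add: algebra_simps)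
      also have "\<dots> \<le> (1 + 5 * \<epsilon>) * \<psi> t" using \<open>\<psi> (a k) \<le> \<psi> t\<close> \<epsilon> by (intro mult_left_mono) auto
      finally show ?thesis .
    qed
    then show ?case unfolding \<psi>_def eventually_at_top_linorder by blast
  qed
qed


text \<open>Second Borel-Cantelli lemma. If all events from n on fail with probability q > 0,
  independence and 1 - p <= exp (-p) bound the sums of the probabilities beyond n by -ln q, against
  divergence.\<close>

lemma (in prob_space) frequently_indep_vars_greater:
  fixes E :: "nat \<Rightarrow> 'a \<Rightarrow> real"
  assumes ind: "indep_vars (\<lambda>_. borel) E UNIV"
    and div: "\<not> summable (\<lambda>k. prob {\<omega> \<in> space M. c k < E k \<omega>})"
  shows "AE \<omega> in M. \<exists>\<^sub>F k in sequentially. c k < E k \<omega>"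
proof -
  have [measurable]: "random_variable borel (E k)" for k
    using ind by (auto simp: indep_vars_def)
  define p where "p k = prob {\<omega> \<in> space M. c k < E k \<omega>}" for k
  define D where "D k = {\<omega> \<in> space M. \<not> c k < E k \<omega>}" for k
  have Dm[measurable]: "D k \<in> events" for k unfolding D_def by measurable
  have D: "indep_events D UNIV"
    unfolding D_def by (rule indep_eventsI_indep_vars[OF ind]) auto
  have pD: "prob (D k) = 1 - p k" for k
    unfolding D_def p_def by (rule prob_neg) measurable
  have zero: "prob (\<Inter>k\<in>{n..}. D k) = 0" for n
  proof (rule ccontr)
    assume "prob (\<Inter>k\<in>{n..}. D k) \<noteq> 0"
    then have q: "0 < prob (\<Inter>k\<in>{n..}. D k)" by (simp add: zero_less_measure_iff)
    have "(\<Sum>k<j. p k) \<le> (\<Sum>k<n. p k) - ln (prob (\<Inter>k\<in>{n..}. D k))" for j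
    proof (cases "j \<le> n")
      case True
      then have "(\<Sum>k<j. p k) \<le> (\<Sum>k<n. p k)" by (intro sum_mono2) (auto simp: p_def)
      moreover have "ln (prob (\<Inter>k\<in>{n..}. D k)) \<le> 0" using q by simp
      ultimately show ?thesis by linarith
    next
      case False
      have "prob (\<Inter>k\<in>{n..}. D k) \<le> prob (\<Inter>k\<in>{n..<j}. D k)"
        using False by (intro finite_measure_mono sets.finite_INT) auto
      also have "\<dots> = (\<Prod>k\<in>{n..<j}. prob (D k))"
        using D False unfolding indep_events_def by auto
      also have "\<dots> \<le> (\<Prod>k\<in>{n..<j}. exp (- p k))"
        using exp_ge_add_one_self[of "- p _"] by (intro prod_mono) (auto simp: pD[symmetric]) 
      also have "\<dots> = exp (- (\<Sum>k\<in>{n..<j}. p k))"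
        by (simp add: exp_sum sum_negf[symmetric])
      finally have "ln (prob (\<Inter>k\<in>{n..}. D k)) \<le> ln (exp (- (\<Sum>k\<in>{n..<j}. p k)))"
        using q by (subst ln_le_cancel_iff) auto
      then have "ln (prob (\<Inter>k\<in>{n..}. D k)) \<le> - (\<Sum>k\<in>{n..<j}. p k)" by simp
      moreover have "(\<Sum>k<j. p k) = (\<Sum>k<n. p k) + (\<Sum>k\<in>{n..<j}. p k)"
        using False by (simp add: lessThan_atLeast0 sum.atLeastLessThan_concat)
      ultimately show ?thesis by linarith
    qed
    then have "summable p" by (intro summableI_nonneg_bounded) (auto simp: p_def)
    then show False using div by (simp add: p_def[abs_def])
  qed
  have "AE \<omega> in M. \<forall>n. \<omega> \<notin> (\<Inter>k\<in>{n..}. D k)"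
    unfolding AE_all_countable
  proof
    fix n
    have "(\<Inter>k\<in>{n..}. D k) \<in> null_sets M"
      using zero[of n] by (intro null_setsI) (auto simp: emeasure_eq_measure)
    then show "AE \<omega> in M. \<omega> \<notin> (\<Inter>k\<in>{n..}. D k)" by (rule AE_not_in)
  qed
  then show ?thesis
    using AE_space by eventually_elim (auto simp: D_def frequently_sequentially)
qed

text \<open>\<open>Z k\<close> is an independent Gaussian part \<open>E k\<close> of nearly full
  variance plus a remainder whose variance bound is the fraction 8/\<rho>. The first exceeds (1 -
  \<epsilon>) \<psi> infinitely often, the second is eventually at most \<epsilon> \<psi>.\<close>

lemma (in prob_space) lil_lower:
  fixes E Z :: "nat \<Rightarrow> 'a \<Rightarrow> real"
  assumes v: "0 < v" and \<epsilon>: "0 < \<epsilon>" "\<epsilon> < 1" and \<rho>: "16 / \<epsilon>\<^sup>2 \<le> \<rho>"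
    and ind: "indep_vars (\<lambda>_. borel) E UNIV"
    and Z: "\<And>k. random_variable borel (Z k)"
    and E: "\<And>k. centered_gaussian M (\<sigma> k) (E k)" "\<And>k. 0 \<le> \<sigma> k"
    and \<sigma>: "\<forall>\<^sub>F k in sequentially. v * \<rho> ^ Suc k * (1 - 4 / \<rho>) \<le> (\<sigma> k)\<^sup>2"
    and tail: "\<forall>\<^sub>F k in sequentially. \<forall>x\<ge>0. prob {\<omega> \<in> space M. x < \<bar>Z k \<omega> - E k \<omega>\<bar>}
      \<le> 2 * exp (- x\<^sup>2 / (2 * (8 * v * \<rho> ^ Suc k / \<rho>)))"
  shows "AE \<omega> in M. \<exists>\<^sub>F k in sequentially.
    (1 - 2 * \<epsilon>) * sqrt (2 * v * \<rho> ^ Suc k * ln (ln (\<rho> ^ Suc k))) \<le> Z k \<omega>"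
proof -
  define a where "a k = \<rho> ^ Suc k" for k
  define \<psi> where "\<psi> k = sqrt (2 * v * a k * ln (ln (a k)))" for k
  have "\<epsilon>\<^sup>2 \<le> 1" using \<epsilon> by (simp add: power_le_one)
  then have "16 \<le> 16 / \<epsilon>\<^sup>2" using \<epsilon> by (simp add: field_simps)
  then have \<rho>16: "16 \<le> \<rho>" using \<rho> by linarith
  have \<rho>\<epsilon>: "16 \<le> \<rho> * \<epsilon>\<^sup>2" using \<rho> \<epsilon> by (simp add: field_simps)
  have a: "1 < a k" for k unfolding a_def using \<rho>16 by (intro one_less_power) auto
  have [measurable]: "random_variable borel (Z k)" "random_variable borel (E k)" for k
    using Z E(1) by (auto dest: centered_gaussianD)
  have at_top: "filterlim (\<lambda>k. ln (ln (a k))) at_top sequentially"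
    unfolding a_def using \<rho>16
    by (intro filterlim_compose[OF ln_at_top] filterlim_power_Suc_at_top) auto
  have "\<forall>\<^sub>F k in sequentially. 2 / \<epsilon>\<^sup>2 \<le> ln (ln (a k))"
    using at_top by (simp add: filterlim_at_top)
  with \<sigma> tail have "\<forall>\<^sub>F k in sequentially. 2 / \<epsilon>\<^sup>2 \<le> ln (ln (a k)) \<and>
      v * a k * (1 - 4 / \<rho>) \<le> (\<sigma> k)\<^sup>2 \<and> (\<forall>x\<ge>0. prob {\<omega> \<in> space M. x < \<bar>Z k \<omega> - E k \<omega>\<bar>}
      \<le> 2 * exp (- x\<^sup>2 / (2 * (8 * v * a k / \<rho>))))"
    unfolding a_def by eventually_elim (intro conjI)
  then obtain K where K: "\<And>k. k \<ge> K \<Longrightarrow> 2 / \<epsilon>\<^sup>2 \<le> ln (ln (a k))"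
    "\<And>k. k \<ge> K \<Longrightarrow> v * a k * (1 - 4 / \<rho>) \<le> (\<sigma> k)\<^sup>2"
    "\<And>k x. k \<ge> K \<Longrightarrow> 0 \<le> x \<Longrightarrow> prob {\<omega> \<in> space M. x < \<bar>Z k \<omega> - E k \<omega>\<bar>}
      \<le> 2 * exp (- x\<^sup>2 / (2 * (8 * v * a k / \<rho>)))"
    unfolding eventually_sequentially by blast
  have \<psi>: "0 \<le> \<psi> k" "(\<psi> k)\<^sup>2 = 2 * v * a k * ln (ln (a k))" if "k \<ge> K" for k
  proof -
    have "0 \<le> 2 / \<epsilon>\<^sup>2" by simp
    then have "0 \<le> ln (ln (a k))" using K(1)[OF that] by linarith
    then have "0 \<le> 2 * v * a k * ln (ln (a k))"
      using a[of k] v by (intro mult_nonneg_nonneg) linarith+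
    then show "0 \<le> \<psi> k" "(\<psi> k)\<^sup>2 = 2 * v * a k * ln (ln (a k))"
      by (simp_all only: \<psi>_def real_sqrt_ge_zero real_sqrt_pow2)
  qed
  have "AE \<omega> in M. \<forall>\<^sub>F k in sequentially. \<omega> \<in> space M - {\<omega> \<in> space M. \<epsilon> * \<psi> k < \<bar>Z k \<omega> - E k \<omega>\<bar>}"
  proof (rule borel_cantelli_AE1)
    have "summable (\<lambda>k. 2 * exp (- (2 * ln (ln (a k)))))"
      unfolding a_def using \<rho>16 by (intro summable_mult summable_iterated_log_powr) auto
    then show "summable (\<lambda>k. prob {\<omega> \<in> space M. \<epsilon> * \<psi> k < \<bar>Z k \<omega> - E k \<omega>\<bar>})"
    proof (rule summable_comparison_test'[of _ K])
      fix k assume k: "K \<le> k"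
      have "0 \<le> 2 / \<epsilon>\<^sup>2" by simp
      then have L: "0 \<le> ln (ln (a k))" using K(1)[OF k] by linarith
      have "prob {\<omega> \<in> space M. \<epsilon> * \<psi> k < \<bar>Z k \<omega> - E k \<omega>\<bar>} \<le> 2 * exp (- (\<epsilon> * \<psi> k)\<^sup>2 / (2 * (8 * v * a k / \<rho>)))"
        using \<epsilon> \<psi>[OF k] by (intro K(3) k mult_nonneg_nonneg) auto
      also have "- (\<epsilon> * \<psi> k)\<^sup>2 / (2 * (8 * v * a k / \<rho>)) = - ((\<rho> * \<epsilon>\<^sup>2 / 8) * ln (ln (a k)))"
        unfolding power_mult_distrib \<psi>(2)[OF k] using v a[of k] \<rho>16 by (simp add: field_simps)
      also have "2 * exp (- ((\<rho> * \<epsilon>\<^sup>2 / 8) * ln (ln (a k)))) \<le> 2 * exp (- (2 * ln (ln (a k))))"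
      proof -
        \<comment> \<open>The size of \<rho> relative to \<epsilon> enters here and makes the
          remainder exponent at least 2.\<close>
        have "2 * ln (ln (a k)) \<le> (\<rho> * \<epsilon>\<^sup>2 / 8) * ln (ln (a k))"
          using \<rho>\<epsilon> L by (intro mult_right_mono) auto
        then show ?thesis by simp
      qed
      finally show "norm (prob {\<omega> \<in> space M. \<epsilon> * \<psi> k < \<bar>Z k \<omega> - E k \<omega>\<bar>}) \<le> 2 * exp (- (2 * ln (ln (a k))))"
        by simp
    qed
  qed (auto simp: emeasure_eq_measure)
  moreover have "AE \<omega> in M. \<exists>\<^sub>F k in sequentially. (1 - \<epsilon>) * \<psi> k < E k \<omega>"
  proof (rule frequently_indep_vars_greater[OF ind], rule notI)
    assume sum: "summable (\<lambda>k. prob {\<omega> \<in> space M. (1 - \<epsilon>) * \<psi> k < E k \<omega>})"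
    \<comment> \<open>The Gaussian lower bound becomes exp (-L) / sqrt (2 pi) with exp L = Suc k *
      ln \<rho>, which is c times a harmonic term.\<close>
    define c where "c = 1 / (sqrt (2 * pi) * ln \<rho>)"
    have c: "0 < c" using \<rho>16 by (simp add: c_def)
    have "summable (\<lambda>k. c * inverse (real (Suc k)))"
    proof (rule summable_comparison_test'[OF sum, of K])
      fix k assume k: "K \<le> k"
      define L where "L = ln (ln (a k))"
      have "2 / \<epsilon>\<^sup>2 \<le> L" using K(1)[OF k] by (simp add: L_def)
      moreover have "0 < 2 / \<epsilon>\<^sup>2" using \<epsilon> by simp
      ultimately have L: "0 < L" by linarith
      define y where "y = sqrt (2 * L)"
      have y2: "y\<^sup>2 = 2 * L" using L by (simp add: y_def)
      have "(2 / \<epsilon>)\<^sup>2 \<le> 2 * L" using \<open>2 / \<epsilon>\<^sup>2 \<le> L\<close> by (simp add: power_divide)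
      then have "2 / \<epsilon> \<le> y" unfolding y_def by (rule real_le_rsqrt)
      \<comment> \<open>1 - \<epsilon> is at most (1 - \<epsilon>/2)^2: one factor absorbs the
        missing variance of E k, the other frees (\<epsilon>/2) y to pay for the shift by 1 in the
        lower tail bound.\<close>
      then have y\<epsilon>: "1 \<le> \<epsilon> / 2 * y" using \<epsilon> by (simp add: field_simps)
      have "4 / \<rho> \<le> \<epsilon>\<^sup>2 / 4" using \<rho>\<epsilon> \<rho>16 by (simp add: field_simps)
      moreover have "\<epsilon>\<^sup>2 \<le> \<epsilon>" using \<epsilon> by (simp add: power2_eq_square)
      moreover have "(1 - \<epsilon> / 2)\<^sup>2 = 1 - \<epsilon> + \<epsilon>\<^sup>2 / 4" by (simp add: power2_diff power_divide)
      ultimately have s1: "(1 - \<epsilon> / 2)\<^sup>2 \<le> 1 - 4 / \<rho>" using \<epsilon>(1) by linarith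
      have va: "0 < v * a k" using v a[of k] by simp
      have "(sqrt (v * a k) * (1 - \<epsilon> / 2))\<^sup>2 \<le> (\<sigma> k)\<^sup>2"
        using K(2)[OF k] mult_left_mono[OF s1, of "v * a k"] va by (simp add: power_mult_distrib)
      then have s2: "sqrt (v * a k) * (1 - \<epsilon> / 2) \<le> \<sigma> k"
        using E(2) by (rule power2_le_imp_le)
      moreover have "0 < sqrt (v * a k) * (1 - \<epsilon> / 2)" using va \<epsilon> by (intro mult_pos_pos) auto
      ultimately have s0: "0 < \<sigma> k" by linarith
      have \<psi>y: "\<psi> k = sqrt (v * a k) * y"
        by (simp add: \<psi>_def y_def L_def real_sqrt_mult[symmetric] mult_ac)
      have "(1 - \<epsilon>) * \<psi> k \<le> (1 - \<epsilon> / 2)\<^sup>2 * \<psi> k"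
        using \<psi>(1)[OF k] by (intro mult_right_mono) (auto simp: power2_diff power_divide)
      also have "\<dots> = (1 - \<epsilon> / 2) * y * (sqrt (v * a k) * (1 - \<epsilon> / 2))"
        by (simp add: \<psi>y power2_eq_square)
      also have "\<dots> \<le> (1 - \<epsilon> / 2) * y * \<sigma> k"
        using s2 \<epsilon> L by (intro mult_left_mono mult_nonneg_nonneg) (auto simp: y_def)
      finally have "(1 - \<epsilon>) * \<psi> k / \<sigma> k \<le> (1 - \<epsilon> / 2) * y"
        using s0 by (simp add: pos_divide_le_eq)
      then have "(1 - \<epsilon>) * \<psi> k / \<sigma> k + 1 \<le> y" using y\<epsilon> by (simp add: algebra_simps)
      moreover have pos: "0 \<le> (1 - \<epsilon>) * \<psi> k" using \<epsilon> \<psi>(1)[OF k] by simp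
      ultimately have le: "((1 - \<epsilon>) * \<psi> k / \<sigma> k + 1)\<^sup>2 \<le> y\<^sup>2"
        using s0 by (intro power_mono) auto
      have "ln (a k) = real (Suc k) * ln \<rho>"
        unfolding a_def using \<rho>16 by (subst ln_realpow) auto
      moreover have "exp L = ln (a k)" using a[of k] by (simp add: L_def)
      ultimately have "exp (- L) = inverse (real (Suc k) * ln \<rho>)" by (simp only: exp_minus)
      then have "c * inverse (real (Suc k)) = exp (- L) / sqrt (2 * pi)"
        by (simp only: c_def inverse_eq_divide) (simp add: mult_ac)
      also have "\<dots> \<le> exp (- ((1 - \<epsilon>) * \<psi> k / \<sigma> k + 1)\<^sup>2 / 2) / sqrt (2 * pi)"
        using le unfolding y2 by (intro divide_right_mono) auto
      also have "\<dots> \<le> prob {\<omega> \<in> space M. (1 - \<epsilon>) * \<psi> k < E k \<omega>}"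
        by (rule centered_gaussian_tail_lower[OF E(1) s0 pos])
      finally show "norm (c * inverse (real (Suc k))) \<le> prob {\<omega> \<in> space M. (1 - \<epsilon>) * \<psi> k < E k \<omega>}"
        using c by simp
    qed
    then have "summable (\<lambda>k. inverse (real (Suc k)))"
      using c by (simp add: summable_cmult_iff)
    then have "summable (\<lambda>k. inverse (real k))"
      by (subst (asm) summable_Suc_iff)
    then show False using not_summable_harmonic[where 'a=real] by (simp add: inverse_eq_divide)
  qed
  ultimately show ?thesis
  proof eventually_elim
    case (elim \<omega>)
    have "\<forall>\<^sub>F k in sequentially. (1 - \<epsilon>) * \<psi> k < E k \<omega> \<longrightarrow> (1 - 2 * \<epsilon>) * \<psi> k \<le> Z k \<omega>"
      using elim(1) by eventually_elim (auto simp: algebra_simps not_less)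
    with elim(2) have "\<exists>\<^sub>F k in sequentially. (1 - 2 * \<epsilon>) * \<psi> k \<le> Z k \<omega>"
      by (rule frequently_rev_mp)
    then show ?case by (simp add: \<psi>_def a_def)
  qed
qed

section \<open>The integrated moving average\<close>

lemma nn_integral_lborel_reflect:
  fixes g :: "real \<Rightarrow> ennreal"
  assumes [measurable]: "g \<in> borel_measurable borel"
  shows "(\<integral>\<^sup>+s. g (u - s) \<partial>lborel) = (\<integral>\<^sup>+s. g s \<partial>lborel)"
  using nn_integral_real_affine[of g "-1" u] by simp

lemma nn_integral_lborel_shift:
  fixes g :: "real \<Rightarrow> ennreal"
  assumes [measurable]: "g \<in> borel_measurable borel"
  shows "(\<integral>\<^sup>+s. g (s - r) \<partial>lborel) = (\<integral>\<^sup>+s. g s \<partial>lborel)"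
  using nn_integral_real_affine[of g 1 "- r"] by simp

locale mma_gaussian = gaussian_basis M \<pi> b \<Lambda>
  for M :: "'w measure" and \<pi> :: "'v::topological_space measure" and b :: real
    and \<Lambda> :: "('v \<times> real) set \<Rightarrow> 'w \<Rightarrow> real" +
  fixes f :: "'v \<times> real \<Rightarrow> real" and X :: "real \<Rightarrow> 'w \<Rightarrow> real"
  assumes b_pos: "0 < b" and kernel: "mma_kernel M \<pi> \<Lambda> f" and process: "mma_process M \<pi> \<Lambda> f X"
    and mass_pos: "0 < (\<integral>\<^sup>+ x. (kernel_mass f x)\<^sup>2 \<partial>\<pi>)"
    and mass_finite: "(\<integral>\<^sup>+ x. (kernel_mass f x)\<^sup>2 \<partial>\<pi>) < \<infinity>"
begin

sublocale base_pair: pair_sigma_finite \<pi> lborel ..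

lemma sigma_finite_N: "sigma_finite_measure N"
  unfolding N_def by (rule base_pair.P.sigma_finite_measure_axioms)

lemma space_N: "space N = UNIV"
  using sets_eq_imp_space_eq[OF sets_base] by (simp add: N_def space_pair_measure)

lemma f_measurable [measurable]: "f \<in> borel_measurable (\<pi> \<Otimes>\<^sub>M lborel)"
  using kernel unfolding mma_kernel_def by (elim conjE)

lemma f_integrable: "integrable (\<pi> \<Otimes>\<^sub>M lborel) f"
  using kernel unfolding mma_kernel_def by (elim conjE)

lemma f_nonneg: "0 \<le> f z"
proof -
  have "\<forall>z. 0 \<le> f z" using kernel unfolding mma_kernel_def by (elim conjE)
  then show ?thesis ..
qed

lemma f_negative: "v < 0 \<Longrightarrow> f (x, v) = 0"
proof -
  have "\<forall>x v. v < 0 \<longrightarrow> f (x, v) = 0" using kernel unfolding mma_kernel_def by (elim conjE)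
  then show "v < 0 \<Longrightarrow> f (x, v) = 0" by blast
qed

lemma space_base: "space \<pi> = UNIV"
  using sets_eq_imp_space_eq[OF sets_base] by simp

lemma f_section_measurable [measurable]: "(\<lambda>v. f (x, v)) \<in> borel_measurable borel"
  using measurable_Pair2[OF f_measurable, of x] by (simp add: space_base)

definition m :: real where "m = enn2real (\<integral>\<^sup>+ x. (kernel_mass f x)\<^sup>2 \<partial>\<pi>)"

lemma ennreal_m: "ennreal m = (\<integral>\<^sup>+ x. (kernel_mass f x)\<^sup>2 \<partial>\<pi>)"
  unfolding m_def using mass_finite by simp

lemma m_pos: "0 < m"
  unfolding m_def using mass_pos mass_finite by (simp add: enn2real_positive_iff)

lemma kernel_mass_eq: "kernel_mass f x = (\<integral>\<^sup>+ v. ennreal (f (x, v)) \<partial>lborel)"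
  unfolding kernel_mass_def
  by (intro nn_integral_cong) (auto simp: indicator_def f_negative)

lemma kernel_mass_measurable [measurable]: "kernel_mass f \<in> borel_measurable \<pi>"
proof -
  have "(\<lambda>x. \<integral>\<^sup>+ v. ennreal (f (x, v)) \<partial>lborel) \<in> borel_measurable \<pi>" by measurable
  then show ?thesis by (simp add: kernel_mass_eq[abs_def])
qed

definition shift :: "real \<Rightarrow> 'v \<times> real \<Rightarrow> real" where
  "shift u = (\<lambda>(x, s). f (x, u - s))"

lemma shift_measurable2 [measurable]: "(\<lambda>(u, z). shift u z) \<in> borel_measurable (lborel \<Otimes>\<^sub>M N)"
proof -
  have "(\<lambda>p. (fst (snd p), fst p - snd (snd p))) \<in> measurable (lborel \<Otimes>\<^sub>M (\<pi> \<Otimes>\<^sub>M lborel)) (\<pi> \<Otimes>\<^sub>M lborel)"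
    by measurable
  from measurable_compose[OF this f_measurable] show ?thesis
    unfolding N_def by (simp add: shift_def case_prod_beta')
qed

lemma shift_measurable [measurable]: "shift u \<in> borel_measurable N"
proof -
  have "(\<lambda>z. (\<lambda>(u, z). shift u z) (u, z)) \<in> borel_measurable N"
    by (rule measurable_Pair2[OF shift_measurable2]) simp
  then show ?thesis by simp
qed

lemma wiener_X: "0 \<le> u \<Longrightarrow> wiener (shift u) (X u)"
  using process unfolding mma_process_def shift_def N_def
  by (intro wiener_of_levy_integral b_pos) (auto simp: N_def)

lemma nn_integral_N:
  assumes "g \<in> borel_measurable N"
  shows "(\<integral>\<^sup>+z. g z \<partial>N) = (\<integral>\<^sup>+x. \<integral>\<^sup>+s. g (x, s) \<partial>lborel \<partial>\<pi>)"
  using lborel.nn_integral_fst[of g \<pi>] assms by (simp add: N_def)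

text \<open>Square integrability of the kernel comes from X 0 being a mean-square integral.
  Reflection and translation invariance of Lebesgue measure carry it to every real u, including
  negative ones, as the field locale requires.\<close>

lemma shift_square: "square_integrable N (shift u)"
  and integral_shift_square: "(\<integral>z. (shift u z)\<^sup>2 \<partial>N) = (\<integral>z. (shift 0 z)\<^sup>2 \<partial>N)"
proof -
  have eq: "(\<integral>\<^sup>+z. ennreal ((shift u z)\<^sup>2) \<partial>N) = (\<integral>\<^sup>+z. ennreal ((shift 0 z)\<^sup>2) \<partial>N)" for u
  proof -
    have "(\<integral>\<^sup>+z. ennreal ((shift u z)\<^sup>2) \<partial>N) = (\<integral>\<^sup>+x. \<integral>\<^sup>+s. ennreal ((f (x, s))\<^sup>2) \<partial>lborel \<partial>\<pi>)" for u
    proof -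
      have "(\<integral>\<^sup>+s. ennreal ((f (x, u - s))\<^sup>2) \<partial>lborel) = (\<integral>\<^sup>+s. ennreal ((f (x, s))\<^sup>2) \<partial>lborel)" for x
        using nn_integral_lborel_reflect[of "\<lambda>v. ennreal ((f (x, v))\<^sup>2)" u] by simp
      moreover have "(\<lambda>z. ennreal ((shift u z)\<^sup>2)) \<in> borel_measurable N" by measurable
      ultimately show ?thesis by (subst nn_integral_N) (simp_all add: shift_def)
    qed
    then show ?thesis by simp
  qed
  have 0: "square_integrable N (shift 0)" using wienerD(1)[OF wiener_X[of 0]] by simp
  have "(\<integral>\<^sup>+z. ennreal ((shift u z)\<^sup>2) \<partial>N) < \<infinity>"
    unfolding eq[of u] using square_integrableD(2)[OF 0] by (simp add: nn_integral_eq_integral)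
  then show "square_integrable N (shift u)"
    unfolding square_integrable_def by (auto intro!: integrableI_bounded)
  show "(\<integral>z. (shift u z)\<^sup>2 \<partial>N) = (\<integral>z. (shift 0 z)\<^sup>2 \<partial>N)"
    by (subst (1 2) integral_eq_nn_integral) (auto simp: eq[of u])
qed

section \<open>Stochastic Fubini for the integrated process\<close>

definition F :: "real \<Rightarrow> 'v \<times> real \<Rightarrow> real" where
  "F t z = (\<integral>u. indicator {0..t} u * shift u z \<partial>lborel)"

abbreviation W :: "real \<Rightarrow> 'w \<Rightarrow> real" where "W \<equiv> integrated_process X"

lemma W_eq: "W t \<omega> = (\<integral>u. indicator {0..t} u * X u \<omega> \<partial>lborel)"
  by (simp add: integrated_process_def set_lebesgue_integral_def)

text \<open>Joint measurability of X is given for times u >= 0. Composition with max 0 u extends it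
  to the line, and the indicator removes the altered values.\<close>

lemma X_measurable2: "(\<lambda>(u, \<omega>). indicator {0..t} u * X u \<omega>) \<in> borel_measurable (lborel \<Otimes>\<^sub>M M)"
proof -
  have X: "(\<lambda>(t, \<omega>). X t \<omega>) \<in> borel_measurable (restrict_space borel {0..} \<Otimes>\<^sub>M M)"
    using process by (simp add: mma_process_def)
  have "(\<lambda>p. max 0 (fst p)) \<in> measurable (lborel \<Otimes>\<^sub>M M) (restrict_space borel {0 :: real..})"
  proof (rule measurable_restrict_space2)
    have "fst \<in> borel_measurable ((lborel :: real measure) \<Otimes>\<^sub>M M)"
      using measurable_fst[of lborel M] by simp
    from borel_measurable_max[OF this borel_measurable_const]
    show "(\<lambda>p. max 0 (fst p) :: real) \<in> borel_measurable (lborel \<Otimes>\<^sub>M M)" .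
  qed auto
  then have "(\<lambda>p. (max 0 (fst p), snd p)) \<in> measurable (lborel \<Otimes>\<^sub>M M) (restrict_space borel {0 :: real..} \<Otimes>\<^sub>M M)"
    by (rule measurable_Pair[OF _ measurable_snd])
  from measurable_compose[OF this X]
  have [measurable]: "(\<lambda>p. X (max 0 (fst p)) (snd p)) \<in> borel_measurable (lborel \<Otimes>\<^sub>M M)" by simp
  have "(\<lambda>p. indicator {0..t} (fst p) * X (max 0 (fst p)) (snd p)) \<in> borel_measurable (lborel \<Otimes>\<^sub>M M)"
    by measurable
  also have "(\<lambda>p. indicator {0..t} (fst p) * X (max 0 (fst p)) (snd p)) = (\<lambda>(u, \<omega>). indicator {0..t} u * X u \<omega>)"
    by (auto simp: fun_eq_iff indicator_def max_def)
  finally show ?thesis .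
qed

context
  fixes t :: real
  assumes t: "0 \<le> t"
begin

interpretation \<Phi>: square_integrable_field N "\<lambda>u z. indicator {0..t} u * shift u z" t "\<integral>z. (shift 0 z)\<^sup>2 \<partial>N"
proof (intro square_integrable_field.intro sigma_finite_N square_integrable_field_axioms.intro t)
  show "(\<lambda>(u, z). indicator {0..t} u * shift u z) \<in> borel_measurable (lborel \<Otimes>\<^sub>M N)" by measurable
  show "square_integrable N (\<lambda>z. indicator {0..t} u * shift u z)" for u
    using square_integrable_lincomb[OF shift_square shift_square, of "indicator {0..t} u" u 0 u] by simp
  show "(\<integral>z. (indicator {0..t} u * shift u z)\<^sup>2 \<partial>N) \<le> (\<integral>z. (shift 0 z)\<^sup>2 \<partial>N)" for u
    using integral_shift_square[of u] by (simp add: indicator_def)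
qed simp

interpretation \<Xi>: square_integrable_field M "\<lambda>u \<omega>. indicator {0..t} u * X u \<omega>" t "b * (\<integral>z. (shift 0 z)\<^sup>2 \<partial>N)"
proof (intro square_integrable_field.intro square_integrable_field_axioms.intro t X_measurable2)
  show "sigma_finite_measure M" ..
  fix u
  have "square_integrable M (\<lambda>\<omega>. indicator {0..t} u * X u \<omega>) \<and>
      (\<integral>\<omega>. (indicator {0..t} u * X u \<omega>)\<^sup>2 \<partial>M) \<le> b * (\<integral>z. (shift 0 z)\<^sup>2 \<partial>N)"
  \<comment> \<open>Outside [0, t] the indicator makes the field zero; this matters for u < 0, where
    \<open>X u\<close> is unconstrained.\<close>
  proof (cases "u \<in> {0..t}")
    case True
    then have "0 \<le> u" by simp
    from wienerD[OF wiener_X[OF this]] True show ?thesis by (simp add: integral_shift_square[of u])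
  next
    case False
    then show ?thesis using b_pos by (simp add: square_integrable_def)
  qed
  then show "square_integrable M (\<lambda>\<omega>. indicator {0..t} u * X u \<omega>)"
    "(\<integral>\<omega>. (indicator {0..t} u * X u \<omega>)\<^sup>2 \<partial>M) \<le> b * (\<integral>z. (shift 0 z)\<^sup>2 \<partial>N)" by auto
qed simp

lemma F_square: "square_integrable N (F t)"
  using \<Phi>.integral_field_square_integrable by (simp add: F_def[abs_def])

lemma W_square: "square_integrable M (W t)"
  using \<Xi>.integral_field_square_integrable by (simp add: W_eq[abs_def])

lemma F_inner:
  assumes "square_integrable N g"
  shows "(\<integral>z. F t z * g z \<partial>N) = (\<integral>u. indicator {0..t} u * (\<integral>z. shift u z * g z \<partial>N) \<partial>lborel)"
  using \<Phi>.integral_field_inner[OF assms] by (simp add: F_def[abs_def] mult.assoc)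

lemma W_inner:
  assumes "square_integrable M Y"
  shows "(\<integral>\<omega>. W t \<omega> * Y \<omega> \<partial>M) = (\<integral>u. indicator {0..t} u * (\<integral>\<omega>. X u \<omega> * Y \<omega> \<partial>M) \<partial>lborel)"
  using \<Xi>.integral_field_inner[OF assms] by (simp add: W_eq[abs_def] mult.assoc)

text \<open>Both sides are integrals over u in [0, t], and their integrands agree by
  \<open>wiener_inner\<close> because X u is the integral of \<open>shift u\<close>.\<close>

lemma W_inner_wiener:
  assumes "wiener g Y"
  shows "(\<integral>\<omega>. W t \<omega> * Y \<omega> \<partial>M) = b * (\<integral>z. F t z * g z \<partial>N)"
proof -
  have "(\<integral>\<omega>. W t \<omega> * Y \<omega> \<partial>M) = (\<integral>u. b * (indicator {0..t} u * (\<integral>z. shift u z * g z \<partial>N)) \<partial>lborel)"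
    unfolding W_inner[OF wienerD(2)[OF assms]]
    by (intro Bochner_Integration.integral_cong refl)
      (auto simp: indicator_def wiener_inner[OF wiener_X assms])
  also have "\<dots> = b * (\<integral>z. F t z * g z \<partial>N)"
    by (simp add: F_inner[OF wienerD(1)[OF assms]])
  finally show ?thesis .
qed

text \<open>The exchange of integrals is used twice: with Y = W t, and then for each u with Y = X
  u.\<close>

lemma integral_W_square: "(\<integral>\<omega>. (W t \<omega>)\<^sup>2 \<partial>M) = b * (\<integral>z. (F t z)\<^sup>2 \<partial>N)"
proof -
  have "(\<integral>\<omega>. (W t \<omega>)\<^sup>2 \<partial>M) = (\<integral>u. indicator {0..t} u * (\<integral>\<omega>. X u \<omega> * W t \<omega> \<partial>M) \<partial>lborel)"
    using W_inner[OF W_square] by (simp add: power2_eq_square)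
  also have "\<dots> = (\<integral>u. b * (indicator {0..t} u * (\<integral>z. shift u z * F t z \<partial>N)) \<partial>lborel)"
    by (intro Bochner_Integration.integral_cong refl)
      (use W_inner_wiener[OF wiener_X] in \<open>auto simp: indicator_def mult.commute\<close>)
  also have "\<dots> = b * (\<integral>z. (F t z)\<^sup>2 \<partial>N)"
    using F_inner[OF F_square] by (simp add: power2_eq_square)
  finally show ?thesis .
qed

text \<open>Stochastic Fubini: \<open>W t\<close> and the Wiener integral of \<open>F t\<close> have the same inner products
  with every \<open>I h\<close>, and the same norm.\<close>

lemma wiener_W: "wiener (F t) (W t)"
proof -
  obtain h where h: "\<And>n. simple_finite N (h n)" "l2_tendsto N h (F t)"
    using square_integrable_simple_approx[OF F_square] by blast
  \<comment> \<open>After expanding the squares, the two norms and the inner product each match up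
    to the factor b.\<close>
  have "(\<integral>\<omega>. (I (h n) \<omega> - W t \<omega>)\<^sup>2 \<partial>M) = b * (\<integral>z. (h n z - F t z)\<^sup>2 \<partial>N)" for n
    unfolding integral_square_diff[OF I_square_integrable(1)[OF h(1)] W_square]
      integral_square_diff[OF simple_finite_integral_square(1)[OF h(1)] F_square]
    using W_inner_wiener[OF wiener_I[OF h(1)], of n] I_square_integrable(2)[OF h(1), of n] integral_W_square
    by (simp add: mult.commute algebra_simps)
  moreover have "(\<lambda>n. b * (\<integral>z. (h n z - F t z)\<^sup>2 \<partial>N)) \<longlonglongrightarrow> b * 0"
    by (intro tendsto_mult_left l2_tendstoD(3) h)
  ultimately have "l2_tendsto M (\<lambda>n. I (h n)) (W t)"
    by (simp add: l2_tendsto_def I_square_integrable(1)[OF h(1)] W_square)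
  then show ?thesis using h unfolding wiener_def by blast
qed

end


section \<open>Variance of increments and mass on strips\<close>

lemma AE_integrable_section: "AE x in \<pi>. integrable lborel (\<lambda>v. f (x, v))"
  by (rule base_pair.AE_integrable_fst'[OF f_integrable])

text \<open>For almost every x the kernel section is integrable, and then increments of F are
  nonnegative integrals to which Tonelli applies. For other x the Bochner integral may take its
  default value 0.\<close>

lemma F_section:
  assumes x: "integrable lborel (\<lambda>v. f (x, v))" and "0 \<le> s" "s \<le> t"
  shows "ennreal (F t (x, r) - F s (x, r)) = (\<integral>\<^sup>+u. indicator {s<..t} u * ennreal (f (x, u - r)) \<partial>lborel)"
    and "s = 0 \<Longrightarrow> ennreal (F t (x, r)) = (\<integral>\<^sup>+u. indicator {s..t} u * ennreal (f (x, u - r)) \<partial>lborel)"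
    and "0 \<le> F t (x, r) - F s (x, r)"
proof -
  have "integrable lborel (\<lambda>u. f (x, - r + 1 * u))"
    using x by (rule lborel_integrable_real_affine) simp
  then have "integrable lborel (\<lambda>u. f (x, u - r))" by simp
  then have int: "integrable lborel (\<lambda>u. indicator A u * f (x, u - r))" if "A \<in> sets borel" for A
    using integrable_real_mult_indicator[of A lborel "\<lambda>u. f (x, u - r)"] that by (simp add: mult.commute)
  have "F t (x, r) - F s (x, r) = (\<integral>u. indicator {0..t} u * f (x, u - r) - indicator {0..s} u * f (x, u - r) \<partial>lborel)"
    unfolding F_def shift_def using int by (subst Bochner_Integration.integral_diff) auto
  also have "\<dots> = (\<integral>u. indicator {s<..t} u * f (x, u - r) \<partial>lborel)"
    using assms by (intro Bochner_Integration.integral_cong) (auto simp: indicator_def)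
  finally have eq: "F t (x, r) - F s (x, r) = (\<integral>u. indicator {s<..t} u * f (x, u - r) \<partial>lborel)" .
  show "0 \<le> F t (x, r) - F s (x, r)"
    unfolding eq by (intro Bochner_Integration.integral_nonneg mult_nonneg_nonneg f_nonneg) simp
  have *: "ennreal (\<integral>u. indicator A u * f (x, u - r) \<partial>lborel) = (\<integral>\<^sup>+u. indicator A u * ennreal (f (x, u - r)) \<partial>lborel)"
    if "A \<in> sets borel" for A
    by (subst nn_integral_eq_integral[OF int[OF that], symmetric])
      (auto simp: f_nonneg ennreal_mult' ennreal_indicator[symmetric])
  show "ennreal (F t (x, r) - F s (x, r)) = (\<integral>\<^sup>+u. indicator {s<..t} u * ennreal (f (x, u - r)) \<partial>lborel)"
    unfolding eq by (rule *) simp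
  show "ennreal (F t (x, r)) = (\<integral>\<^sup>+u. indicator {s..t} u * ennreal (f (x, u - r)) \<partial>lborel)" if "s = 0"
    unfolding F_def shift_def that using *[of "{0..t}"] by simp
qed

text \<open>For fixed x the increment, as a function of r, is at most f_1(x) and has integral f_1(x)
  (t - s) over r, so its square has integral at most f_1(x)^2 (t - s).\<close>

lemma F_diff_bound:
  assumes st: "0 \<le> s" "s \<le> t"
  shows "(\<integral>z. (F t z - F s z)\<^sup>2 \<partial>N) \<le> m * (t - s)"
proof -
  have t: "0 \<le> t" using st by simp
  note sq = square_integrable_diff[OF F_square[OF t] F_square[OF st(1)]]
  note [measurable] = square_integrableD(1)[OF F_square[OF t]] square_integrableD(1)[OF F_square[OF st(1)]]
  have inner: "(\<integral>\<^sup>+r. ennreal ((F t (x, r) - F s (x, r))\<^sup>2) \<partial>lborel) \<le> (kernel_mass f x)\<^sup>2 * ennreal (t - s)"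
    if x: "integrable lborel (\<lambda>v. f (x, v))" for x
  proof -
    define J where "J r = (\<integral>\<^sup>+u. indicator {s<..t} u * ennreal (f (x, u - r)) \<partial>lborel)" for r
    have [measurable]: "J \<in> borel_measurable borel" unfolding J_def by measurable
    have J_le: "J r \<le> kernel_mass f x" for r
    proof -
      have "J r \<le> (\<integral>\<^sup>+u. ennreal (f (x, u - r)) \<partial>lborel)"
        unfolding J_def by (intro nn_integral_mono) (auto simp: indicator_def)
      also have "\<dots> = kernel_mass f x"
        unfolding kernel_mass_eq using nn_integral_lborel_shift[of "\<lambda>v. ennreal (f (x, v))" r] by simp
      finally show ?thesis .
    qed
    have "(\<integral>\<^sup>+r. J r \<partial>lborel) = (\<integral>\<^sup>+u. \<integral>\<^sup>+r. indicator {s<..t} u * ennreal (f (x, u - r)) \<partial>lborel \<partial>lborel)"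
      unfolding J_def by (rule lborel_pair.Fubini') measurable
    also have "\<dots> = (\<integral>\<^sup>+u. kernel_mass f x * indicator {s<..t} u \<partial>lborel)"
    proof (intro nn_integral_cong)
      fix u
      have "(\<integral>\<^sup>+r. indicator {s<..t} u * ennreal (f (x, u - r)) \<partial>lborel) =
          indicator {s<..t} u * (\<integral>\<^sup>+r. ennreal (f (x, u - r)) \<partial>lborel)"
        by (rule nn_integral_cmult) measurable
      also have "(\<integral>\<^sup>+r. ennreal (f (x, u - r)) \<partial>lborel) = kernel_mass f x"
        unfolding kernel_mass_eq using nn_integral_lborel_reflect[of "\<lambda>v. ennreal (f (x, v))" u] by simp
      finally show "(\<integral>\<^sup>+r. indicator {s<..t} u * ennreal (f (x, u - r)) \<partial>lborel) = kernel_mass f x * indicator {s<..t} u"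
        by (simp add: mult.commute)
    qed
    also have "\<dots> = kernel_mass f x * ennreal (t - s)"
      using st by (simp add: nn_integral_cmult_indicator)
    finally have J_int: "(\<integral>\<^sup>+r. J r \<partial>lborel) = kernel_mass f x * ennreal (t - s)" .
    have "(\<integral>\<^sup>+r. ennreal ((F t (x, r) - F s (x, r))\<^sup>2) \<partial>lborel) \<le> (\<integral>\<^sup>+r. kernel_mass f x * J r \<partial>lborel)"
    proof (rule nn_integral_mono)
      fix r
      have "ennreal ((F t (x, r) - F s (x, r))\<^sup>2) = J r * J r"
        using F_section(1,3)[OF x st, of r] by (simp add: power2_eq_square ennreal_mult J_def)
      also have "\<dots> \<le> kernel_mass f x * J r" by (intro mult_right_mono J_le) simp
      finally show "ennreal ((F t (x, r) - F s (x, r))\<^sup>2) \<le> kernel_mass f x * J r" .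
    qed
    also have "\<dots> = kernel_mass f x * (\<integral>\<^sup>+r. J r \<partial>lborel)"
      by (rule nn_integral_cmult) measurable
    also have "\<dots> = (kernel_mass f x)\<^sup>2 * ennreal (t - s)"
      by (simp add: J_int power2_eq_square mult.assoc)
    finally show ?thesis .
  qed
  have "ennreal (\<integral>z. (F t z - F s z)\<^sup>2 \<partial>N) = (\<integral>\<^sup>+z. ennreal ((F t z - F s z)\<^sup>2) \<partial>N)"
    by (rule nn_integral_eq_integral[symmetric, OF square_integrableD(2)[OF sq]]) simp
  also have "\<dots> = (\<integral>\<^sup>+x. \<integral>\<^sup>+r. ennreal ((F t (x, r) - F s (x, r))\<^sup>2) \<partial>lborel \<partial>\<pi>)"
    by (rule nn_integral_N) measurable
  also have "\<dots> \<le> (\<integral>\<^sup>+x. (kernel_mass f x)\<^sup>2 * ennreal (t - s) \<partial>\<pi>)"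
    using AE_integrable_section by (intro nn_integral_mono_AE) (auto elim!: eventually_mono dest: inner)
  also have "\<dots> = (\<integral>\<^sup>+x. (kernel_mass f x)\<^sup>2 \<partial>\<pi>) * ennreal (t - s)"
    by (rule nn_integral_multc) measurable
  also have "\<dots> = ennreal (m * (t - s))"
    unfolding ennreal_m[symmetric] using m_pos st by (simp add: ennreal_mult)
  finally show ?thesis
    using m_pos st by (subst (asm) ennreal_le_iff) auto
qed

text \<open>Monotone convergence twice, in v and then in x. Bounding the lag by n is what makes the
  boundary loss in \<open>F_strip_lower\<close> finite.\<close>

lemma truncated_mass_limit:
  "(\<lambda>n. \<integral>\<^sup>+x. (\<integral>\<^sup>+v. indicator {0..real n} v * ennreal (f (x, v)) \<partial>lborel)\<^sup>2 \<partial>\<pi>) \<longlonglongrightarrow> ennreal m"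
  unfolding ennreal_m
proof (rule nn_integral_LIMSEQ)
  define A where "A n x = (\<integral>\<^sup>+v. indicator {0..real n} v * ennreal (f (x, v)) \<partial>lborel)" for n x
  have inc: "incseq (\<lambda>n v. indicator {0..real n} v * ennreal (f (x, v)))" for x
    by (auto simp: incseq_def le_fun_def indicator_def)
  have mono: "A n x \<le> A n' x" if "n \<le> n'" for n n' x
    unfolding A_def using inc that by (intro nn_integral_mono) (auto simp: incseq_def le_fun_def)
  show "incseq (\<lambda>n x. (\<integral>\<^sup>+v. indicator {0..real n} v * ennreal (f (x, v)) \<partial>lborel)\<^sup>2)"
    unfolding A_def[symmetric] incseq_def le_fun_def power2_eq_square by (auto intro!: mult_mono mono)
  show "(\<lambda>x. (\<integral>\<^sup>+v. indicator {0..real n} v * ennreal (f (x, v)) \<partial>lborel)\<^sup>2) \<in> borel_measurable \<pi>" for n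
    by measurable
  fix x
  have "(\<lambda>n. A n x) \<longlonglongrightarrow> kernel_mass f x"
    unfolding A_def kernel_mass_eq
  proof (rule nn_integral_LIMSEQ[OF inc])
    fix v
    have "\<forall>\<^sub>F n in sequentially. indicator {0..real n} v * ennreal (f (x, v)) = ennreal (f (x, v))"
    proof (cases "v < 0")
      case True
      then show ?thesis by (simp add: f_negative)
    next
      case False
      have "indicator {0..real n} v * ennreal (f (x, v)) = ennreal (f (x, v))" if "nat \<lceil>v\<rceil> \<le> n" for n
        using that False by (simp add: nat_ceiling_le_eq)
      then show ?thesis unfolding eventually_sequentially by blast
    qed
    then show "(\<lambda>n. indicator {0..real n} v * ennreal (f (x, v))) \<longlonglongrightarrow> ennreal (f (x, v))"
      by (rule tendsto_eventually)
  qed measurable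
  then show "(\<lambda>n. (\<integral>\<^sup>+v. indicator {0..real n} v * ennreal (f (x, v)) \<partial>lborel)\<^sup>2) \<longlonglongrightarrow> (kernel_mass f x)\<^sup>2"
    unfolding A_def[symmetric] power2_eq_square by (intro tendsto_mult_ennreal) auto
qed

text \<open>Half-open in time, so that strips over adjacent intervals are disjoint.\<close>

definition strip :: "real \<Rightarrow> real \<Rightarrow> ('v \<times> real) set" where
  "strip s t = UNIV \<times> {s<..t}"

lemma strip_sets [measurable]: "strip s t \<in> sets N"
proof -
  have "(UNIV :: 'v set) \<in> sets \<pi>" using sets.top[of \<pi>] by (simp add: space_base)
  then show ?thesis unfolding strip_def N_def by (intro pair_measureI) auto
qed

lemma F_strip_square: "0 \<le> t \<Longrightarrow> square_integrable N (\<lambda>z. indicator (strip s t) z * F t z)"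
  using square_integrableD(1)[OF F_square[of t]]
  by (intro square_integrable_bound[OF F_square[of t], where c=1]) (auto simp: indicator_def)

text \<open>For r in (s, t - n] every lag in [0, n] is attained by a time in [0, t], so F t (x, r)
  is at least the kernel mass up to lag n. The loss w = n does not depend on s and t, hence is
  negligible on long strips.\<close>

lemma F_strip_lower:
  assumes "0 < \<delta>" "\<delta> < 1"
  shows "\<exists>w\<ge>0. \<forall>s t. 0 \<le> s \<longrightarrow> s + w \<le> t \<longrightarrow>
    (1 - \<delta>) * m * (t - w - s) \<le> (\<integral>z. (indicator (strip s t) z * F t z)\<^sup>2 \<partial>N)"
proof -
  define A where "A n = (\<integral>\<^sup>+x. (\<integral>\<^sup>+v. indicator {0..real n} v * ennreal (f (x, v)) \<partial>lborel)\<^sup>2 \<partial>\<pi>)" for n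
  have "(1 - \<delta>) * m < m" using assms m_pos by (simp add: algebra_simps)
  then have "ennreal ((1 - \<delta>) * m) < ennreal m" by (rule ennreal_lessI[OF m_pos])
  from order_tendstoD(1)[OF truncated_mass_limit this] obtain n where n: "ennreal ((1 - \<delta>) * m) \<le> A n"
    unfolding A_def eventually_sequentially by (meson less_imp_le order_refl)
  have "(1 - \<delta>) * m * (t - real n - s) \<le> (\<integral>z. (indicator (strip s t) z * F t z)\<^sup>2 \<partial>N)"
    if st: "0 \<le> s" "s + real n \<le> t" for s t
  proof -
    have t: "0 \<le> t" using st by simp
    note [measurable] = square_integrableD(1)[OF F_square[OF t]]
    define B where "B x = (\<integral>\<^sup>+v. indicator {0..real n} v * ennreal (f (x, v)) \<partial>lborel)" for x
    have [measurable]: "B \<in> borel_measurable \<pi>" unfolding B_def by measurable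
    have "ennreal ((1 - \<delta>) * m * (t - real n - s)) = ennreal ((1 - \<delta>) * m) * ennreal (t - real n - s)"
      using st assms m_pos by (subst ennreal_mult) auto
    also have "\<dots> \<le> A n * ennreal (t - real n - s)" by (intro mult_right_mono n) simp
    also have "\<dots> = (\<integral>\<^sup>+x. (B x)\<^sup>2 * ennreal (t - real n - s) \<partial>\<pi>)"
      unfolding A_def B_def[symmetric] by (rule nn_integral_multc[symmetric]) measurable
    also have "\<dots> \<le> (\<integral>\<^sup>+x. \<integral>\<^sup>+r. ennreal ((indicator (strip s t) (x, r) * F t (x, r))\<^sup>2) \<partial>lborel \<partial>\<pi>)"
      using AE_integrable_section
    proof (intro nn_integral_mono_AE, eventually_elim)
      fix x assume x: "integrable lborel (\<lambda>v. f (x, v))"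
      have "(B x)\<^sup>2 * ennreal (t - real n - s) = (\<integral>\<^sup>+r. (B x)\<^sup>2 * indicator {s<..t - real n} r \<partial>lborel)"
        using st by (subst nn_integral_cmult_indicator) auto
      also have "\<dots> \<le> (\<integral>\<^sup>+r. ennreal ((indicator (strip s t) (x, r) * F t (x, r))\<^sup>2) \<partial>lborel)"
      proof (rule nn_integral_mono)
        fix r
        show "(B x)\<^sup>2 * indicator {s<..t - real n} r \<le> ennreal ((indicator (strip s t) (x, r) * F t (x, r))\<^sup>2)"
        proof (cases "r \<in> {s<..t - real n}")
          case True
          have F: "ennreal (F t (x, r)) = (\<integral>\<^sup>+u. indicator {0..t} u * ennreal (f (x, u - r)) \<partial>lborel)"
            using F_section(2)[OF x order_refl t] by simp
          have "B x = (\<integral>\<^sup>+u. indicator {0..real n} (u - r) * ennreal (f (x, u - r)) \<partial>lborel)"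
            unfolding B_def
            using nn_integral_lborel_shift[of "\<lambda>v. indicator {0..real n} v * ennreal (f (x, v))" r] by simp
          also have "\<dots> \<le> ennreal (F t (x, r))"
            unfolding F using True st by (intro nn_integral_mono) (auto simp: indicator_def)
          finally have "(B x)\<^sup>2 \<le> (ennreal (F t (x, r)))\<^sup>2"
            unfolding power2_eq_square by (intro mult_mono) auto
          also have "\<dots> \<le> ennreal ((F t (x, r))\<^sup>2)"
            by (cases "0 \<le> F t (x, r)") (auto simp: power2_eq_square ennreal_mult ennreal_neg)
          also have "\<dots> = ennreal ((indicator (strip s t) (x, r) * F t (x, r))\<^sup>2)"
            using True by (simp add: strip_def)
          finally show ?thesis using True by simp
        qed simp
      qed
      finally show "(B x)\<^sup>2 * ennreal (t - real n - s) \<le>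
        (\<integral>\<^sup>+r. ennreal ((indicator (strip s t) (x, r) * F t (x, r))\<^sup>2) \<partial>lborel)" .
    qed
    also have "\<dots> = (\<integral>\<^sup>+z. ennreal ((indicator (strip s t) z * F t z)\<^sup>2) \<partial>N)"
      by (rule nn_integral_N[symmetric]) measurable
    also have "\<dots> = ennreal (\<integral>z. (indicator (strip s t) z * F t z)\<^sup>2 \<partial>N)"
      by (rule nn_integral_eq_integral[OF square_integrableD(2)[OF F_strip_square[OF t]]]) simp
    finally show ?thesis by (subst (asm) ennreal_le_iff) simp
  qed
  then show ?thesis by (intro exI[of _ "real n"]) simp
qed


lemma F_0: "F 0 z = 0"
  unfolding F_def
proof (rule integral_eq_zero_AE)
  show "AE u in lborel. indicator {0..0} u * shift u z = 0"
    using AE_lborel_singleton[of "0::real"] by eventually_elim simp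
qed

lemma W_0: "W 0 \<omega> = 0"
  unfolding W_eq
proof (rule integral_eq_zero_AE)
  show "AE u in lborel. indicator {0..0} u * X u \<omega> = 0"
    using AE_lborel_singleton[of "0::real"] by eventually_elim simp
qed

text \<open>Error budget in units of m T / \<rho>: at most 1 each for the truncation with \<delta> =
  1/\<rho>, for the boundary loss w <= \<rho>^k, and for the part of [0, T] before the strip. So G
  keeps 1 - 3/\<rho>, and its simple approximant 1 - 4/\<rho>.\<close>

lemma strip_approximants:
  assumes \<rho>: "16 \<le> \<rho>"
  shows "\<exists>h. (\<forall>k. simple_finite N (h k)) \<and> (\<forall>k l z. k \<noteq> l \<longrightarrow> h k z = 0 \<or> h l z = 0) \<and>
    (\<forall>\<^sub>F k in sequentially. m * \<rho> ^ Suc k * (1 - 4 / \<rho>) \<le> (\<integral>z. (h k z)\<^sup>2 \<partial>N)) \<and>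
    (\<forall>\<^sub>F k in sequentially. (\<integral>z. (F (\<rho> ^ Suc k) z - h k z)\<^sup>2 \<partial>N) \<le> 8 * m * \<rho> ^ Suc k / \<rho>)"
proof -
  define T where "T k = \<rho> ^ Suc k" for k
  have T: "0 < T k" for k using \<rho> by (simp add: T_def)
  define G where "G k z = indicator (strip (\<rho> ^ k) (T k)) z * F (T k) z" for k z
  have G: "square_integrable N (G k)" for k
    unfolding G_def by (rule F_strip_square) (use T[of k] in simp)
  have FT: "square_integrable N (F (T k))" for k using T[of k] by (intro F_square) simp
  have "\<exists>h. simple_finite N h \<and> (\<forall>z. G k z = 0 \<longrightarrow> h z = 0) \<and>
      (\<integral>z. (h z - G k z)\<^sup>2 \<partial>N) \<le> m * T k / \<rho> \<and> (\<integral>z. (G k z)\<^sup>2 \<partial>N) - m * T k / \<rho> \<le> (\<integral>z. (h z)\<^sup>2 \<partial>N)" for k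
  proof -
    have e: "0 < m * T k / \<rho>" using m_pos T[of k] \<rho> by simp
    obtain h where h: "\<And>n. simple_finite N (h n)" "l2_tendsto N h (G k)"
      "\<And>n z. G k z = 0 \<Longrightarrow> h n z = 0"
      using square_integrable_simple_approx[OF G[of k]] by (auto simp: space_N)
    have "\<forall>\<^sub>F n in sequentially. (\<integral>z. (h n z - G k z)\<^sup>2 \<partial>N) < m * T k / \<rho>"
      using order_tendstoD(2)[OF l2_tendstoD(3)[OF h(2)] e] .
    moreover have "\<forall>\<^sub>F n in sequentially. (\<integral>z. (G k z)\<^sup>2 \<partial>N) - m * T k / \<rho> < (\<integral>z. (h n z)\<^sup>2 \<partial>N)"
      by (rule order_tendstoD(1)[OF l2_tendsto_square[OF h(2)]]) (use e in simp)
    ultimately have "\<forall>\<^sub>F n in sequentially. (\<integral>z. (h n z - G k z)\<^sup>2 \<partial>N) < m * T k / \<rho> \<and>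
        (\<integral>z. (G k z)\<^sup>2 \<partial>N) - m * T k / \<rho> < (\<integral>z. (h n z)\<^sup>2 \<partial>N)"
      by (rule eventually_conj)
    then obtain n where "(\<integral>z. (h n z - G k z)\<^sup>2 \<partial>N) < m * T k / \<rho>"
        "(\<integral>z. (G k z)\<^sup>2 \<partial>N) - m * T k / \<rho> < (\<integral>z. (h n z)\<^sup>2 \<partial>N)"
      by (auto simp: eventually_sequentially)
    then show ?thesis using h by (intro exI[of _ "h n"]) (auto intro: less_imp_le)
  qed
  then have "\<exists>h. \<forall>k. simple_finite N (h k) \<and> (\<forall>z. G k z = 0 \<longrightarrow> h k z = 0) \<and>
      (\<integral>z. (h k z - G k z)\<^sup>2 \<partial>N) \<le> m * T k / \<rho> \<and> (\<integral>z. (G k z)\<^sup>2 \<partial>N) - m * T k / \<rho> \<le> (\<integral>z. (h k z)\<^sup>2 \<partial>N)"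
    by (intro choice allI)
  then obtain h where H: "\<forall>k. simple_finite N (h k) \<and> (\<forall>z. G k z = 0 \<longrightarrow> h k z = 0) \<and>
      (\<integral>z. (h k z - G k z)\<^sup>2 \<partial>N) \<le> m * T k / \<rho> \<and> (\<integral>z. (G k z)\<^sup>2 \<partial>N) - m * T k / \<rho> \<le> (\<integral>z. (h k z)\<^sup>2 \<partial>N)" ..
  have h: "simple_finite N (h k)" "G k z = 0 \<Longrightarrow> h k z = 0"
    "(\<integral>z. (h k z - G k z)\<^sup>2 \<partial>N) \<le> m * T k / \<rho>"
    "(\<integral>z. (G k z)\<^sup>2 \<partial>N) - m * T k / \<rho> \<le> (\<integral>z. (h k z)\<^sup>2 \<partial>N)" for k z
    using H by blast+
  \<comment> \<open>Approximants vanish wherever G does, and for k < l the strip of k ends at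
    \<rho>^(k+1) <= \<rho>^l, where that of l begins.\<close>
  have dis_less: "h k z = 0 \<or> h l z = 0" if "k < l" for k l z
  proof (rule ccontr)
    assume "\<not> ?thesis"
    then have "G k z \<noteq> 0" "G l z \<noteq> 0" using h(2) by blast+
    then have "snd z \<le> T k" "\<rho> ^ l < snd z"
      by (auto simp: G_def strip_def indicator_def split: if_splits)
    moreover have "T k \<le> \<rho> ^ l" unfolding T_def using \<rho> that by (intro power_increasing) auto
    ultimately show False by linarith
  qed
  have dis: "h k z = 0 \<or> h l z = 0" if "k \<noteq> l" for k l z
    using that dis_less[of k l z] dis_less[of l k z] by (cases "k < l") auto
  obtain w where w: "0 \<le> w" "\<And>s t. 0 \<le> s \<Longrightarrow> s + w \<le> t \<Longrightarrow>
      (1 - 1 / \<rho>) * m * (t - w - s) \<le> (\<integral>z. (indicator (strip s t) z * F t z)\<^sup>2 \<partial>N)"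
    using F_strip_lower[of "1 / \<rho>"] \<rho> by auto
  obtain K where K: "w < \<rho> ^ K" using real_arch_pow[of \<rho> w] \<rho> by auto
  have G_lower: "m * T k * (1 - 3 / \<rho>) \<le> (\<integral>z. (G k z)\<^sup>2 \<partial>N)" if k: "K \<le> k" for k
  proof -
    have "\<rho> ^ K \<le> \<rho> ^ k" using \<rho> k by (intro power_increasing) auto
    then have wk: "w \<le> \<rho> ^ k" using K by linarith
    have Tk: "T k = \<rho> * \<rho> ^ k" by (simp add: T_def)
    have "2 * \<rho> ^ k \<le> \<rho> * \<rho> ^ k" using \<rho> by (intro mult_right_mono) auto
    then have le: "\<rho> ^ k + w \<le> T k" unfolding Tk using wk by linarith
    have "(1 - 3 / \<rho>) \<le> (1 - 1 / \<rho>) * (1 - 2 / \<rho>)"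
      using \<rho> by (simp add: field_simps)
    then have "m * T k * (1 - 3 / \<rho>) \<le> m * T k * ((1 - 1 / \<rho>) * (1 - 2 / \<rho>))"
      using m_pos T[of k] by (intro mult_left_mono) auto
    also have "\<dots> = (1 - 1 / \<rho>) * m * (T k - \<rho> ^ k - \<rho> ^ k)"
      unfolding Tk using \<rho> by (simp add: field_simps)
    also have "\<dots> \<le> (1 - 1 / \<rho>) * m * (T k - w - \<rho> ^ k)"
      using wk \<rho> m_pos by (intro mult_left_mono mult_nonneg_nonneg) auto
    also have "\<dots> \<le> (\<integral>z. (G k z)\<^sup>2 \<partial>N)"
      unfolding G_def by (rule w(2)) (use le \<rho> in auto)
    finally show ?thesis .
  qed
  have "\<forall>\<^sub>F k in sequentially. m * T k * (1 - 4 / \<rho>) \<le> (\<integral>z. (h k z)\<^sup>2 \<partial>N)"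
    using eventually_ge_at_top[of K]
  proof eventually_elim
    fix k assume k: "K \<le> k"
    have "m * T k * (1 - 4 / \<rho>) = m * T k * (1 - 3 / \<rho>) - m * T k / \<rho>"
      using \<rho> by (simp add: field_simps)
    then show "m * T k * (1 - 4 / \<rho>) \<le> (\<integral>z. (h k z)\<^sup>2 \<partial>N)" using G_lower[OF k] h(4)[of k] by linarith
  qed
  moreover have "\<forall>\<^sub>F k in sequentially. (\<integral>z. (F (T k) z - h k z)\<^sup>2 \<partial>N) \<le> 8 * m * T k / \<rho>"
    using eventually_ge_at_top[of K]
  proof eventually_elim
    fix k assume k: "K \<le> k"
    \<comment> \<open>G is a restriction of F, so the squared distance is the difference of the
      squared norms, at most m T - m T (1 - 3/\<rho>).\<close>
    have eq: "(F (T k) z - G k z)\<^sup>2 = (F (T k) z)\<^sup>2 - (G k z)\<^sup>2" for z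
      by (auto simp: G_def indicator_def)
    have "(\<integral>z. (F (T k) z - G k z)\<^sup>2 \<partial>N) = (\<integral>z. (F (T k) z)\<^sup>2 \<partial>N) - (\<integral>z. (G k z)\<^sup>2 \<partial>N)"
      unfolding eq by (intro Bochner_Integration.integral_diff square_integrableD(2) FT G)
    moreover have "(\<integral>z. (F (T k) z)\<^sup>2 \<partial>N) \<le> m * T k"
      using F_diff_bound[of 0 "T k"] T[of k] by (simp add: F_0)
    moreover have "m * T k - m * T k * (1 - 3 / \<rho>) = 3 * (m * T k / \<rho>)"
      using \<rho> by (simp add: field_simps)
    ultimately have FG: "(\<integral>z. (F (T k) z - G k z)\<^sup>2 \<partial>N) \<le> 3 * (m * T k / \<rho>)"
      using G_lower[OF k] by linarith
    \<comment> \<open>The constant 8 is 2 * 3 + 2 * 1 in units of m T / \<rho>.\<close>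
    have "(\<integral>z. (F (T k) z - h k z)\<^sup>2 \<partial>N) \<le> 2 * (\<integral>z. (F (T k) z - G k z)\<^sup>2 \<partial>N) + 2 * (\<integral>z. (h k z - G k z)\<^sup>2 \<partial>N)"
      by (rule integral_square_diff_le[OF FT simple_finite_integral_square(1)[OF h(1)] G])
    also have "\<dots> \<le> 8 * (m * T k / \<rho>)" using FG h(3)[of k] by linarith
    finally show "(\<integral>z. (F (T k) z - h k z)\<^sup>2 \<partial>N) \<le> 8 * m * T k / \<rho>" by simp
  qed
  ultimately show ?thesis
    using h(1) dis unfolding T_def by (intro exI[of _ h] conjI) blast+
qed

text \<open>Almost every path of X is integrable on each [0, T], so W is an indefinite integral
  there. Continuity at t within the half-line is read off from [0, t + 1].\<close>

lemma W_continuous: "AE \<omega> in M. continuous_on {0..} (\<lambda>t. W t \<omega>)"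
proof -
  have "AE \<omega> in M. \<forall>t\<ge>0. set_integrable lborel {0..t} (\<lambda>u. X u \<omega>)"
    using process by (simp add: mma_process_def)
  then show ?thesis
  proof eventually_elim
    case (elim \<omega>)
    have c: "continuous_on {0..T} (\<lambda>t. W t \<omega>)" if T: "0 \<le> T" for T
    proof -
      have "(\<lambda>u. X u \<omega>) integrable_on {0..T}"
        using elim T by (intro set_borel_integral_eq_integral(1)) auto
      then have "continuous_on {0..T} (\<lambda>t. integral {0..t} (\<lambda>u. X u \<omega>))"
        by (rule indefinite_integral_continuous_1)
      moreover have "integral {0..t} (\<lambda>u. X u \<omega>) = W t \<omega>" if "t \<in> {0..T}" for t
        unfolding integrated_process_def using elim that by (intro set_borel_integral_eq_integral(2)[symmetric]) auto
      ultimately show ?thesis by (rule continuous_on_eq)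
    qed
    show ?case
      unfolding continuous_on_eq_continuous_within
    proof
      fix t :: real assume t: "t \<in> {0..}"
      have "at t within {0..} = at t within {0..t + 1}"
        by (rule at_within_nhd[of t "{..<t + 1}"]) auto
      then show "continuous (at t within {0..}) (\<lambda>t. W t \<omega>)"
        using c[of "t + 1"] t unfolding continuous_on_eq_continuous_within by auto
    qed
  qed
qed

section \<open>The iterated logarithm for the integrated process\<close>

lemma W_tail:
  assumes "0 \<le> s" "s < t" "0 \<le> x"
  shows "prob {\<omega> \<in> space M. x < \<bar>W t \<omega> - W s \<omega>\<bar>} \<le> 2 * exp (- x\<^sup>2 / (2 * (b * m * (t - s))))"
proof (rule wiener_tail)
  show "wiener (\<lambda>z. F t z - F s z) (\<lambda>\<omega>. W t \<omega> - W s \<omega>)"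
    using assms by (intro wiener_diff wiener_W) auto
  show "b * (\<integral>z. (F t z - F s z)\<^sup>2 \<partial>N) \<le> b * m * (t - s)"
    using F_diff_bound[of s t] assms b_pos by (simp add: mult.assoc)
  show "0 < b * m * (t - s)" using b_pos m_pos assms by simp
qed fact

text \<open>The times \<rho>^(k+1) tend to infinity, so a bound that holds for infinitely many k
  holds at arbitrarily large real times.\<close>

lemma W_lower:
  assumes \<epsilon>: "0 < \<epsilon>" "\<epsilon> < 1"
  shows "AE \<omega> in M. \<exists>\<^sub>F t in at_top. (1 - 2 * \<epsilon>) * sqrt (2 * (b * m) * t * ln (ln t)) \<le> W t \<omega>"
proof -
  define \<rho> where "\<rho> = 16 / \<epsilon>\<^sup>2"
  have "\<epsilon>\<^sup>2 \<le> 1" using \<epsilon> by (simp add: power_le_one)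
  then have \<rho>: "16 \<le> \<rho>" using \<epsilon> by (simp add: \<rho>_def field_simps)
  obtain h where h: "\<And>k. simple_finite N (h k)" "\<And>k l z. k \<noteq> l \<Longrightarrow> h k z = 0 \<or> h l z = 0"
    "\<forall>\<^sub>F k in sequentially. m * \<rho> ^ Suc k * (1 - 4 / \<rho>) \<le> (\<integral>z. (h k z)\<^sup>2 \<partial>N)"
    "\<forall>\<^sub>F k in sequentially. (\<integral>z. (F (\<rho> ^ Suc k) z - h k z)\<^sup>2 \<partial>N) \<le> 8 * m * \<rho> ^ Suc k / \<rho>"
    using strip_approximants[OF \<rho>] by blast
  have T: "0 \<le> \<rho> ^ Suc k" for k using \<rho> by simp
  have "AE \<omega> in M. \<exists>\<^sub>F k in sequentially.
    (1 - 2 * \<epsilon>) * sqrt (2 * (b * m) * \<rho> ^ Suc k * ln (ln (\<rho> ^ Suc k))) \<le> W (\<rho> ^ Suc k) \<omega>"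
  proof (rule lil_lower[where E="\<lambda>k. I (h k)" and \<sigma>="\<lambda>k. sqrt (b * (\<integral>z. (h k z)\<^sup>2 \<partial>N))"])
    show "0 < b * m" using b_pos m_pos by simp
    show "16 / \<epsilon>\<^sup>2 \<le> \<rho>" by (simp add: \<rho>_def)
    show "indep_vars (\<lambda>_. borel) (\<lambda>k. I (h k)) UNIV" by (rule indep_vars_I(1)[OF h(1,2)])
    show "random_variable borel (W (\<rho> ^ Suc k))" for k
      by (rule square_integrableD(1)[OF W_square[OF T]])
    show "centered_gaussian M (sqrt (b * (\<integral>z. (h k z)\<^sup>2 \<partial>N))) (I (h k))" for k
      by (rule centered_gaussian_I[OF h(1)])
    show "0 \<le> sqrt (b * (\<integral>z. (h k z)\<^sup>2 \<partial>N))" for k using b_pos by simp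
    show "\<forall>\<^sub>F k in sequentially. b * m * \<rho> ^ Suc k * (1 - 4 / \<rho>) \<le> (sqrt (b * (\<integral>z. (h k z)\<^sup>2 \<partial>N)))\<^sup>2"
      using h(3)
    proof eventually_elim
      case (elim k)
      then have "b * (m * \<rho> ^ Suc k * (1 - 4 / \<rho>)) \<le> b * (\<integral>z. (h k z)\<^sup>2 \<partial>N)"
        using b_pos by (intro mult_left_mono) auto
      also have "\<dots> = (sqrt (b * (\<integral>z. (h k z)\<^sup>2 \<partial>N)))\<^sup>2"
        using b_pos by simp
      finally show ?case by (simp only: mult.assoc)
    qed
    show "\<forall>\<^sub>F k in sequentially. \<forall>x\<ge>0. prob {\<omega> \<in> space M. x < \<bar>W (\<rho> ^ Suc k) \<omega> - I (h k) \<omega>\<bar>}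
      \<le> 2 * exp (- x\<^sup>2 / (2 * (8 * (b * m) * \<rho> ^ Suc k / \<rho>)))"
      using h(4)
    proof eventually_elim
      case (elim k)
      show ?case
      proof (intro allI impI wiener_tail)
        show "wiener (\<lambda>z. F (\<rho> ^ Suc k) z - h k z) (\<lambda>\<omega>. W (\<rho> ^ Suc k) \<omega> - I (h k) \<omega>)"
          by (intro wiener_diff wiener_W wiener_I T h)
        have "b * (\<integral>z. (F (\<rho> ^ Suc k) z - h k z)\<^sup>2 \<partial>N) \<le> b * (8 * m * \<rho> ^ Suc k / \<rho>)"
          using elim b_pos by (intro mult_left_mono) auto
        also have "\<dots> = 8 * (b * m) * \<rho> ^ Suc k / \<rho>" by simp
        finally show "b * (\<integral>z. (F (\<rho> ^ Suc k) z - h k z)\<^sup>2 \<partial>N) \<le> 8 * (b * m) * \<rho> ^ Suc k / \<rho>" .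
        show "0 < 8 * (b * m) * \<rho> ^ Suc k / \<rho>" using b_pos m_pos \<rho> by simp
      qed
    qed
  qed (use \<epsilon> in auto)
  then show ?thesis
  proof eventually_elim
    case (elim \<omega>)
    have lim: "filterlim (\<lambda>k. \<rho> ^ Suc k) at_top sequentially"
      using \<rho> by (intro filterlim_power_Suc_at_top) simp
    show ?case
    proof (rule ccontr)
      assume "\<not> ?case"
      then have "\<forall>\<^sub>F t in at_top. \<not> (1 - 2 * \<epsilon>) * sqrt (2 * (b * m) * t * ln (ln t)) \<le> W t \<omega>"
        by (simp add: frequently_def)
      from eventually_compose_filterlim[OF this lim] elim show False
        by (simp add: frequently_def)
    qed
  qed
qed

theorem W_lil: "AE \<omega> in M. Limsup at_top (\<lambda>t. ereal (\<bar>W t \<omega>\<bar> / sqrt (2 * b * m * t * ln (ln t)))) = 1"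
proof -
  \<comment> \<open>A countable sequence keeps the union of the exceptional sets null; the offset 2
    keeps every term below 1.\<close>
  define \<epsilon> :: "nat \<Rightarrow> real" where "\<epsilon> n = 1 / real (n + 2)" for n
  have \<epsilon>: "0 < \<epsilon> n" "\<epsilon> n < 1" for n by (auto simp: \<epsilon>_def)
  have \<epsilon>0: "\<epsilon> \<longlonglongrightarrow> 0"
    unfolding \<epsilon>_def using LIMSEQ_ignore_initial_segment[OF lim_1_over_n[where 'a=real], of 2] by simp
  have "AE \<omega> in M. \<forall>n. \<forall>\<^sub>F t in at_top. \<bar>W t \<omega>\<bar> \<le> (1 + 5 * \<epsilon> n) * sqrt (2 * (b * m) * t * ln (ln t))"
    unfolding AE_all_countable
  proof
    fix n
    show "AE \<omega> in M. \<forall>\<^sub>F t in at_top. \<bar>W t \<omega>\<bar> \<le> (1 + 5 * \<epsilon> n) * sqrt (2 * (b * m) * t * ln (ln t))"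
    proof (rule lil_upper)
      show "0 < b * m" using b_pos m_pos by simp
      show "random_variable borel (W t)" if "0 \<le> t" for t
        by (rule square_integrableD(1)[OF W_square[OF that]])
      show "0 < \<epsilon> n" by (rule \<epsilon>)
    qed (fact W_0 W_tail W_continuous)+
  qed
  moreover have "AE \<omega> in M. \<forall>n. \<exists>\<^sub>F t in at_top. (1 - 2 * \<epsilon> n) * sqrt (2 * (b * m) * t * ln (ln t)) \<le> W t \<omega>"
    unfolding AE_all_countable by (intro allI W_lower \<epsilon>)
  ultimately show ?thesis
  proof eventually_elim
    case (elim \<omega>)
    let ?q = "\<lambda>t. ereal (\<bar>W t \<omega>\<bar> / sqrt (2 * b * m * t * ln (ln t)))"
    \<comment> \<open>For t > e the iterated logarithm is positive, so near infinity the quotient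
      has a nonzero denominator.\<close>
    have pos: "\<forall>\<^sub>F t in at_top. 0 < sqrt (2 * b * m * t * ln (ln t))"
      using eventually_gt_at_top[of "exp 1 :: real"]
    proof eventually_elim
      case (elim t)
      then have "ln (exp 1) < ln t" by (subst ln_less_cancel_iff) (auto intro: less_trans[OF exp_gt_zero])
      then have "0 < ln (ln t)" by simp
      moreover have "0 < t" using elim less_trans[OF exp_gt_zero] by blast
      ultimately show ?case using b_pos m_pos by simp
    qed
    have upper: "Limsup at_top ?q \<le> ereal (1 + 5 * \<epsilon> n)" for n
    proof (rule Limsup_bounded)
      show "\<forall>\<^sub>F t in at_top. ?q t \<le> ereal (1 + 5 * \<epsilon> n)"
        using elim(1)[rule_format, of n] pos
        by eventually_elim (simp add: pos_divide_le_eq mult.assoc)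
    qed
    have lower: "ereal (1 - 2 * \<epsilon> n) \<le> Limsup at_top ?q" for n
    proof (rule ccontr)
      assume "\<not> ?thesis"
      then have "Limsup at_top ?q < ereal (1 - 2 * \<epsilon> n)" by simp
      from Limsup_lessD[OF this] pos
      have "\<forall>\<^sub>F t in at_top. \<not> (1 - 2 * \<epsilon> n) * sqrt (2 * (b * m) * t * ln (ln t)) \<le> W t \<omega>"
      proof eventually_elim
        case (elim t)
        then have "\<bar>W t \<omega>\<bar> < (1 - 2 * \<epsilon> n) * sqrt (2 * b * m * t * ln (ln t))"
          by (simp add: pos_divide_less_eq)
        then show ?case using abs_ge_self[of "W t \<omega>"] by (simp add: mult.assoc)
      qed
      then show False using elim(2) by (simp add: frequently_def)
    qed
    show ?case
    proof (rule antisym)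
      have "(\<lambda>n. ereal (1 + 5 * \<epsilon> n)) \<longlonglongrightarrow> ereal (1 + 5 * 0)"
        by (intro tendsto_intros \<epsilon>0)
      then have "Limsup at_top ?q \<le> ereal (1 + 5 * 0)"
        by (rule LIMSEQ_le_const) (use upper in blast)
      then show "Limsup at_top ?q \<le> 1" by (simp add: one_ereal_def)
      have "(\<lambda>n. ereal (1 - 2 * \<epsilon> n)) \<longlonglongrightarrow> ereal (1 - 2 * 0)"
        by (intro tendsto_intros \<epsilon>0)
      then have "ereal (1 - 2 * 0) \<le> Limsup at_top ?q"
        by (rule LIMSEQ_le_const2) (use lower in blast)
      then show "1 \<le> Limsup at_top ?q" by (simp add: one_ereal_def)
    qed
  qed
qed

end

theorem theorem3p3:
  fixes M :: "'w measure" and \<pi> :: "'v::topological_space measure"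
    and a b :: real and \<nu> :: "real measure"
    and \<Lambda> :: "('v \<times> real) set \<Rightarrow> 'w \<Rightarrow> real"
    and f :: "'v \<times> real \<Rightarrow> real" and X :: "real \<Rightarrow> 'w \<Rightarrow> real"
  assumes "lusin_space (euclidean :: 'v topology)"
    and "levy_basis M \<pi> a b \<nu> \<Lambda>"
    and "mma_kernel M \<pi> \<Lambda> f"
    and "mma_process M \<pi> \<Lambda> f X"
    and "a = 0" and "b > 0" and "\<nu> = null_measure borel"
    and "0 < (\<integral>\<^sup>+ x. (kernel_mass f x)\<^sup>2 \<partial>\<pi>)"
    and "(\<integral>\<^sup>+ x. (kernel_mass f x)\<^sup>2 \<partial>\<pi>) < \<infinity>"
  shows "AE \<omega> in M.
    Limsup at_top (\<lambda>t. ereal (\<bar>integrated_process X t \<omega>\<bar> /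
      sqrt (2 * b * enn2real (\<integral>\<^sup>+ x. (kernel_mass f x)\<^sup>2 \<partial>\<pi>) * t * ln (ln t)))) = 1"
proof -
  interpret mma_gaussian M \<pi> b \<Lambda> f X
    using assms by (intro mma_gaussian.intro gaussian_basis.intro mma_gaussian_axioms.intro) simp_all
  show ?thesis using W_lil unfolding m_def .
qed

end
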